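(* Let $u\in\mathcal{W}(I)$ be a solution of the unsteady Bingham pipe flow problem and let $z\in L^2(I;Y^* )$ be an associated dual flux, as described in the context. Then, for every $(y,\lambda)\in L^2(I;Y^* )\times\mathcal{W}(I)$ with $\operatorname{div}y=\partial_t\lambda-f$ in $L^2(I;V^* )$, $$\begin{aligned}&\tfrac1{2\nu}\|(y-z)-(\Pi_g(y)-\Pi_g(z))\|_Q^2+\bigl(g\|\nabla u\|_{1,Q}-(\Pi_g(y),\nabla u)_Q\bigr)\\&\quad+\tfrac\nu2\|\nabla(\lambda-u)\|_Q^2+\bigl(g\|\nabla\lambda\|_{1,Q}-(\Pi_g(z),\nabla\lambda)_Q\bigr)+\tfrac12\|(\lambda-u)(T)\|_H^2\\&=\tfrac1{2\nu}\|y-\Pi_g(y)-\nu\nabla\lambda\|_Q^2+\bigl(g\|\nabla\lambda\|_{1,Q}-(\Pi_g(y),\nabla\lambda)_Q\bigr)+\tfrac12\|\lambda(0)-u_0\|_H^2 .\end{aligned}$$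
   Context: $\Omega\subseteq\mathbb{R}^d$ is a bounded Lipschitz domain with boundary split into disjoint relatively open sets $\Gamma_D\ne\emptyset$ and $\Gamma_N$, $\overline\Gamma_D\cup\overline\Gamma_N=\partial\Omega$; $I=(0,T)$, $0<T<\infty$; $Q=I\times\Omega$; $\nu,g>0$. $V=W^{1,2}_D(\Omega)$ (zero trace on $\Gamma_D$) with norm $\|\nabla\cdot\|_{L^2(\Omega)}$, $H=L^2(\Omega)$, $Y=Y^*=L^2(\Omega;\mathbb{R}^d)$. $V\hookrightarrow H\cong H^*\hookrightarrow V^*$ is the usual evolution triple and $\mathcal{W}(I)=\{v\in L^2(I;V)\mid\partial_tv\in L^2(I;V^* )\}\hookrightarrow C^0(\overline I;H)$. $L=\nabla\colon V\to Y$, $\langle L^*y,v\rangle_V=\int_\Omega y\cdot\nabla v\,dx$ (pointwise in time); in $V^*$, $\operatorname{div}y$ means $-L^*y$. $\Pi_g\colon\mathbb{R}^d\to\mathbb{R}^d$ is the orthogonal projection onto the closed ball of radius $g$ centred at $0$, applied pointwise. $\|\cdot\|_Q$, $\|\cdot\|_{1,Q}$, $(\cdot,\cdot)_Q$ are the $L^2(Q)$-norm, the $L^1(Q)$-norm and the $L^2(Q)$ inner product. Problem: $f\in L^2(I;V^* )$, $u_0\in H$, $\phi(a)=\frac\nu2|a|^2+g|a|$ on $\mathbb{R}^d$, $E(t,v)=\int_\Omega\phi(\nabla v)\,dx-\langle f(t),v\rangle_V$ for $v\in V$. It is assumed that there is a solution $u\in\mathcal{W}(I)$ of $\partial_tu(t)+\partial_vE(t,u(t))\ni0$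 in $V^*$ for a.e. $t\in I$, $u(0)=u_0$ in $H$. The dual flux $z\in L^2(I;Y^* )$ (first component of a dual solution) satisfies $z\in\partial\phi(\nabla u)$ a.e. in $Q$ and $\partial_tu+L^*z=f$ in $L^2(I;V^* )$; the first condition is equivalent to $z-\Pi_g(z)=\nu\nabla u$ and $\Pi_g(z)\cdot\nabla u=g|\nabla u|$ a.e. in $Q$. *)

theory Defs
  imports "HOL-Analysis.Analysis"
begin

section \<open>Lipschitz domains and the boundary split\<close>

text \<open>Locally, the domain is the strict epigraph, in some unit direction \<open>e\<close>, of a Lipschitz
  function on the hyperplane orthogonal to \<open>e\<close>.\<close>

definition lipschitz_domain :: "'a::euclidean_space set \<Rightarrow> bool" where
  "lipschitz_domain \<Omega> \<longleftrightarrow> open \<Omega> \<and> connected \<Omega> \<and> \<Omega> \<noteq> {} \<and>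
     (\<forall>p\<in>frontier \<Omega>. \<exists>U e h L. open U \<and> p \<in> U \<and> norm e = 1 \<and> L-lipschitz_on {x. x \<bullet> e = 0} h \<and>
        \<Omega> \<inter> U = {x\<in>U. h (x - (x \<bullet> e) *\<^sub>R e) < x \<bullet> e})"

definition boundary_split :: "'a::euclidean_space set \<Rightarrow> 'a set \<Rightarrow> 'a set \<Rightarrow> bool" where
  "boundary_split \<Omega> \<Gamma>D \<Gamma>N \<longleftrightarrow>
     openin (top_of_set (frontier \<Omega>)) \<Gamma>D \<and> openin (top_of_set (frontier \<Omega>)) \<Gamma>N \<and>
     \<Gamma>D \<inter> \<Gamma>N = {} \<and> closure \<Gamma>D \<union> closure \<Gamma>N = frontier \<Omega>"


section \<open>Surface measure\<close>

text \<open>The \<open>k\<close>-dimensional Hausdorff measure for natural \<open>k\<close>. Empty covering sets are given weight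
  \<open>0\<close> separately, because \<open>0 ^ 0 = 1\<close>; thus \<open>k = 0\<close> gives the counting measure. Boundedness of the
  covering sets is required because \<^const>\<open>diameter\<close> is meaningless on unbounded sets.\<close>

definition hausdorff_weight :: "nat \<Rightarrow> 'a::metric_space set \<Rightarrow> real" where
  "hausdorff_weight k C = (if C = {} then 0 else unit_ball_vol (real k) * (diameter C / 2) ^ k)"

definition hausdorff_outer :: "nat \<Rightarrow> 'a::metric_space set \<Rightarrow> ennreal" where
  "hausdorff_outer k A =
     (SUP \<delta>\<in>{0<..}. INF C\<in>{C :: nat \<Rightarrow> 'a set. A \<subseteq> (\<Union>i. C i) \<and> (\<forall>i. bounded (C i) \<and> diameter (C i) \<le> \<delta>)}.
        \<Sum>i. ennreal (hausdorff_weight k (C i)))"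

definition hausdorff_measure :: "nat \<Rightarrow> 'a::metric_space measure" where
  "hausdorff_measure k = measure_of UNIV (sets borel) (hausdorff_outer k)"

definition surface_measure :: "'a::euclidean_space set \<Rightarrow> 'a measure" where
  "surface_measure \<Omega> = restrict_space (hausdorff_measure (DIM('a) - 1)) (frontier \<Omega>)"


section \<open>Lebesgue and Sobolev spaces on the domain\<close>

text \<open>Elements of function spaces on \<open>\<Omega>\<close> are represented by functions on the ambient space, of
  which only the almost-everywhere class on \<open>\<Omega>\<close> matters.\<close>

definition L2 :: "'a::euclidean_space set \<Rightarrow> ('a \<Rightarrow> 'b::euclidean_space) set" where
  "L2 \<Omega> = {v. v \<in> borel_measurable (lebesgue_on \<Omega>) \<and> integrable (lebesgue_on \<Omega>) (\<lambda>x. (norm (v x))\<^sup>2)}"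

definition L2_norm :: "'a::euclidean_space set \<Rightarrow> ('a \<Rightarrow> 'b::euclidean_space) \<Rightarrow> real" where
  "L2_norm \<Omega> v = sqrt (LINT x|lebesgue_on \<Omega>. (norm (v x))\<^sup>2)"

text \<open>All iterated partial derivatives exist and are (totally) differentiable.\<close>

definition smooth_fun :: "('a::euclidean_space \<Rightarrow> real) \<Rightarrow> bool" where
  "smooth_fun \<phi> \<longleftrightarrow> (\<forall>is. set is \<subseteq> Basis \<longrightarrow>
     (\<forall>x. foldr (\<lambda>i \<psi> x. frechet_derivative \<psi> (at x) i) is \<phi> differentiable (at x)))"

definition test_functions :: "'a::euclidean_space set \<Rightarrow> ('a \<Rightarrow> real) set" where
  "test_functions \<Omega> = {\<phi>. smooth_fun \<phi> \<and> compact (closure {x. \<phi> x \<noteq> 0}) \<and> closure {x. \<phi> x \<noteq> 0} \<subseteq> \<Omega>}"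

definition weak_gradient :: "'a::euclidean_space set \<Rightarrow> ('a \<Rightarrow> real) \<Rightarrow> ('a \<Rightarrow> 'a) \<Rightarrow> bool" where
  "weak_gradient \<Omega> v G \<longleftrightarrow> v \<in> L2 \<Omega> \<and> G \<in> L2 \<Omega> \<and>
     (\<forall>\<phi>\<in>test_functions \<Omega>. \<forall>i\<in>Basis.
        (LINT x|lebesgue_on \<Omega>. v x * frechet_derivative \<phi> (at x) i) =
        - (LINT x|lebesgue_on \<Omega>. (G x \<bullet> i) * \<phi> x))"

definition W12 :: "'a::euclidean_space set \<Rightarrow> ('a \<Rightarrow> real) set" where
  "W12 \<Omega> = {v. \<exists>G. weak_gradient \<Omega> v G}"

definition grad :: "'a::euclidean_space set \<Rightarrow> ('a \<Rightarrow> real) \<Rightarrow> 'a \<Rightarrow> 'a" where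
  "grad \<Omega> v = (SOME G. weak_gradient \<Omega> v G)"

definition W12_norm :: "'a::euclidean_space set \<Rightarrow> ('a \<Rightarrow> real) \<Rightarrow> real" where
  "W12_norm \<Omega> v = sqrt ((L2_norm \<Omega> v)\<^sup>2 + (L2_norm \<Omega> (grad \<Omega> v))\<^sup>2)"

text \<open>The graph of the trace operator from \<open>W12 \<Omega>\<close> to the square-integrable functions on the
  boundary: the continuous extension of the restriction of smooth functions to the boundary.\<close>

definition has_trace :: "'a::euclidean_space set \<Rightarrow> ('a \<Rightarrow> real) \<Rightarrow> ('a \<Rightarrow> real) \<Rightarrow> bool" where
  "has_trace \<Omega> v \<tau> \<longleftrightarrow> v \<in> W12 \<Omega> \<and> \<tau> \<in> borel_measurable (surface_measure \<Omega>) \<and>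
     (\<exists>\<phi> :: nat \<Rightarrow> 'a \<Rightarrow> real. (\<forall>n. smooth_fun (\<phi> n) \<and> \<phi> n \<in> W12 \<Omega>) \<and>
        (\<lambda>n. W12_norm \<Omega> (\<lambda>x. \<phi> n x - v x)) \<longlonglongrightarrow> 0 \<and>
        (\<lambda>n. \<integral>\<^sup>+x. ennreal ((\<phi> n x - \<tau> x)\<^sup>2) \<partial>surface_measure \<Omega>) \<longlonglongrightarrow> 0)"

definition V_space :: "'a::euclidean_space set \<Rightarrow> 'a set \<Rightarrow> ('a \<Rightarrow> real) set" where
  "V_space \<Omega> \<Gamma>D = {v. \<exists>\<tau>. has_trace \<Omega> v \<tau> \<and> (AE x in surface_measure \<Omega>. x \<in> \<Gamma>D \<longrightarrow> \<tau> x = 0)}"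

definition V_norm :: "'a::euclidean_space set \<Rightarrow> ('a \<Rightarrow> real) \<Rightarrow> real" where
  "V_norm \<Omega> v = L2_norm \<Omega> (grad \<Omega> v)"

text \<open>Functionals are total functions; only their values on \<open>V\<close> matter.\<close>

type_synonym 'a functional = "('a \<Rightarrow> real) \<Rightarrow> real"

definition V_dual :: "'a::euclidean_space set \<Rightarrow> 'a set \<Rightarrow> 'a functional set" where
  "V_dual \<Omega> \<Gamma>D = {\<zeta>.
     (\<forall>v\<in>V_space \<Omega> \<Gamma>D. \<forall>w\<in>V_space \<Omega> \<Gamma>D. \<zeta> (\<lambda>x. v x + w x) = \<zeta> v + \<zeta> w) \<and>
     (\<forall>v\<in>V_space \<Omega> \<Gamma>D. \<forall>c. \<zeta> (\<lambda>x. c * v x) = c * \<zeta> v) \<and>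
     (\<exists>C. \<forall>v\<in>V_space \<Omega> \<Gamma>D. \<bar>\<zeta> v\<bar> \<le> C * V_norm \<Omega> v)}"

definition V_dual_norm :: "'a::euclidean_space set \<Rightarrow> 'a set \<Rightarrow> 'a functional \<Rightarrow> real" where
  "V_dual_norm \<Omega> \<Gamma>D \<zeta> = (SUP v\<in>{v \<in> V_space \<Omega> \<Gamma>D. V_norm \<Omega> v \<le> 1}. \<bar>\<zeta> v\<bar>)"

definition eq_V_dual :: "'a::euclidean_space set \<Rightarrow> 'a set \<Rightarrow> 'a functional \<Rightarrow> 'a functional \<Rightarrow> bool" where
  "eq_V_dual \<Omega> \<Gamma>D \<zeta> \<xi> \<longleftrightarrow> (\<forall>v\<in>V_space \<Omega> \<Gamma>D. \<zeta> v = \<xi> v)"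

definition L_adj :: "'a::euclidean_space set \<Rightarrow> ('a \<Rightarrow> 'a) \<Rightarrow> 'a functional" where
  "L_adj \<Omega> y = (\<lambda>v. LINT x|lebesgue_on \<Omega>. y x \<bullet> grad \<Omega> v x)"

definition weak_div :: "'a::euclidean_space set \<Rightarrow> ('a \<Rightarrow> 'a) \<Rightarrow> 'a functional" where
  "weak_div \<Omega> y = (\<lambda>v. - L_adj \<Omega> y v)"


section \<open>Bochner spaces over the time interval\<close>

text \<open>\<open>bochner_L2 T X N\<close> is the space of strongly measurable, square-integrable functions from the
  interval \<open>(0, T)\<close> to the space with carrier \<open>X\<close> and norm \<open>N\<close>.\<close>

definition strongly_measurable ::
    "real \<Rightarrow> 'x::minus set \<Rightarrow> ('x \<Rightarrow> real) \<Rightarrow> (real \<Rightarrow> 'x) \<Rightarrow> bool" where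
  "strongly_measurable T X N u \<longleftrightarrow>
     (\<exists>s :: nat \<Rightarrow> real \<Rightarrow> 'x.
        (\<forall>n. simple_function (lebesgue_on {0<..<T}) (s n) \<and> s n ` {0<..<T} \<subseteq> X) \<and>
        (AE t in lebesgue_on {0<..<T}. (\<lambda>n. N (s n t - u t)) \<longlonglongrightarrow> 0))"

definition bochner_L2 :: "real \<Rightarrow> 'x::minus set \<Rightarrow> ('x \<Rightarrow> real) \<Rightarrow> (real \<Rightarrow> 'x) set" where
  "bochner_L2 T X N = {u. (AE t in lebesgue_on {0<..<T}. u t \<in> X) \<and> strongly_measurable T X N u \<and>
     integrable (lebesgue_on {0<..<T}) (\<lambda>t. (N (u t))\<^sup>2)}"

abbreviation L2_H :: "real \<Rightarrow> 'a::euclidean_space set \<Rightarrow> (real \<Rightarrow> 'a \<Rightarrow> real) set" where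
  "L2_H T \<Omega> \<equiv> bochner_L2 T (L2 \<Omega>) (L2_norm \<Omega>)"

abbreviation L2_Y :: "real \<Rightarrow> 'a::euclidean_space set \<Rightarrow> (real \<Rightarrow> 'a \<Rightarrow> 'a) set" where
  "L2_Y T \<Omega> \<equiv> bochner_L2 T (L2 \<Omega>) (L2_norm \<Omega>)"

abbreviation L2_V :: "real \<Rightarrow> 'a::euclidean_space set \<Rightarrow> 'a set \<Rightarrow> (real \<Rightarrow> 'a \<Rightarrow> real) set" where
  "L2_V T \<Omega> \<Gamma>D \<equiv> bochner_L2 T (V_space \<Omega> \<Gamma>D) (V_norm \<Omega>)"

abbreviation L2_V_dual :: "real \<Rightarrow> 'a::euclidean_space set \<Rightarrow> 'a set \<Rightarrow> (real \<Rightarrow> 'a functional) set" where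
  "L2_V_dual T \<Omega> \<Gamma>D \<equiv> bochner_L2 T (V_dual \<Omega> \<Gamma>D) (V_dual_norm \<Omega> \<Gamma>D)"

text \<open>The distributional time derivative is taken through the embeddings of \<open>V\<close> into \<open>H\<close>, identified
  with its dual, and of \<open>H\<close> into the dual of \<open>V\<close>. Membership in \<open>L2_H\<close> only records the first
  embedding: for \<open>v \<in> L2_V T \<Omega> \<Gamma>D\<close> it holds automatically by the Friedrichs inequality.\<close>

definition has_time_derivative ::
    "real \<Rightarrow> 'a::euclidean_space set \<Rightarrow> 'a set \<Rightarrow> (real \<Rightarrow> 'a \<Rightarrow> real) \<Rightarrow> (real \<Rightarrow> 'a functional) \<Rightarrow> bool" where
  "has_time_derivative T \<Omega> \<Gamma>D v \<xi> \<longleftrightarrow> v \<in> L2_H T \<Omega> \<and> \<xi> \<in> L2_V_dual T \<Omega> \<Gamma>D \<and>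
     (\<forall>\<theta>\<in>test_functions {0<..<T}. \<forall>w\<in>V_space \<Omega> \<Gamma>D.
        (LINT t|lebesgue_on {0<..<T}. deriv \<theta> t * (LINT x|lebesgue_on \<Omega>. v t x * w x)) =
        - (LINT t|lebesgue_on {0<..<T}. \<theta> t * \<xi> t w))"

definition W_space :: "real \<Rightarrow> 'a::euclidean_space set \<Rightarrow> 'a set \<Rightarrow> (real \<Rightarrow> 'a \<Rightarrow> real) set" where
  "W_space T \<Omega> \<Gamma>D = {v \<in> L2_V T \<Omega> \<Gamma>D. \<exists>\<xi>. has_time_derivative T \<Omega> \<Gamma>D v \<xi>}"

definition time_deriv ::
    "real \<Rightarrow> 'a::euclidean_space set \<Rightarrow> 'a set \<Rightarrow> (real \<Rightarrow> 'a \<Rightarrow> real) \<Rightarrow> real \<Rightarrow> 'a functional" where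
  "time_deriv T \<Omega> \<Gamma>D v = (SOME \<xi>. has_time_derivative T \<Omega> \<Gamma>D v \<xi>)"

definition continuous_into_H :: "real \<Rightarrow> 'a::euclidean_space set \<Rightarrow> (real \<Rightarrow> 'a \<Rightarrow> real) \<Rightarrow> bool" where
  "continuous_into_H T \<Omega> c \<longleftrightarrow> (\<forall>t\<in>{0..T}. c t \<in> L2 \<Omega> \<and>
     ((\<lambda>s. L2_norm \<Omega> (c s - c t)) \<longlongrightarrow> 0) (at t within {0..T}))"

text \<open>Point values in time of elements of \<open>W_space\<close> are those of the representative that is
  continuous on the closed interval with values in \<open>H\<close>.\<close>

definition continuous_rep ::
    "real \<Rightarrow> 'a::euclidean_space set \<Rightarrow> (real \<Rightarrow> 'a \<Rightarrow> real) \<Rightarrow> real \<Rightarrow> 'a \<Rightarrow> real" where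
  "continuous_rep T \<Omega> v = (SOME c. continuous_into_H T \<Omega> c \<and>
     (AE t in lebesgue_on {0<..<T}. AE x in lebesgue_on \<Omega>. c t x = v t x))"


section \<open>Norms on the space-time cylinder\<close>

text \<open>Elements of \<open>L2_Y\<close> are identified with square-integrable functions on the space-time cylinder;
  integrals and almost-everywhere statements over the cylinder are iterated accordingly (Fubini), so
  that they depend only on the Bochner class and not on a jointly measurable representative.\<close>

definition norm_Q :: "real \<Rightarrow> 'a::euclidean_space set \<Rightarrow> (real \<Rightarrow> 'a \<Rightarrow> 'b::euclidean_space) \<Rightarrow> real" where
  "norm_Q T \<Omega> y = sqrt (LINT t|lebesgue_on {0<..<T}. LINT x|lebesgue_on \<Omega>. (norm (y t x))\<^sup>2)"

definition norm1_Q :: "real \<Rightarrow> 'a::euclidean_space set \<Rightarrow> (real \<Rightarrow> 'a \<Rightarrow> 'b::euclidean_space) \<Rightarrow> real" where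
  "norm1_Q T \<Omega> y = (LINT t|lebesgue_on {0<..<T}. LINT x|lebesgue_on \<Omega>. norm (y t x))"

definition inner_Q ::
    "real \<Rightarrow> 'a::euclidean_space set \<Rightarrow> (real \<Rightarrow> 'a \<Rightarrow> 'b::euclidean_space) \<Rightarrow> (real \<Rightarrow> 'a \<Rightarrow> 'b) \<Rightarrow> real" where
  "inner_Q T \<Omega> y q = (LINT t|lebesgue_on {0<..<T}. LINT x|lebesgue_on \<Omega>. y t x \<bullet> q t x)"


section \<open>The unsteady Bingham problem\<close>

definition bingham_phi :: "real \<Rightarrow> real \<Rightarrow> 'a::euclidean_space \<Rightarrow> real" where
  "bingham_phi \<nu> g a = \<nu> / 2 * (norm a)\<^sup>2 + g * norm a"

definition bingham_energy ::
    "'a::euclidean_space set \<Rightarrow> real \<Rightarrow> real \<Rightarrow> (real \<Rightarrow> 'a functional) \<Rightarrow> real \<Rightarrow> ('a \<Rightarrow> real) \<Rightarrow> real" where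
  "bingham_energy \<Omega> \<nu> g f t v = (LINT x|lebesgue_on \<Omega>. bingham_phi \<nu> g (grad \<Omega> v x)) - f t v"

definition subdiff :: "('a::euclidean_space \<Rightarrow> real) \<Rightarrow> 'a \<Rightarrow> 'a set" where
  "subdiff F a = {p. \<forall>b. F a + p \<bullet> (b - a) \<le> F b}"

definition subdiff_V ::
    "'a::euclidean_space set \<Rightarrow> 'a set \<Rightarrow> (('a \<Rightarrow> real) \<Rightarrow> real) \<Rightarrow> ('a \<Rightarrow> real) \<Rightarrow> 'a functional set" where
  "subdiff_V \<Omega> \<Gamma>D F v =
     {\<zeta> \<in> V_dual \<Omega> \<Gamma>D. \<forall>w\<in>V_space \<Omega> \<Gamma>D. F v + \<zeta> (\<lambda>x. w x - v x) \<le> F w}"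

definition bingham_solution ::
    "real \<Rightarrow> 'a::euclidean_space set \<Rightarrow> 'a set \<Rightarrow> real \<Rightarrow> real \<Rightarrow> (real \<Rightarrow> 'a functional) \<Rightarrow> ('a \<Rightarrow> real) \<Rightarrow>
     (real \<Rightarrow> 'a \<Rightarrow> real) \<Rightarrow> bool" where
  "bingham_solution T \<Omega> \<Gamma>D \<nu> g f u0 u \<longleftrightarrow> u \<in> W_space T \<Omega> \<Gamma>D \<and>
     (AE t in lebesgue_on {0<..<T}. \<exists>\<zeta>\<in>subdiff_V \<Omega> \<Gamma>D (bingham_energy \<Omega> \<nu> g f t) (u t).
        eq_V_dual \<Omega> \<Gamma>D (\<lambda>w. time_deriv T \<Omega> \<Gamma>D u t w + \<zeta> w) (\<lambda>w. 0)) \<and>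
     (AE x in lebesgue_on \<Omega>. continuous_rep T \<Omega> u 0 x = u0 x)"

definition dual_flux ::
    "real \<Rightarrow> 'a::euclidean_space set \<Rightarrow> 'a set \<Rightarrow> real \<Rightarrow> real \<Rightarrow> (real \<Rightarrow> 'a functional) \<Rightarrow>
     (real \<Rightarrow> 'a \<Rightarrow> real) \<Rightarrow> (real \<Rightarrow> 'a \<Rightarrow> 'a) \<Rightarrow> bool" where
  "dual_flux T \<Omega> \<Gamma>D \<nu> g f u z \<longleftrightarrow> z \<in> L2_Y T \<Omega> \<and>
     (AE t in lebesgue_on {0<..<T}. AE x in lebesgue_on \<Omega>.
        z t x \<in> subdiff (bingham_phi \<nu> g) (grad \<Omega> (u t) x)) \<and>
     (AE t in lebesgue_on {0<..<T}.
        eq_V_dual \<Omega> \<Gamma>D (\<lambda>w. time_deriv T \<Omega> \<Gamma>D u t w + L_adj \<Omega> (z t) w) (f t))"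

definition proj_ball :: "real \<Rightarrow> 'a::euclidean_space \<Rightarrow> 'a" where
  "proj_ball g = closest_point (cball 0 g)"

end

theory Submission
  imports Defs
begin

text \<open>Pointwise, the optimality conditions for \<open>z\<close> let all terms of the identity cancel except
  \<open>(y - z) \<bullet> (grad lam - grad u)\<close>. By the two divergence constraints, the integral of this remainder is
  minus the duality pairing of \<open>e = lam - u\<close> with its time derivative, so what is left is the
  integration by parts formula in time for elements of \<^const>\<open>W_space\<close>.

  That formula is obtained without integrating vector-valued functions. For \<open>s\<close>, \<open>t\<close>, \<open>\<tau>\<close> outside a
  null set, \<open>(v t - v s, v \<tau>)\<close> is the integral of \<open>\<xi> r (v \<tau>)\<close> over \<open>{s..t}\<close>, where \<open>\<xi>\<close> is the time
  derivative of \<open>v\<close>. Taking \<open>\<tau> = s\<close> and \<open>\<tau> = t\<close> bounds the increments of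
  \<open>F t = (norm (v t))\<^sup>2 - 2 * (\<integral> r\<le>t. \<xi> r (v r))\<close> from both sides by integrals of
  \<open>norm (\<xi> r) * norm (v t - v r)\<close>, and the averages of these bounds over short windows vanish relative
  to the window length. Hence \<open>F\<close> is constant almost everywhere.\<close>


section \<open>Square-integrable functions\<close>

text \<open>The spaces are sets of representatives with seminorms, not Banach space types, which is
  why time regularity is reduced to real-valued integrals. The distributional derivative yields, for
  each fixed test element, an identity off a null set depending on it, whereas the energy argument
  tests with values of \<open>v\<close> itself; hence the work on a common null set. Constancy of
  \<open>F\<close> is read off from the integral of \<open>F (r + h) - F r\<close> over
  \<open>{a..<b}\<close>: it collapses to two windows of length \<open>h\<close> at the ends, so
  after division by \<open>h\<close> it tends to \<open>F b - F a\<close> at Lebesgue points, while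
  the two one-sided bounds push it to 0. These bounds vanish on average because \<open>v\<close>,
  being square-integrable with values in \<open>V\<close>, is continuous in the mean, and the dual
  norm of \<open>\<xi>\<close> is square-integrable. The energy identity is then used a second time:
  combined with the square of \<open>v t - v s\<close> that the bounds discard, it yields the
  continuous representative, and so determines the end values that \<open>continuous_rep\<close>
  only picks by choice.\<close>

lemma L2_D:
  assumes "v \<in> L2 \<Omega>"
  shows "v \<in> borel_measurable (lebesgue_on \<Omega>)" "integrable (lebesgue_on \<Omega>) (\<lambda>x. (norm (v x))\<^sup>2)"
  using assms by (auto simp: L2_def)

definition L2_ip :: "'a::euclidean_space set \<Rightarrow> ('a \<Rightarrow> 'b::euclidean_space) \<Rightarrow> ('a \<Rightarrow> 'b) \<Rightarrow> real" where
  "L2_ip \<Omega> v w = (LINT x|lebesgue_on \<Omega>. v x \<bullet> w x)"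

lemma L2_integrable_inner:
  assumes "v \<in> L2 \<Omega>" "w \<in> L2 \<Omega>"
  shows "integrable (lebesgue_on \<Omega>) (\<lambda>x. v x \<bullet> w x)"
proof (rule Bochner_Integration.integrable_bound)
  show "integrable (lebesgue_on \<Omega>) (\<lambda>x. (norm (v x))\<^sup>2 + (norm (w x))\<^sup>2)"
    using assms by (auto simp: L2_def)
  show "(\<lambda>x. v x \<bullet> w x) \<in> borel_measurable (lebesgue_on \<Omega>)"
    using assms by (auto simp: L2_def)
  have "\<bar>a \<bullet> b\<bar> \<le> (norm a)\<^sup>2 + (norm b)\<^sup>2" for a b :: 'b
  proof -
    have "\<bar>a \<bullet> b\<bar> \<le> norm a * norm b" by (rule Cauchy_Schwarz_ineq2)
    also have "\<dots> \<le> (norm a)\<^sup>2 + (norm b)\<^sup>2"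
      using sum_squares_bound[of "norm a" "norm b"] mult_nonneg_nonneg[OF norm_ge_zero[of a] norm_ge_zero[of b]]
      by linarith
    finally show ?thesis .
  qed
  then show "AE x in lebesgue_on \<Omega>. norm (v x \<bullet> w x) \<le> norm ((norm (v x))\<^sup>2 + (norm (w x))\<^sup>2)"
    by (intro AE_I2) simp
qed

lemma L2_add:
  assumes "v \<in> L2 \<Omega>" "w \<in> L2 \<Omega>" shows "(\<lambda>x. v x + w x) \<in> L2 \<Omega>"
proof -
  have "integrable (lebesgue_on \<Omega>) (\<lambda>x. (norm (v x))\<^sup>2 + (norm (w x))\<^sup>2 + 2 * (v x \<bullet> w x))"
    using assms L2_integrable_inner[OF assms] by (auto simp: L2_def)
  then have "integrable (lebesgue_on \<Omega>) (\<lambda>x. (norm (v x + w x))\<^sup>2)"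
    by (simp add: power2_norm_eq_inner inner_commute algebra_simps)
  with assms show ?thesis by (auto simp: L2_def)
qed

lemma L2_scale: "v \<in> L2 \<Omega> \<Longrightarrow> (\<lambda>x. c *\<^sub>R v x) \<in> L2 \<Omega>"
  by (auto simp: L2_def power_mult_distrib)

lemma L2_zero: "(\<lambda>x. 0) \<in> L2 \<Omega>"
  by (auto simp: L2_def)

lemma L2_diff:
  assumes "v \<in> L2 \<Omega>" "w \<in> L2 \<Omega>" shows "(\<lambda>x. v x - w x) \<in> L2 \<Omega>"
  using L2_add[OF assms(1) L2_scale[OF assms(2), of "-1"]] by simp

lemma L2_norm_nonneg: "L2_norm \<Omega> v \<ge> 0"
  by (simp add: L2_norm_def)

lemma L2_norm_sq: "(L2_norm \<Omega> v)\<^sup>2 = (LINT x|lebesgue_on \<Omega>. (norm (v x))\<^sup>2)"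
  by (simp add: L2_norm_def)

lemma L2_ip_self: "L2_ip \<Omega> v v = (L2_norm \<Omega> v)\<^sup>2"
  by (simp add: L2_norm_sq L2_ip_def power2_norm_eq_inner)

lemma L2_ip_commute: "L2_ip \<Omega> v w = L2_ip \<Omega> w v"
  by (simp add: L2_ip_def inner_commute)

lemma L2_ip_add_left:
  assumes "v \<in> L2 \<Omega>" "w \<in> L2 \<Omega>" "p \<in> L2 \<Omega>"
  shows "L2_ip \<Omega> (\<lambda>x. v x + w x) p = L2_ip \<Omega> v p + L2_ip \<Omega> w p"
  using L2_integrable_inner[OF assms(1,3)] L2_integrable_inner[OF assms(2,3)]
  by (simp add: L2_ip_def inner_add_left)

lemma L2_ip_diff_left:
  assumes "v \<in> L2 \<Omega>" "w \<in> L2 \<Omega>" "p \<in> L2 \<Omega>"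
  shows "L2_ip \<Omega> (\<lambda>x. v x - w x) p = L2_ip \<Omega> v p - L2_ip \<Omega> w p"
  using L2_integrable_inner[OF assms(1,3)] L2_integrable_inner[OF assms(2,3)]
  by (simp add: L2_ip_def inner_diff_left)

lemma L2_ip_diff_right:
  assumes "v \<in> L2 \<Omega>" "w \<in> L2 \<Omega>" "p \<in> L2 \<Omega>"
  shows "L2_ip \<Omega> p (\<lambda>x. v x - w x) = L2_ip \<Omega> p v - L2_ip \<Omega> p w"
  using L2_ip_diff_left[OF assms] by (simp add: L2_ip_commute)

lemma L2_ip_add_right:
  assumes "v \<in> L2 \<Omega>" "w \<in> L2 \<Omega>" "p \<in> L2 \<Omega>"
  shows "L2_ip \<Omega> p (\<lambda>x. v x + w x) = L2_ip \<Omega> p v + L2_ip \<Omega> p w"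
  using L2_ip_add_left[OF assms] by (simp add: L2_ip_commute)

lemma L2_ip_scale_left: "L2_ip \<Omega> (\<lambda>x. c *\<^sub>R v x) p = c * L2_ip \<Omega> v p"
  by (simp add: L2_ip_def)

lemma L2_ip_scale_right: "L2_ip \<Omega> p (\<lambda>x. c *\<^sub>R v x) = c * L2_ip \<Omega> p v"
  by (simp add: L2_ip_def)

lemma L2_norm_scale: "L2_norm \<Omega> (\<lambda>x. c *\<^sub>R v x) = \<bar>c\<bar> * L2_norm \<Omega> v"
  by (simp add: L2_norm_def power_mult_distrib real_sqrt_mult)

lemma L2_norm_diff_sq:
  assumes "v \<in> L2 \<Omega>" "w \<in> L2 \<Omega>"
  shows "(L2_norm \<Omega> (\<lambda>x. v x - w x))\<^sup>2 = (L2_norm \<Omega> v)\<^sup>2 + (L2_norm \<Omega> w)\<^sup>2 - 2 * L2_ip \<Omega> v w"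
  using assms L2_ip_commute[of \<Omega> w v]
  by (simp add: L2_ip_self[symmetric] L2_ip_diff_left L2_ip_diff_right L2_diff)

lemma L2_norm_add_sq:
  assumes "v \<in> L2 \<Omega>" "w \<in> L2 \<Omega>"
  shows "(L2_norm \<Omega> (\<lambda>x. v x + w x))\<^sup>2 = (L2_norm \<Omega> v)\<^sup>2 + (L2_norm \<Omega> w)\<^sup>2 + 2 * L2_ip \<Omega> v w"
  using assms L2_ip_commute[of \<Omega> w v]
  by (simp add: L2_ip_self[symmetric] L2_ip_add_left L2_ip_add_right L2_add)

lemma L2_norm_cong_AE:
  assumes "AE x in lebesgue_on \<Omega>. v x = w x" "v \<in> L2 \<Omega>" "w \<in> L2 \<Omega>"
  shows "L2_norm \<Omega> v = L2_norm \<Omega> w"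
  unfolding L2_norm_def
  by (intro arg_cong[where f = sqrt] integral_cong_AE) (use assms in \<open>auto simp: L2_def\<close>)

lemma L2_ip_cong_AE:
  assumes "AE x in lebesgue_on \<Omega>. v x = w x" "v \<in> L2 \<Omega>" "w \<in> L2 \<Omega>" "p \<in> L2 \<Omega>"
  shows "L2_ip \<Omega> p v = L2_ip \<Omega> p w"
  unfolding L2_ip_def
  by (intro integral_cong_AE) (use assms in \<open>auto simp: L2_def\<close>)

text \<open>The quadratic form in \<open>key\<close> is nonnegative; at \<open>s = b\<close>,
  \<open>t = c\<close> it gives the discriminant bound up to the factor \<open>b\<close>.\<close>

lemma L2_cauchy_schwarz:
  assumes v: "v \<in> L2 \<Omega>" and w: "w \<in> L2 \<Omega>"
  shows "\<bar>L2_ip \<Omega> v w\<bar> \<le> L2_norm \<Omega> v * L2_norm \<Omega> w"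
proof -
  define a b c where "a = (L2_norm \<Omega> v)\<^sup>2" "b = (L2_norm \<Omega> w)\<^sup>2" "c = L2_ip \<Omega> v w"
  have key: "0 \<le> s\<^sup>2 * a + t\<^sup>2 * b - 2 * s * t * c" for s t :: real
  proof -
    have "0 \<le> (L2_norm \<Omega> (\<lambda>x. s *\<^sub>R v x - t *\<^sub>R w x))\<^sup>2" by simp
    also have "\<dots> = s\<^sup>2 * a + t\<^sup>2 * b - 2 * s * t * c"
      by (simp add: L2_norm_diff_sq L2_scale v w L2_norm_scale L2_ip_scale_left L2_ip_scale_right
          power_mult_distrib a_b_c_def)
    finally show ?thesis .
  qed
  have ab: "a \<ge> 0" "b \<ge> 0" by (auto simp: a_b_c_def)
  have "c\<^sup>2 \<le> a * b"
  proof (cases "b = 0")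
    case False
    with ab have "b > 0" by simp
    moreover have "0 \<le> b * (a * b - c\<^sup>2)"
      using key[of b c] by (simp add: power2_eq_square algebra_simps)
    ultimately show ?thesis by (simp add: zero_le_mult_iff)
  next
    case True
    have "c = 0"
    proof (rule ccontr)
      assume "c \<noteq> 0"
      \<comment> \<open>With \<open>b = 0\<close> this value of \<open>t\<close> turns the form into
        \<open>a - (a + 1) = -1\<close>.\<close>
      with key[of 1 "(a + 1) / (2 * c)"] True ab show False by simp
    qed
    with True show ?thesis by simp
  qed
  also have "\<dots> = (L2_norm \<Omega> v * L2_norm \<Omega> w)\<^sup>2"
    by (simp add: a_b_c_def power_mult_distrib)
  finally show ?thesis
    unfolding a_b_c_def by (simp add: abs_le_square_iff[symmetric] L2_norm_nonneg abs_mult)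
qed

lemma L2_norm_triangle:
  assumes "v \<in> L2 \<Omega>" "w \<in> L2 \<Omega>"
  shows "L2_norm \<Omega> (\<lambda>x. v x + w x) \<le> L2_norm \<Omega> v + L2_norm \<Omega> w"
proof (rule power2_le_imp_le)
  show "(L2_norm \<Omega> (\<lambda>x. v x + w x))\<^sup>2 \<le> (L2_norm \<Omega> v + L2_norm \<Omega> w)\<^sup>2"
    using L2_cauchy_schwarz[OF assms]
    by (simp add: L2_norm_add_sq[OF assms] power2_sum)
qed (simp add: L2_norm_nonneg)

lemma L2_norm_minus_commute: "L2_norm \<Omega> (\<lambda>x. v x - w x) = L2_norm \<Omega> (\<lambda>x. w x - v x)"
  by (simp add: L2_norm_def norm_minus_commute)

lemma L2_norm_triangle_mid:
  assumes "v \<in> L2 \<Omega>" "w \<in> L2 \<Omega>" "p \<in> L2 \<Omega>"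
  shows "L2_norm \<Omega> (\<lambda>x. v x - w x) \<le> L2_norm \<Omega> (\<lambda>x. v x - p x) + L2_norm \<Omega> (\<lambda>x. p x - w x)"
  using L2_norm_triangle[OF L2_diff[OF assms(1,3)] L2_diff[OF assms(3,2)]] by simp

lemma L2_norm_le_diff:
  assumes "v \<in> L2 \<Omega>" "w \<in> L2 \<Omega>"
  shows "\<bar>L2_norm \<Omega> v - L2_norm \<Omega> w\<bar> \<le> L2_norm \<Omega> (\<lambda>x. v x - w x)"
  using L2_norm_triangle[OF L2_diff[OF assms] assms(2)]
        L2_norm_triangle[OF L2_diff[OF assms(2,1)] assms(1)] L2_norm_minus_commute[of \<Omega> v w]
  by simp

text \<open>Meant for the projection onto the ball and for the norm, both nonexpansive and vanishing
  at 0; measurability comes from continuity.\<close>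

lemma L2_lipschitz:
  fixes F :: "'b::euclidean_space \<Rightarrow> 'c::euclidean_space"
  assumes F: "\<And>a b. norm (F a - F b) \<le> norm (a - b)" and F0: "F 0 = 0" and v: "v \<in> L2 \<Omega>"
  shows "(\<lambda>x. F (v x)) \<in> L2 \<Omega>"
proof -
  have "continuous_on UNIV F"
    unfolding continuous_on_iff dist_norm using F by (metis le_less_trans)
  then have "F \<in> borel_measurable borel" by (rule borel_measurable_continuous_onI)
  then have meas: "(\<lambda>x. F (v x)) \<in> borel_measurable (lebesgue_on \<Omega>)"
    using v by (auto simp: L2_def)
  have "norm (F a) \<le> norm a" for a using F[of a 0] F0 by simp
  then have "(norm (F a))\<^sup>2 \<le> (norm a)\<^sup>2" for a by (simp add: power_mono)
  then have "integrable (lebesgue_on \<Omega>) (\<lambda>x. (norm (F (v x)))\<^sup>2)"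
    using meas by (intro Bochner_Integration.integrable_bound[OF L2_D(2)[OF v]]) auto
  with meas show ?thesis by (simp add: L2_def)
qed

lemma L2_norm_mono:
  assumes "v \<in> L2 \<Omega>" "w \<in> L2 \<Omega>" "\<And>x. norm (v x) \<le> norm (w x)"
  shows "L2_norm \<Omega> v \<le> L2_norm \<Omega> w"
  unfolding L2_norm_def
  by (intro real_sqrt_le_mono integral_mono) (use assms in \<open>auto simp: L2_def power_mono\<close>)

lemma L2_norm_lipschitz:
  fixes F :: "'b::euclidean_space \<Rightarrow> 'c::euclidean_space"
  assumes F: "\<And>a b. norm (F a - F b) \<le> norm (a - b)" and F0: "F 0 = 0"
    and v: "v \<in> L2 \<Omega>" and w: "w \<in> L2 \<Omega>"
  shows "L2_norm \<Omega> (\<lambda>x. F (v x) - F (w x)) \<le> L2_norm \<Omega> (\<lambda>x. v x - w x)"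
  by (intro L2_norm_mono L2_diff L2_lipschitz[of F, OF F F0] v w F)

lemma L2_const:
  assumes "bounded \<Omega>" "open \<Omega>"
  shows "(\<lambda>x. c) \<in> L2 \<Omega>"
proof -
  have "\<Omega> \<in> lmeasurable" by (rule lmeasurable_open[OF assms])
  then show ?thesis by (auto simp: L2_def finite_measure.integrable_const finite_measure_lebesgue_on)
qed

text \<open>Riesz-Fischer for the set-based space: a fast Cauchy subsequence converges almost
  everywhere, and Fatou's lemma turns the pointwise limit into a limit in norm.\<close>

lemma L2_complete:
  fixes v :: "nat \<Rightarrow> 'a::euclidean_space \<Rightarrow> 'b::euclidean_space"
  assumes v: "\<And>n. v n \<in> L2 \<Omega>"
    and cauchy: "\<And>e. e > 0 \<Longrightarrow> \<exists>N. \<forall>m\<ge>N. \<forall>n\<ge>N. L2_norm \<Omega> (\<lambda>x. v m x - v n x) < e"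
  obtains w where "w \<in> L2 \<Omega>" "(\<lambda>n. L2_norm \<Omega> (\<lambda>x. v n x - w x)) \<longlonglongrightarrow> 0"
proof -
  define M where "M = lebesgue_on \<Omega>"
  have [measurable]: "v n \<in> borel_measurable M" for n using v by (auto simp: L2_def M_def)
  have nn: "(\<integral>\<^sup>+x. ennreal ((norm (p x))\<^sup>2) \<partial>M) = ennreal ((L2_norm \<Omega> p)\<^sup>2)" if "p \<in> L2 \<Omega>" for p :: "'a \<Rightarrow> 'b"
    unfolding L2_norm_sq M_def using that by (intro nn_integral_eq_integral) (auto simp: L2_def)
  have "\<forall>k. \<exists>N. \<forall>m\<ge>N. \<forall>n\<ge>N. L2_norm \<Omega> (\<lambda>x. v m x - v n x) < (1/4)^k"
    using cauchy by simp
  then obtain N where N: "\<And>k m n. m \<ge> N k \<Longrightarrow> n \<ge> N k \<Longrightarrow> L2_norm \<Omega> (\<lambda>x. v m x - v n x) < (1/4)^k"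
    by metis
  \<comment> \<open>Adding up the thresholds makes \<open>r k\<close> and \<open>r (Suc k)\<close>
    exceed \<open>N k\<close>; the summand \<open>k\<close> sends them to infinity.\<close>
  define r where "r k = (\<Sum>i\<le>k. N i) + k" for k
  have rN: "r k \<ge> N k" "r (Suc k) \<ge> N k" "r k \<ge> k" for k
  proof -
    have "N k \<le> sum N {..k}" for k by (intro member_le_sum) auto
    from this[of k] show "r k \<ge> N k" "r (Suc k) \<ge> N k" "r k \<ge> k" by (auto simp: r_def)
  qed
  define d where "d k x = v (r (Suc k)) x - v (r k) x" for k x
  have [measurable]: "d k \<in> borel_measurable M" for k unfolding d_def by measurable
  have d: "d k \<in> L2 \<Omega>" for k unfolding d_def by (intro L2_diff v)
  have dsmall: "L2_norm \<Omega> (d k) \<le> (1/4)^k" for k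
    unfolding d_def using N[OF rN(2) rN(1)] by (simp add: less_imp_le)
  \<comment> \<open>The squared norms are at most \<open>(1/16)^k\<close>, so the weight
    \<open>4^k\<close> still leaves a geometric series; finiteness of the weighted sum then makes
    \<open>norm (d k x)\<close> decay like \<open>(1/2)^k\<close>.\<close>
  have "(\<integral>\<^sup>+x. (\<Sum>k. ennreal (4^k * (norm (d k x))\<^sup>2)) \<partial>M) = (\<Sum>k. (\<integral>\<^sup>+x. ennreal (4^k * (norm (d k x))\<^sup>2) \<partial>M))"
    by (rule nn_integral_suminf) simp
  also have "\<dots> \<le> (\<Sum>k. ennreal ((1/4)^k))"
  proof (intro suminf_le)
    fix k
    have "(\<integral>\<^sup>+x. ennreal (4^k * (norm (d k x))\<^sup>2) \<partial>M) = ennreal (4^k) * ennreal ((L2_norm \<Omega> (d k))\<^sup>2)"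
      unfolding nn[OF d, symmetric] by (simp add: ennreal_mult nn_integral_cmult)
    also have "\<dots> \<le> ennreal (4^k) * ennreal (((1/4)^k)\<^sup>2)"
      using dsmall[of k] by (intro mult_left_mono ennreal_leI power_mono) (auto simp: L2_norm_nonneg)
    also have "\<dots> = ennreal ((1/4)^k)"
      by (simp add: ennreal_mult[symmetric] power2_eq_square power_one_over)
    finally show "(\<integral>\<^sup>+x. ennreal (4^k * (norm (d k x))\<^sup>2) \<partial>M) \<le> ennreal ((1/4)^k)" .
  qed auto
  also have "\<dots> < \<infinity>"
    by (subst suminf_ennreal2) (auto intro: summable_geometric)
  finally have "AE x in M. (\<Sum>k. ennreal (4^k * (norm (d k x))\<^sup>2)) \<noteq> \<infinity>"
    by (intro nn_integral_PInf_AE) auto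
  then have conv: "AE x in M. convergent (\<lambda>k. v (r k) x)"
  proof (rule AE_mp, intro AE_I2 impI)
    fix x assume fin: "(\<Sum>k. ennreal (4^k * (norm (d k x))\<^sup>2)) \<noteq> \<infinity>"
    have "summable (\<lambda>k. 4^k * (norm (d k x))\<^sup>2)"
      by (rule summable_suminf_not_top) (use fin in auto)
    then have "(\<lambda>k. 4^k * (norm (d k x))\<^sup>2) \<longlonglongrightarrow> 0" by (rule summable_LIMSEQ_zero)
    then have "Bseq (\<lambda>k. 4^k * (norm (d k x))\<^sup>2)" using convergent_imp_Bseq convergentI by blast
    then obtain K where K: "K > 0" "\<And>k. norm (4^k * (norm (d k x))\<^sup>2) \<le> K" unfolding Bseq_def by blast
    have bnd: "norm (d k x) \<le> sqrt K * (1/2)^k" for k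
    proof (rule power2_le_imp_le)
      have "4^k * (norm (d k x))\<^sup>2 \<le> K" using K(2)[of k] by simp
      then show "(norm (d k x))\<^sup>2 \<le> (sqrt K * (1/2)^k)\<^sup>2"
        using K(1) by (simp add: power_mult_distrib field_simps power_even_eq[symmetric] power2_eq_square power_mult_distrib[symmetric])
    qed (use K(1) in auto)
    have "summable (\<lambda>k. d k x)"
      by (rule summable_comparison_test[of _ "\<lambda>k. sqrt K * (1/2)^k"]) (use bnd in \<open>auto intro!: summable_mult summable_geometric\<close>)
    then have "convergent (\<lambda>n. \<Sum>k<n. d k x)" by (simp add: summable_iff_convergent)
    moreover have "(\<Sum>k<n. d k x) = v (r n) x - v (r 0) x" for n
      unfolding d_def by (rule sum_lessThan_telescope)
    ultimately show "convergent (\<lambda>k. v (r k) x)"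
      using convergent_add[of "\<lambda>n. v (r n) x - v (r 0) x" "\<lambda>_. v (r 0) x"]
      by (simp add: convergent_const)
  qed
  define w where "w x = lim (\<lambda>k. v (r k) x)" for x
  have [measurable]: "w \<in> borel_measurable M" unfolding w_def by measurable
  have lim: "AE x in M. (\<lambda>k. v (r k) x) \<longlonglongrightarrow> w x"
    using conv by (auto simp: w_def convergent_LIMSEQ_iff)
  \<comment> \<open>Fatou along \<open>r\<close> with \<open>v n\<close> kept fixed. The bound with
    \<open>e = 1\<close> first puts the limit into the space, arbitrary \<open>e\<close> then gives
    convergence.\<close>
  have est: "(\<integral>\<^sup>+x. ennreal ((norm (v n x - w x))\<^sup>2) \<partial>M) \<le> ennreal (e\<^sup>2)"
    if "\<And>m. m \<ge> n0 \<Longrightarrow> L2_norm \<Omega> (\<lambda>x. v n x - v m x) \<le> e" "e \<ge> 0" for n n0 e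
  proof -
    have "(\<integral>\<^sup>+x. ennreal ((norm (v n x - w x))\<^sup>2) \<partial>M) = (\<integral>\<^sup>+x. liminf (\<lambda>k. ennreal ((norm (v n x - v (r k) x))\<^sup>2)) \<partial>M)"
      using lim
    proof (intro nn_integral_cong_AE, eventually_elim)
      case (elim x)
      have "(\<lambda>k. ennreal ((norm (v n x - v (r k) x))\<^sup>2)) \<longlonglongrightarrow> ennreal ((norm (v n x - w x))\<^sup>2)"
        using elim by (intro tendsto_intros) 
      then show ?case using lim_imp_Liminf[OF sequentially_bot] by metis
    qed
    also have "\<dots> \<le> liminf (\<lambda>k. \<integral>\<^sup>+x. ennreal ((norm (v n x - v (r k) x))\<^sup>2) \<partial>M)"
      by (rule nn_integral_liminf) simp
    also have "\<dots> \<le> limsup (\<lambda>k. \<integral>\<^sup>+x. ennreal ((norm (v n x - v (r k) x))\<^sup>2) \<partial>M)"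
      by (rule Liminf_le_Limsup) simp
    also have "\<dots> \<le> ennreal (e\<^sup>2)"
    proof (rule Limsup_bounded)
      have "\<forall>k\<ge>n0. (\<integral>\<^sup>+x. ennreal ((norm (v n x - v (r k) x))\<^sup>2) \<partial>M) \<le> ennreal (e\<^sup>2)"
      proof (intro allI impI)
        fix k assume "k \<ge> n0"
        then have "r k \<ge> n0" using rN(3)[of k] by simp
        then have "L2_norm \<Omega> (\<lambda>x. v n x - v (r k) x) \<le> e" by (rule that(1))
        then show "(\<integral>\<^sup>+x. ennreal ((norm (v n x - v (r k) x))\<^sup>2) \<partial>M) \<le> ennreal (e\<^sup>2)"
          using nn[OF L2_diff[OF v[of n] v[of "r k"]]]
          by (simp add: power_mono L2_norm_nonneg)
      qed
      then show "\<forall>\<^sub>F k in sequentially. (\<integral>\<^sup>+x. ennreal ((norm (v n x - v (r k) x))\<^sup>2) \<partial>M) \<le> ennreal (e\<^sup>2)"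
        unfolding eventually_sequentially by blast
    qed
    finally show ?thesis .
  qed
  have vw: "(\<lambda>x. v n x - w x) \<in> L2 \<Omega>" if "n \<ge> N 0" for n
  proof -
    have "(\<integral>\<^sup>+x. ennreal ((norm (v n x - w x))\<^sup>2) \<partial>M) \<le> ennreal (1\<^sup>2)"
      by (rule est[of "N 0"]) (use N[of 0 n] that in \<open>auto intro: less_imp_le\<close>)
    then have "integrable M (\<lambda>x. (norm (v n x - w x))\<^sup>2)"
      by (intro integrableI_bounded) (auto intro: le_less_trans)
    then show ?thesis by (auto simp: L2_def M_def[symmetric])
  qed
  have w: "w \<in> L2 \<Omega>"
    using L2_diff[OF v[of "N 0"] vw[of "N 0"]] by simp
  have "(\<lambda>n. L2_norm \<Omega> (\<lambda>x. v n x - w x)) \<longlonglongrightarrow> 0"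
  proof (rule LIMSEQ_I)
    fix e :: real assume e: "e > 0"
    obtain n0 where n0: "\<And>m n. m \<ge> n0 \<Longrightarrow> n \<ge> n0 \<Longrightarrow> L2_norm \<Omega> (\<lambda>x. v m x - v n x) < e / 2"
      using cauchy[of "e/2"] e by auto
    have "norm (L2_norm \<Omega> (\<lambda>x. v n x - w x) - 0) < e" if n: "n \<ge> n0" for n
    proof -
      have "ennreal ((L2_norm \<Omega> (\<lambda>x. v n x - w x))\<^sup>2) \<le> ennreal ((e/2)\<^sup>2)"
        unfolding nn[OF L2_diff[OF v w], symmetric]
        by (rule est[of n0]) (use n0 n e in \<open>auto intro: less_imp_le\<close>)
      then have "(L2_norm \<Omega> (\<lambda>x. v n x - w x))\<^sup>2 \<le> (e/2)\<^sup>2" by (simp add: ennreal_le_iff)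
      then have "L2_norm \<Omega> (\<lambda>x. v n x - w x) \<le> e/2" by (rule power2_le_imp_le) (use e in simp)
      then show ?thesis using e by (simp add: L2_norm_nonneg)
    qed
    then show "\<exists>n0. \<forall>n\<ge>n0. norm (L2_norm \<Omega> (\<lambda>x. v n x - w x) - 0) < e" by blast
  qed
  with w show ?thesis by (rule that)
qed


section \<open>Smooth bump functions and the fundamental lemma\<close>

text \<open>Polynomial multiples of the flat function \<open>exp (- (1 / t))\<close>, extended by
  zero. The polynomial in \<open>1 / t\<close> is carried along because every derivative again has
  this form.\<close>

definition exp_bump :: "real poly \<Rightarrow> real \<Rightarrow> real" where
  "exp_bump p t = (if t > 0 then poly p (1 / t) * exp (- (1 / t)) else 0)"

text \<open>Decay of \<open>exp_bump\<close> at 0, in the variable \<open>1 / t\<close>. The free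
  power \<open>k\<close> absorbs the factor \<open>x\<close> that \<open>pCons\<close> splits off,
  so that the induction closes.\<close>

lemma tendsto_power_poly_div_exp_0: "((\<lambda>x. x ^ k * poly p x / exp x) \<longlongrightarrow> (0::real)) at_top"
proof (induction p arbitrary: k)
  case (pCons a p)
  have "((\<lambda>x. a * (x ^ k / exp x) + x ^ Suc k * poly p x / exp x) \<longlongrightarrow> a * 0 + 0) at_top"
    by (intro tendsto_intros pCons.IH tendsto_power_div_exp_0)
  then show ?case by (simp add: algebra_simps add_divide_distrib)
qed simp

text \<open>Away from 0 the derivative is \<open>1 / t^2\<close> times the value of
  \<open>p - pderiv p\<close> at \<open>1 / t\<close> times the exponential;
  \<open>[:0, 0, 1:]\<close> is this square.\<close>

lemma exp_bump_has_derivative: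
  "(exp_bump p has_real_derivative exp_bump ([:0, 0, 1:] * (p - pderiv p)) t) (at t)"
proof -
  consider "t < 0" | "t > 0" | "t = 0" by linarith
  then show ?thesis
  proof cases
    case 1
    have "((\<lambda>_. 0) has_real_derivative 0) (at t)" by simp
    then have "(exp_bump p has_real_derivative 0) (at t)"
      by (rule has_field_derivative_transform_within_open[where S = "{..<0}"]) (use 1 in \<open>auto simp: exp_bump_def\<close>)
    with 1 show ?thesis by (simp add: exp_bump_def)
  next
    case 2
    have "((\<lambda>t. poly p (1 / t) * exp (- (1 / t))) has_real_derivative
       exp_bump ([:0, 0, 1:] * (p - pderiv p)) t) (at t)"
      using 2
      by (auto intro!: derivative_eq_intros DERIV_chain2[OF poly_DERIV] simp: exp_bump_def field_simps power2_eq_square)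
    then show ?thesis
      by (rule has_field_derivative_transform_within_open[where S = "{0<..}"]) (use 2 in \<open>auto simp: exp_bump_def\<close>)
  next
    case 3
    have "((\<lambda>h. exp_bump p h / h) \<longlongrightarrow> 0) (at 0)"
      unfolding filterlim_split_at
    proof (intro filterlim_split_at)
      show "((\<lambda>h. exp_bump p h / h) \<longlongrightarrow> 0) (at_left 0)"
        by (rule tendsto_eventually) (auto simp: eventually_at_filter exp_bump_def)
      \<comment> \<open>The right-hand difference quotient in the variable \<open>1 / h\<close>;
        division by \<open>h\<close> costs one more power.\<close>
      have "((\<lambda>h. inverse h ^ 1 * poly p (inverse h) / exp (inverse h)) \<longlongrightarrow> 0) (at_right 0)"
        by (rule filterlim_compose[OF tendsto_power_poly_div_exp_0 filterlim_inverse_at_top_right])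
      then show "((\<lambda>h. exp_bump p h / h) \<longlongrightarrow> 0) (at_right 0)"
        by (rule Lim_transform_eventually)
           (auto simp: eventually_at_filter exp_bump_def exp_minus field_simps)
    qed
    with 3 show ?thesis by (simp add: has_field_derivative_iff exp_bump_def)
  qed
qed

text \<open>A class of functions closed under partial derivatives, rich enough to contain smooth
  approximations of indicators of boxes.\<close>

inductive_set smooth_class :: "('a::euclidean_space \<Rightarrow> real) set" where
  const: "(\<lambda>x. c) \<in> smooth_class"
| bump: "(\<lambda>x. exp_bump p (\<alpha> * (x \<bullet> e) + \<beta>)) \<in> smooth_class"
| add: "\<phi> \<in> smooth_class \<Longrightarrow> \<psi> \<in> smooth_class \<Longrightarrow> (\<lambda>x. \<phi> x + \<psi> x) \<in> smooth_class"
| mult: "\<phi> \<in> smooth_class \<Longrightarrow> \<psi> \<in> smooth_class \<Longrightarrow> (\<lambda>x. \<phi> x * \<psi> x) \<in> smooth_class"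

lemma smooth_class_prod:
  assumes "finite I" "\<And>i. i \<in> I \<Longrightarrow> \<phi> i \<in> smooth_class"
  shows "(\<lambda>x. \<Prod>i\<in>I. \<phi> i x) \<in> smooth_class"
  using assms by (induction I rule: finite_induct) (auto intro: smooth_class.intros)

lemma smooth_class_has_derivative:
  assumes "\<phi> \<in> smooth_class"
  shows "\<exists>\<phi>'. (\<forall>i. \<phi>' i \<in> smooth_class) \<and> (\<forall>x. (\<phi> has_derivative (\<lambda>i. \<phi>' i x)) (at x))"
  using assms
proof induction
  case (const c)
  show ?case by (intro exI[of _ "\<lambda>_ _. 0"]) (auto intro: smooth_class.const)
next
  case (bump p \<alpha> e \<beta>)
  define q where "q = [:0, 0, 1:] * (p - pderiv p)"
  have "((\<lambda>x. exp_bump p (\<alpha> * (x \<bullet> e) + \<beta>)) has_derivative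
       (\<lambda>i. (\<alpha> * (i \<bullet> e)) * exp_bump q (\<alpha> * (x \<bullet> e) + \<beta>))) (at x)" for x
    unfolding q_def by (auto intro!: derivative_eq_intros has_derivative_eq_rhs[OF DERIV_compose_FDERIV[OF exp_bump_has_derivative]])
  moreover have "(\<lambda>x. (\<alpha> * (i \<bullet> e)) * exp_bump q (\<alpha> * (x \<bullet> e) + \<beta>)) \<in> smooth_class" for i
    by (intro smooth_class.intros)
  ultimately show ?case
    by (intro exI[of _ "\<lambda>i x. (\<alpha> * (i \<bullet> e)) * exp_bump q (\<alpha> * (x \<bullet> e) + \<beta>)"]) auto
next
  case (add \<phi> \<psi>)
  then obtain \<phi>' \<psi>' where "\<And>i. \<phi>' i \<in> smooth_class" "\<And>x. (\<phi> has_derivative (\<lambda>i. \<phi>' i x)) (at x)"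
    "\<And>i. \<psi>' i \<in> smooth_class" "\<And>x. (\<psi> has_derivative (\<lambda>i. \<psi>' i x)) (at x)" by blast
  then show ?case
    by (intro exI[of _ "\<lambda>i x. \<phi>' i x + \<psi>' i x"]) (auto intro!: smooth_class.intros derivative_intros)
next
  case (mult \<phi> \<psi>)
  then obtain \<phi>' \<psi>' where "\<And>i. \<phi>' i \<in> smooth_class" "\<And>x. (\<phi> has_derivative (\<lambda>i. \<phi>' i x)) (at x)"
    "\<And>i. \<psi>' i \<in> smooth_class" "\<And>x. (\<psi> has_derivative (\<lambda>i. \<psi>' i x)) (at x)" by blast
  with mult.hyps show ?case
    by (intro exI[of _ "\<lambda>i x. \<phi> x * \<psi>' i x + \<phi>' i x * \<psi> x"]) (auto intro!: smooth_class.intros derivative_intros)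
qed

text \<open>Partial derivatives stay in the class, so differentiability of its members settles all
  iterated derivatives at once.\<close>

lemma smooth_class_smooth:
  assumes "\<phi> \<in> smooth_class"
  shows "smooth_fun \<phi>"
proof -
  have D: "(\<lambda>x. frechet_derivative \<psi> (at x) i) \<in> smooth_class" "\<psi> differentiable (at x)"
    if psi: "\<psi> \<in> smooth_class" for \<psi> :: "'a \<Rightarrow> real" and i x
  proof -
    obtain \<psi>' where *: "\<And>i. \<psi>' i \<in> smooth_class" "\<And>x. (\<psi> has_derivative (\<lambda>i. \<psi>' i x)) (at x)"
      using smooth_class_has_derivative[OF psi] by blast
    then have "(\<lambda>x. frechet_derivative \<psi> (at x) i) = \<psi>' i"
      using frechet_derivative_at[OF *(2), symmetric] by auto
    with * show "(\<lambda>x. frechet_derivative \<psi> (at x) i) \<in> smooth_class" "\<psi> differentiable (at x)"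
      by (auto simp: differentiable_def)
  qed
  have "foldr (\<lambda>i \<psi> x. frechet_derivative \<psi> (at x) i) is \<phi> \<in> smooth_class" for "is"
    by (induction "is") (use assms D(1) in auto)
  then show ?thesis unfolding smooth_fun_def using D(2) by blast
qed

text \<open>Each factor \<open>exp (- (1 / (k * t)))\<close> tends to 1 as \<open>k\<close> grows if
  \<open>t > 0\<close>, and is replaced by 0 otherwise; the products thus tend to the indicator of
  the open box.\<close>

definition box_bump :: "real \<Rightarrow> 'a::euclidean_space \<Rightarrow> 'a \<Rightarrow> 'a \<Rightarrow> real" where
  "box_bump k a b x = (\<Prod>i\<in>Basis. exp_bump 1 (k * (x \<bullet> i - a \<bullet> i)) * exp_bump 1 (k * (b \<bullet> i - x \<bullet> i)))"

lemma box_bump_smooth: "smooth_fun (box_bump k a b)"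
proof -
  have "(\<lambda>x. \<Prod>i\<in>Basis. exp_bump 1 (k * (x \<bullet> i) + (- k * (a \<bullet> i))) * exp_bump 1 ((- k) * (x \<bullet> i) + k * (b \<bullet> i)))
     \<in> smooth_class"
    by (intro smooth_class_prod smooth_class.mult smooth_class.bump) auto
  also have "(\<lambda>x. \<Prod>i\<in>Basis. exp_bump 1 (k * (x \<bullet> i) + (- k * (a \<bullet> i))) * exp_bump 1 ((- k) * (x \<bullet> i) + k * (b \<bullet> i)))
     = box_bump k a b"
    by (simp add: box_bump_def fun_eq_iff algebra_simps)
  finally show ?thesis by (rule smooth_class_smooth)
qed

lemma box_bump_bounds: "0 \<le> box_bump k a b x" "box_bump k a b x \<le> 1"
  by (auto simp: box_bump_def exp_bump_def intro!: prod_nonneg prod_le_1 mult_le_one)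

lemma box_bump_zero:
  assumes "k > 0" "x \<notin> box a b" shows "box_bump k a b x = 0"
proof -
  obtain i where i: "i \<in> Basis" "x \<bullet> i - a \<bullet> i \<le> 0 \<or> b \<bullet> i - x \<bullet> i \<le> 0"
    using assms(2) by (force simp: mem_box)
  then have "exp_bump 1 (k * (x \<bullet> i - a \<bullet> i)) * exp_bump 1 (k * (b \<bullet> i - x \<bullet> i)) = 0"
    using assms(1) by (auto simp: exp_bump_def zero_less_mult_iff)
  with i(1) show ?thesis unfolding box_bump_def by (intro prod_zero) auto
qed

lemma box_bump_test:
  assumes "k > 0" "cbox a b \<subseteq> \<Omega>" shows "box_bump k a b \<in> test_functions \<Omega>"
proof -
  have "{x. box_bump k a b x \<noteq> 0} \<subseteq> cbox a b"
    using box_bump_zero[OF assms(1)] box_subset_cbox by blast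
  then have "closure {x. box_bump k a b x \<noteq> 0} \<subseteq> cbox a b" by (rule closure_minimal[OF _ closed_cbox])
  moreover from this have "compact (closure {x. box_bump k a b x \<noteq> 0})"
    by (meson bounded_cbox bounded_subset compact_closure closure_subset order_trans)
  ultimately show ?thesis using assms(2) box_bump_smooth unfolding test_functions_def by blast
qed

lemma box_bump_tendsto: "(\<lambda>n. box_bump (real (Suc n)) a b x) \<longlonglongrightarrow> indicat_real (box a b) x"
proof (cases "x \<in> box a b")
  case True
  have "(\<lambda>n. exp_bump 1 (real (Suc n) * t)) \<longlonglongrightarrow> 1" if "t > 0" for t
  proof -
    have "(\<lambda>n. exp (- (1 / t * inverse (real (Suc n))))) \<longlonglongrightarrow> exp (- (1 / t * 0))"
      by (intro tendsto_intros LIMSEQ_inverse_real_of_nat)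
    moreover have "exp_bump 1 (real (Suc n) * t) = exp (- (1 / t * inverse (real (Suc n))))" for n
      using that by (simp add: exp_bump_def divide_simps del: of_nat_Suc)
    ultimately show ?thesis by simp
  qed
  then have "(\<lambda>n. box_bump (real (Suc n)) a b x) \<longlonglongrightarrow> (\<Prod>i\<in>(Basis::'a set). 1 * 1)"
    unfolding box_bump_def using True by (intro tendsto_intros) (auto simp: mem_box)
  with True show ?thesis by simp
qed (simp add: box_bump_zero)

section \<open>Calculus with smooth functions and test functions\<close>

lemma smooth_fun_differentiable: "smooth_fun \<phi> \<Longrightarrow> \<phi> differentiable (at x)"
  unfolding smooth_fun_def by (drule spec[of _ "[]"]) simp

lemma smooth_fun_continuous: "smooth_fun \<phi> \<Longrightarrow> continuous_on A \<phi>"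
  by (metis smooth_fun_differentiable differentiable_imp_continuous_within continuous_at_imp_continuous_on)

lemma smooth_fun_deriv:
  assumes "smooth_fun \<phi>" "i \<in> Basis"
  shows "smooth_fun (\<lambda>x. frechet_derivative \<phi> (at x) i)"
  unfolding smooth_fun_def
proof (intro allI impI)
  fix "is" :: "'a list" and x assume "set is \<subseteq> Basis"
  \<comment> \<open>\<open>foldr\<close> applies the last list entry first, hence \<open>i\<close>
    is appended at the end.\<close>
  with assms show "foldr (\<lambda>i \<psi> x. frechet_derivative \<psi> (at x) i) is (\<lambda>x. frechet_derivative \<phi> (at x) i) differentiable at x"
    unfolding smooth_fun_def by (auto dest!: spec[of _ "is @ [i]"])
qed

text \<open>Meant for antiderivatives: a nonempty list of partials starts by differentiating
  \<open>\<phi>\<close> once, after which the smoothness of that partial takes over.\<close>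

lemma smooth_fun_step:
  assumes "\<And>x. \<phi> differentiable (at x)" "\<And>i. i \<in> Basis \<Longrightarrow> smooth_fun (\<lambda>x. frechet_derivative \<phi> (at x) i)"
  shows "smooth_fun \<phi>"
  unfolding smooth_fun_def
proof (intro allI impI)
  fix "is" :: "'a list" and x assume "set is \<subseteq> Basis"
  then show "foldr (\<lambda>i \<psi> x. frechet_derivative \<psi> (at x) i) is \<phi> differentiable at x"
    by (cases "is" rule: rev_cases) (use assms in \<open>auto simp: smooth_fun_def\<close>)
qed

text \<open>Iterated partials commute with linear combinations, by induction on the list;
  differentiability for the shorter list feeds each step.\<close>

lemma smooth_fun_comb:
  assumes "smooth_fun \<phi>" "smooth_fun \<psi>"
  shows "smooth_fun (\<lambda>x. \<phi> x + c * \<psi> x)"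
proof -
  define D where "D = foldr (\<lambda>i (\<psi>::'a \<Rightarrow> real) x. frechet_derivative \<psi> (at x) i)"
  have diff: "D is \<phi> differentiable (at x)" "D is \<psi> differentiable (at x)" if "set is \<subseteq> Basis" for "is" x
    using assms that unfolding smooth_fun_def D_def by auto
  have "D is (\<lambda>x. \<phi> x + c * \<psi> x) = (\<lambda>x. D is \<phi> x + c * D is \<psi> x)" if "set is \<subseteq> Basis" for "is"
    using that
  proof (induction "is")
    case (Cons i "is")
    have "((\<lambda>x. D is \<phi> x + c * D is \<psi> x) has_derivative
       (\<lambda>h. frechet_derivative (D is \<phi>) (at x) h + c * frechet_derivative (D is \<psi>) (at x) h)) (at x)" for x
      using diff[of "is" x] Cons.prems by (intro derivative_intros) (auto simp: frechet_derivative_works)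
    from frechet_derivative_at[OF this, symmetric] show ?case
      using Cons by (simp add: D_def)
  qed (simp add: D_def)
  then show ?thesis
    using diff unfolding smooth_fun_def D_def[symmetric] by auto
qed

lemma test_functions_bounded:
  assumes "\<phi> \<in> test_functions \<Omega>"
  obtains B where "\<And>x. \<bar>\<phi> x\<bar> \<le> B"
proof -
  let ?K = "closure {x. \<phi> x \<noteq> 0}"
  have "compact (\<phi> ` ?K)"
    using assms by (intro compact_continuous_image smooth_fun_continuous) (auto simp: test_functions_def)
  then obtain B where B: "B > 0" "\<And>y. y \<in> \<phi> ` ?K \<Longrightarrow> norm y \<le> B"
    using compact_imp_bounded bounded_pos by metis
  have "\<bar>\<phi> x\<bar> \<le> B" for x
  proof (cases "\<phi> x = 0")
    case False
    then have "x \<in> ?K" using closure_subset by fastforce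
    with B(2) show ?thesis by auto
  qed (use B in auto)
  then show ?thesis by (rule that)
qed

lemma test_functions_deriv:
  assumes "\<phi> \<in> test_functions \<Omega>" "i \<in> Basis"
  shows "(\<lambda>x. frechet_derivative \<phi> (at x) i) \<in> test_functions \<Omega>"
proof -
  let ?K = "closure {x. \<phi> x \<noteq> 0}"
  have "frechet_derivative \<phi> (at x) i = 0" if "x \<notin> ?K" for x
  proof -
    have "((\<lambda>_. 0) has_derivative (\<lambda>_. 0)) (at x)" by simp
    then have "(\<phi> has_derivative (\<lambda>_. 0)) (at x)"
      by (rule has_derivative_transform_within_open[where s = "- ?K"])
         (use that closure_subset[of "{x. \<phi> x \<noteq> 0}"] in auto)
    from frechet_derivative_at[OF this] show ?thesis by metis
  qed
  then have "{x. frechet_derivative \<phi> (at x) i \<noteq> 0} \<subseteq> ?K" by auto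
  then have sub: "closure {x. frechet_derivative \<phi> (at x) i \<noteq> 0} \<subseteq> ?K" by (rule closure_minimal) simp
  moreover have "compact (closure {x. frechet_derivative \<phi> (at x) i \<noteq> 0})"
    using assms(1) closed_Int_compact[OF closed_closure, of ?K "{x. frechet_derivative \<phi> (at x) i \<noteq> 0}"] sub
    by (simp add: test_functions_def inf.absorb1)
  ultimately show ?thesis
    using assms smooth_fun_deriv[of \<phi> i] unfolding test_functions_def by auto
qed

lemma smooth_fun_measurable: "smooth_fun \<phi> \<Longrightarrow> \<phi> \<in> borel_measurable borel"
  by (intro borel_measurable_continuous_onI smooth_fun_continuous)

lemma integrable_mult_test:
  assumes "integrable (lebesgue_on \<Omega>) f" "\<phi> \<in> test_functions \<Omega>'"
  shows "integrable (lebesgue_on \<Omega>) (\<lambda>x. f x * \<phi> x)"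
proof -
  obtain B where B: "\<And>x. \<bar>\<phi> x\<bar> \<le> B" using test_functions_bounded[OF assms(2)] by blast
  have "\<phi> \<in> borel_measurable borel" using assms(2) by (auto simp: test_functions_def smooth_fun_measurable)
  then have [measurable]: "\<phi> \<in> borel_measurable (lebesgue_on \<Omega>)"
    by (simp add: measurable_restrict_space1 measurable_completion)
  have [measurable]: "f \<in> borel_measurable (lebesgue_on \<Omega>)" using assms(1) by auto
  show ?thesis
  proof (rule Bochner_Integration.integrable_bound)
    show "integrable (lebesgue_on \<Omega>) (\<lambda>x. B * f x)" using assms(1) by auto
    have "\<bar>f x\<bar> * \<bar>\<phi> x\<bar> \<le> \<bar>f x\<bar> * \<bar>B\<bar>" for x
      using B[of x] by (intro mult_left_mono) auto
    then show "AE x in lebesgue_on \<Omega>. norm (f x * \<phi> x) \<le> norm (B * f x)"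
      by (auto simp: abs_mult mult.commute)
  qed simp
qed

text \<open>Indicators of boxes inside \<open>\<Omega>\<close> are limits of test functions, so
  \<open>f\<close> integrates to 0 over small cubes; Lebesgue differentiation recovers
  \<open>f\<close> from these integrals at almost every point.\<close>

lemma fundamental_lemma_calculus_of_variations:
  fixes f :: "'a::euclidean_space \<Rightarrow> real"
  assumes op: "open \<Omega>" and int: "integrable (lebesgue_on \<Omega>) f"
    and zero: "\<And>\<phi>. \<phi> \<in> test_functions \<Omega> \<Longrightarrow> (LINT x|lebesgue_on \<Omega>. f x * \<phi> x) = 0"
  shows "AE x in lebesgue_on \<Omega>. f x = 0"
proof -
  have ms: "\<Omega> \<in> sets lebesgue" using op by (simp add: borel_open lborelD)
  have [measurable]: "f \<in> borel_measurable (lebesgue_on \<Omega>)" using int by auto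
  \<comment> \<open>Extension by zero to the whole space, where the differentiation theorem for
    cubes applies.\<close>
  define F where "F x = indicator \<Omega> x *\<^sub>R f x" for x
  have F: "integrable lebesgue F"
    unfolding F_def using int ms integrable_restrict_space[of \<Omega> lebesgue f] by simp
  have Fon: "F integrable_on cbox a b" for a b
    using integrable_on_subcbox[OF integrable_on_lebesgue[OF F]] by simp
  have boxzero: "integral (cbox a b) F = 0" if sub: "cbox a b \<subseteq> \<Omega>" for a b
  proof -
    have bsub: "box a b \<subseteq> \<Omega>" using sub box_subset_cbox by blast
    have "(\<lambda>n. LINT x|lebesgue_on \<Omega>. f x * box_bump (real (Suc n)) a b x)
        \<longlonglongrightarrow> (LINT x|lebesgue_on \<Omega>. f x * indicat_real (box a b) x)"
    proof (rule integral_dominated_convergence[where w = "\<lambda>x. \<bar>f x\<bar>"])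
      have "box_bump (real (Suc n)) a b \<in> borel_measurable borel" for n
        by (intro smooth_fun_measurable box_bump_smooth)
      then have [measurable]: "box_bump (real (Suc n)) a b \<in> borel_measurable (lebesgue_on \<Omega>)" for n
        by (simp add: measurable_restrict_space1 measurable_completion)
      show "(\<lambda>x. f x * box_bump (real (Suc n)) a b x) \<in> borel_measurable (lebesgue_on \<Omega>)" for n
        by measurable
      have "\<Omega> \<inter> box a b \<in> sets (lebesgue_on \<Omega>)" by (auto simp: sets_restrict_space)
      then have "indicat_real (box a b) \<in> borel_measurable (lebesgue_on \<Omega>)"
        by (intro borel_measurable_indicator') (simp add: Int_def[symmetric] space_restrict_space)
      then show "(\<lambda>x. f x * indicat_real (box a b) x) \<in> borel_measurable (lebesgue_on \<Omega>)" by measurable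
      show "integrable (lebesgue_on \<Omega>) (\<lambda>x. \<bar>f x\<bar>)" using int by auto
      show "AE x in lebesgue_on \<Omega>. (\<lambda>n. f x * box_bump (real (Suc n)) a b x) \<longlonglongrightarrow> f x * indicat_real (box a b) x"
        by (intro AE_I2 tendsto_intros box_bump_tendsto)
      show "AE x in lebesgue_on \<Omega>. norm (f x * box_bump (real (Suc n)) a b x) \<le> \<bar>f x\<bar>" for n
        using box_bump_bounds[of "real (Suc n)" a b] by (intro AE_I2) (simp add: abs_mult mult_left_le)
    qed
    moreover have "(LINT x|lebesgue_on \<Omega>. f x * box_bump (real (Suc n)) a b x) = 0" for n
      by (intro zero box_bump_test sub) simp
    ultimately have "(LINT x|lebesgue_on \<Omega>. f x * indicat_real (box a b) x) = 0"
      by (simp add: LIMSEQ_const_iff)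
    also have "(LINT x|lebesgue_on \<Omega>. f x * indicat_real (box a b) x) = (LINT x|lebesgue. indicator (box a b) x *\<^sub>R F x)"
      using ms by (simp add: integral_restrict_space F_def ac_simps)
    also have "\<dots> = (LINT x|lebesgue_on (box a b). F x)"
      by (subst integral_restrict_space) auto
    also have "\<dots> = integral (box a b) F"
    proof (rule lebesgue_integral_eq_integral)
      show "integrable (lebesgue_on (box a b)) F"
        using integrable_mult_indicator[OF _ F, of "box a b"] by (simp add: integrable_restrict_space)
    qed simp
    finally show ?thesis by (simp add: integral_open_interval)
  qed
  obtain N where N: "negligible N"
    "\<And>x e. \<lbrakk>x \<notin> N; 0 < e\<rbrakk> \<Longrightarrow> \<exists>d>0. \<forall>h. 0 < h \<and> h < d \<longrightarrow>
                         norm(integral (cbox x (x + h *\<^sub>R One)) F /\<^sub>R h ^ DIM('a) - F x) < e"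
    using integrable_ccontinuous_explicit[of F] Fon by blast
  have "F x = 0" if x: "x \<in> \<Omega>" "x \<notin> N" for x
  proof (rule ccontr)
    assume "F x \<noteq> 0"
    then obtain d where d: "d > 0" "\<And>h. 0 < h \<Longrightarrow> h < d \<Longrightarrow> norm(integral (cbox x (x + h *\<^sub>R One)) F /\<^sub>R h ^ DIM('a) - F x) < \<bar>F x\<bar>"
      using N(2)[of x "\<bar>F x\<bar>"] x by auto
    obtain e where e: "e > 0" "ball x e \<subseteq> \<Omega>" using op x(1) openE by blast
    \<comment> \<open>The cube with lower corner \<open>x\<close> and side \<open>h\<close> has
      diameter \<open>h * norm One\<close>, which this choice keeps below \<open>e\<close>.\<close>
    define h where "h = min (d / 2) (e / (2 * norm (One::'a)))"
    have nOne: "norm (One::'a) > 0" by simp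
    have h: "h > 0" "h < d" "h * norm (One::'a) < e"
      using d(1) e(1) nOne by (auto simp: h_def min_def field_simps)
    have "cbox x (x + h *\<^sub>R One) \<subseteq> ball x e"
    proof
      fix y assume y: "y \<in> cbox x (x + h *\<^sub>R One)"
      have "norm (y - x) \<le> norm (h *\<^sub>R (One::'a))"
        by (rule norm_le_componentwise) (use y h(1) in \<open>auto simp: mem_box inner_diff_left inner_add_left\<close>)
      also have "\<dots> < e" using h by simp
      finally show "y \<in> ball x e" by (simp add: dist_norm norm_minus_commute)
    qed
    with boxzero e(2) have "integral (cbox x (x + h *\<^sub>R One)) F = 0" by blast
    with d(2)[OF h(1,2)] show False by simp
  qed
  moreover have "AE x in lebesgue_on \<Omega>. x \<notin> N"
    using N(1) ms AE_not_in[of N lebesgue]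
    by (auto simp: AE_restrict_space_iff negligible_iff_null_sets elim!: eventually_mono)
  moreover have "AE x in lebesgue_on \<Omega>. x \<in> \<Omega>"
    by (intro AE_I2) (simp add: space_restrict_space)
  ultimately show ?thesis
    by (auto simp: F_def elim: eventually_elim2)
qed


section \<open>Gradients, the trace space and its dual\<close>

lemma L2_integrable_component:
  assumes "bounded \<Omega>" "open \<Omega>" "G \<in> L2 \<Omega>"
  shows "integrable (lebesgue_on \<Omega>) (\<lambda>x. G x \<bullet> i)"
  by (rule L2_integrable_inner[OF assms(3) L2_const[OF assms(1,2)]])

lemma L2_integrable:
  fixes v :: "'a::euclidean_space \<Rightarrow> real"
  assumes "bounded \<Omega>" "open \<Omega>" "v \<in> L2 \<Omega>"
  shows "integrable (lebesgue_on \<Omega>) v"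
  using L2_integrable_component[OF assms, of 1] by simp

text \<open>\<open>grad\<close> is a choice among weak gradients, so its algebraic properties hold
  almost everywhere only and are obtained from this uniqueness.\<close>

lemma weak_gradient_unique:
  assumes bo: "bounded \<Omega>" "open \<Omega>" and G: "weak_gradient \<Omega> v G" "weak_gradient \<Omega> v G'"
  shows "AE x in lebesgue_on \<Omega>. G x = G' x"
proof -
  have L: "G \<in> L2 \<Omega>" "G' \<in> L2 \<Omega>" using G by (auto simp: weak_gradient_def)
  have "AE x in lebesgue_on \<Omega>. (G x - G' x) \<bullet> i = 0" if i: "i \<in> Basis" for i
  proof (rule fundamental_lemma_calculus_of_variations[OF bo(2)])
    show "integrable (lebesgue_on \<Omega>) (\<lambda>x. (G x - G' x) \<bullet> i)"
      using L2_integrable_component[OF bo L2_diff[OF L]] .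
    fix \<phi> assume phi: "\<phi> \<in> test_functions \<Omega>"
    have "integrable (lebesgue_on \<Omega>) (\<lambda>x. (G x \<bullet> i) * \<phi> x)" "integrable (lebesgue_on \<Omega>) (\<lambda>x. (G' x \<bullet> i) * \<phi> x)"
      by (intro integrable_mult_test[OF _ phi] L2_integrable_component bo L)+
    moreover have "(LINT x|lebesgue_on \<Omega>. (G x \<bullet> i) * \<phi> x) = (LINT x|lebesgue_on \<Omega>. (G' x \<bullet> i) * \<phi> x)"
    proof -
      let ?I = "LINT x|lebesgue_on \<Omega>. v x * frechet_derivative \<phi> (at x) i"
      have "?I = - (LINT x|lebesgue_on \<Omega>. (G x \<bullet> i) * \<phi> x)" "?I = - (LINT x|lebesgue_on \<Omega>. (G' x \<bullet> i) * \<phi> x)"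
        using G phi i by (auto simp: weak_gradient_def)
      then show ?thesis by linarith
    qed
    ultimately show "(LINT x|lebesgue_on \<Omega>. ((G x - G' x) \<bullet> i) * \<phi> x) = 0"
      by (simp add: inner_diff_left left_diff_distrib)
  qed
  then have "AE x in lebesgue_on \<Omega>. \<forall>i\<in>Basis. (G x - G' x) \<bullet> i = 0"
    by (simp add: AE_finite_all)
  then show ?thesis
    by (rule eventually_mono) (simp add: euclidean_eq_iff[where 'a='a] inner_diff_left)
qed

text \<open>The form \<open>v + c * w\<close> serves sums, differences (\<open>c = -1\<close>) and
  multiples (\<open>v = 0\<close>) together.\<close>

lemma weak_gradient_comb:
  assumes bo: "bounded \<Omega>" "open \<Omega>" and G: "weak_gradient \<Omega> v G" "weak_gradient \<Omega> w K"
  shows "weak_gradient \<Omega> (\<lambda>x. v x + c * w x) (\<lambda>x. G x + c *\<^sub>R K x)"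
  unfolding weak_gradient_def
proof (intro conjI ballI)
  have L: "v \<in> L2 \<Omega>" "w \<in> L2 \<Omega>" "G \<in> L2 \<Omega>" "K \<in> L2 \<Omega>" using G by (auto simp: weak_gradient_def)
  show "(\<lambda>x. v x + c * w x) \<in> L2 \<Omega>" using L2_add[OF L(1) L2_scale[OF L(2), of c]] by simp
  show "(\<lambda>x. G x + c *\<^sub>R K x) \<in> L2 \<Omega>" by (intro L2_add L2_scale L)
  fix \<phi> :: "'a \<Rightarrow> real" and i :: 'a assume phi: "\<phi> \<in> test_functions \<Omega>" and i: "i \<in> Basis"
  let ?d = "\<lambda>x. frechet_derivative \<phi> (at x) i"
  have d: "?d \<in> test_functions \<Omega>" by (rule test_functions_deriv[OF phi i])
  have [simp]: "integrable (lebesgue_on \<Omega>) (\<lambda>x. v x * ?d x)" "integrable (lebesgue_on \<Omega>) (\<lambda>x. w x * ?d x)"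
    by (intro integrable_mult_test[OF _ d] L2_integrable bo L)+
  have [simp]: "integrable (lebesgue_on \<Omega>) (\<lambda>x. (G x \<bullet> i) * \<phi> x)" "integrable (lebesgue_on \<Omega>) (\<lambda>x. (K x \<bullet> i) * \<phi> x)"
    by (intro integrable_mult_test[OF _ phi] L2_integrable_component bo L)+
  have "(LINT x|lebesgue_on \<Omega>. (v x + c * w x) * ?d x) = (LINT x|lebesgue_on \<Omega>. v x * ?d x) + c * (LINT x|lebesgue_on \<Omega>. w x * ?d x)"
    by (simp add: distrib_right mult.assoc)
  also have "\<dots> = - (LINT x|lebesgue_on \<Omega>. (G x \<bullet> i) * \<phi> x) - c * (LINT x|lebesgue_on \<Omega>. (K x \<bullet> i) * \<phi> x)"
    using G phi i by (simp add: weak_gradient_def)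
  also have "\<dots> = - (LINT x|lebesgue_on \<Omega>. ((G x + c *\<^sub>R K x) \<bullet> i) * \<phi> x)"
    by (simp add: inner_add_left distrib_right mult.assoc)
  finally show "(LINT x|lebesgue_on \<Omega>. (v x + c * w x) * ?d x) = - (LINT x|lebesgue_on \<Omega>. ((G x + c *\<^sub>R K x) \<bullet> i) * \<phi> x)" .
qed

lemma weak_gradient_zero: "weak_gradient \<Omega> (\<lambda>x. 0) (\<lambda>x. 0)"
  by (simp add: weak_gradient_def L2_zero)

lemma W12_zero: "(\<lambda>x. 0) \<in> W12 \<Omega>"
  using weak_gradient_zero by (auto simp: W12_def)

lemma grad_weak_gradient: "v \<in> W12 \<Omega> \<Longrightarrow> weak_gradient \<Omega> v (grad \<Omega> v)"
  using someI_ex[of "weak_gradient \<Omega> v"] by (simp add: W12_def grad_def)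

lemma W12_L2: "v \<in> W12 \<Omega> \<Longrightarrow> v \<in> L2 \<Omega>" "v \<in> W12 \<Omega> \<Longrightarrow> grad \<Omega> v \<in> L2 \<Omega>"
  using grad_weak_gradient[of v \<Omega>] by (auto simp: weak_gradient_def)

lemma W12_comb:
  assumes "bounded \<Omega>" "open \<Omega>" "v \<in> W12 \<Omega>" "w \<in> W12 \<Omega>"
  shows "(\<lambda>x. v x + c * w x) \<in> W12 \<Omega>"
  using weak_gradient_comb[OF assms(1,2) grad_weak_gradient[OF assms(3)] grad_weak_gradient[OF assms(4)]]
  by (auto simp: W12_def)

lemma grad_comb:
  assumes "bounded \<Omega>" "open \<Omega>" "v \<in> W12 \<Omega>" "w \<in> W12 \<Omega>"
  shows "AE x in lebesgue_on \<Omega>. grad \<Omega> (\<lambda>x. v x + c * w x) x = grad \<Omega> v x + c *\<^sub>R grad \<Omega> w x"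
  by (rule weak_gradient_unique[OF assms(1,2) grad_weak_gradient[OF W12_comb[OF assms]]
        weak_gradient_comb[OF assms(1,2) grad_weak_gradient[OF assms(3)] grad_weak_gradient[OF assms(4)]]])

lemma grad_zero:
  assumes "bounded \<Omega>" "open \<Omega>"
  shows "AE x in lebesgue_on \<Omega>. grad \<Omega> (\<lambda>x. 0) x = 0"
  by (rule weak_gradient_unique[OF assms grad_weak_gradient[OF W12_zero] weak_gradient_zero])

lemma L2_norm_grad_comb:
  assumes "bounded \<Omega>" "open \<Omega>" "v \<in> W12 \<Omega>" "w \<in> W12 \<Omega>"
  shows "L2_norm \<Omega> (grad \<Omega> (\<lambda>x. v x + c * w x)) = L2_norm \<Omega> (\<lambda>x. grad \<Omega> v x + c *\<^sub>R grad \<Omega> w x)"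
  by (intro L2_norm_cong_AE grad_comb assms W12_L2 W12_comb L2_add L2_scale)

lemma L2_norm_grad_zero:
  assumes "bounded \<Omega>" "open \<Omega>"
  shows "L2_norm \<Omega> (grad \<Omega> (\<lambda>x. 0)) = 0"
proof -
  have "L2_norm \<Omega> (grad \<Omega> (\<lambda>x. 0)) = L2_norm \<Omega> (\<lambda>x. 0 :: 'a)"
    by (intro L2_norm_cong_AE grad_zero assms W12_L2 L2_zero W12_zero)
  then show ?thesis by (simp add: L2_norm_def)
qed

lemma L2_norm_comb:
  assumes "v \<in> L2 \<Omega>" "w \<in> L2 \<Omega>"
  shows "L2_norm \<Omega> (\<lambda>x. v x + c *\<^sub>R w x) \<le> L2_norm \<Omega> v + \<bar>c\<bar> * L2_norm \<Omega> w"
  using L2_norm_triangle[OF assms(1) L2_scale[OF assms(2)]] by (simp add: L2_norm_scale)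

lemma W12_norm_comb:
  assumes "bounded \<Omega>" "open \<Omega>" "v \<in> W12 \<Omega>" "w \<in> W12 \<Omega>"
  shows "W12_norm \<Omega> (\<lambda>x. v x + c * w x) \<le> W12_norm \<Omega> v + \<bar>c\<bar> * W12_norm \<Omega> w"
proof -
  have 1: "L2_norm \<Omega> (\<lambda>x. v x + c * w x) \<le> L2_norm \<Omega> v + \<bar>c\<bar> * L2_norm \<Omega> w"
    using L2_norm_comb[OF W12_L2(1)[OF assms(3)] W12_L2(1)[OF assms(4)], of c] by simp
  have 2: "L2_norm \<Omega> (grad \<Omega> (\<lambda>x. v x + c * w x)) \<le> L2_norm \<Omega> (grad \<Omega> v) + \<bar>c\<bar> * L2_norm \<Omega> (grad \<Omega> w)"
    unfolding L2_norm_grad_comb[OF assms] by (intro L2_norm_comb W12_L2 assms)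
  have "W12_norm \<Omega> (\<lambda>x. v x + c * w x) \<le> sqrt ((L2_norm \<Omega> v + \<bar>c\<bar> * L2_norm \<Omega> w)\<^sup>2
      + (L2_norm \<Omega> (grad \<Omega> v) + \<bar>c\<bar> * L2_norm \<Omega> (grad \<Omega> w))\<^sup>2)"
    unfolding W12_norm_def by (intro real_sqrt_le_mono add_mono power_mono 1 2 L2_norm_nonneg)
  also have "\<dots> \<le> W12_norm \<Omega> v + sqrt ((\<bar>c\<bar> * L2_norm \<Omega> w)\<^sup>2 + (\<bar>c\<bar> * L2_norm \<Omega> (grad \<Omega> w))\<^sup>2)"
    unfolding W12_norm_def by (rule real_sqrt_sum_squares_triangle_ineq)
  also have "\<dots> = W12_norm \<Omega> v + \<bar>c\<bar> * W12_norm \<Omega> w"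
    unfolding W12_norm_def by (simp add: power_mult_distrib distrib_left[symmetric] real_sqrt_mult)
  finally show ?thesis .
qed

section \<open>Traces and the space V\<close>

lemma sets_surface_measure: "sets (surface_measure \<Omega>) = sets (restrict_space borel (frontier \<Omega>))"
  \<comment> \<open>\<open>measure_of\<close> carries the sigma-algebra generated by the given sets,
    whatever the set function is; here these are the Borel sets.\<close>
  unfolding surface_measure_def hausdorff_measure_def
  by (rule sets_restrict_space_cong) (simp add: sets_measure_of_conv sets.sigma_sets_eq[of borel, simplified])

lemma smooth_fun_surface_measurable:
  assumes "smooth_fun \<phi>" shows "\<phi> \<in> borel_measurable (surface_measure \<Omega>)"
  unfolding measurable_cong_sets[OF sets_surface_measure refl]
  by (intro measurable_restrict_space1 smooth_fun_measurable assms)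

lemma has_trace_comb:
  assumes bo: "bounded \<Omega>" "open \<Omega>" and tr: "has_trace \<Omega> v \<tau>" "has_trace \<Omega> w \<sigma>"
  shows "has_trace \<Omega> (\<lambda>x. v x + c * w x) (\<lambda>x. \<tau> x + c * \<sigma> x)"
proof -
  define S where "S = surface_measure \<Omega>"
  from tr have vw: "v \<in> W12 \<Omega>" "w \<in> W12 \<Omega>" and [measurable]: "\<tau> \<in> borel_measurable S" "\<sigma> \<in> borel_measurable S"
    by (auto simp: has_trace_def S_def)
  from tr obtain \<phi> \<psi> :: "nat \<Rightarrow> 'a \<Rightarrow> real" where
    phi: "\<And>n. smooth_fun (\<phi> n)" "\<And>n. \<phi> n \<in> W12 \<Omega>" "(\<lambda>n. W12_norm \<Omega> (\<lambda>x. \<phi> n x - v x)) \<longlonglongrightarrow> 0"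
      "(\<lambda>n. \<integral>\<^sup>+x. ennreal ((\<phi> n x - \<tau> x)\<^sup>2) \<partial>S) \<longlonglongrightarrow> 0" and
    psi: "\<And>n. smooth_fun (\<psi> n)" "\<And>n. \<psi> n \<in> W12 \<Omega>" "(\<lambda>n. W12_norm \<Omega> (\<lambda>x. \<psi> n x - w x)) \<longlonglongrightarrow> 0"
      "(\<lambda>n. \<integral>\<^sup>+x. ennreal ((\<psi> n x - \<sigma> x)\<^sup>2) \<partial>S) \<longlonglongrightarrow> 0"
    unfolding has_trace_def S_def by blast
  have [measurable]: "\<phi> n \<in> borel_measurable S" "\<psi> n \<in> borel_measurable S" for n
    unfolding S_def by (intro smooth_fun_surface_measurable phi psi)+
  have "(\<lambda>n. W12_norm \<Omega> (\<lambda>x. (\<phi> n x + c * \<psi> n x) - (v x + c * w x))) \<longlonglongrightarrow> 0"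
  proof (rule tendsto_sandwich[where f = "\<lambda>_. 0"
        and h = "\<lambda>n. W12_norm \<Omega> (\<lambda>x. \<phi> n x - v x) + \<bar>c\<bar> * W12_norm \<Omega> (\<lambda>x. \<psi> n x - w x)"])
    have "(\<lambda>n. W12_norm \<Omega> (\<lambda>x. \<phi> n x - v x) + \<bar>c\<bar> * W12_norm \<Omega> (\<lambda>x. \<psi> n x - w x)) \<longlonglongrightarrow> 0 + \<bar>c\<bar> * 0"
      by (intro tendsto_intros phi psi)
    then show "(\<lambda>n. W12_norm \<Omega> (\<lambda>x. \<phi> n x - v x) + \<bar>c\<bar> * W12_norm \<Omega> (\<lambda>x. \<psi> n x - w x)) \<longlonglongrightarrow> 0" by simp
    have "(\<lambda>x. \<phi> n x - v x) \<in> W12 \<Omega>" "(\<lambda>x. \<psi> n x - w x) \<in> W12 \<Omega>" for n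
      using W12_comb[OF bo phi(2) vw(1), of n "-1"] W12_comb[OF bo psi(2) vw(2), of n "-1"] by auto
    from W12_norm_comb[OF bo this, where c = c]
    show "\<forall>\<^sub>F n in sequentially. W12_norm \<Omega> (\<lambda>x. (\<phi> n x + c * \<psi> n x) - (v x + c * w x))
       \<le> W12_norm \<Omega> (\<lambda>x. \<phi> n x - v x) + \<bar>c\<bar> * W12_norm \<Omega> (\<lambda>x. \<psi> n x - w x)"
      by (intro always_eventually allI) (simp add: algebra_simps)
  qed (auto simp: W12_norm_def)
  moreover have "(\<lambda>n. \<integral>\<^sup>+x. ennreal (((\<phi> n x + c * \<psi> n x) - (\<tau> x + c * \<sigma> x))\<^sup>2) \<partial>S) \<longlonglongrightarrow> 0"
  proof -
    let ?B = "\<lambda>n. ennreal 2 * (\<integral>\<^sup>+x. ennreal ((\<phi> n x - \<tau> x)\<^sup>2) \<partial>S) + ennreal (2 * c\<^sup>2) * (\<integral>\<^sup>+x. ennreal ((\<psi> n x - \<sigma> x)\<^sup>2) \<partial>S)"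
    have "?B \<longlonglongrightarrow> ennreal 2 * 0 + ennreal (2 * c\<^sup>2) * 0"
      by (intro tendsto_add ennreal_tendsto_cmult phi psi) auto
    then have lim: "?B \<longlonglongrightarrow> 0" by simp
    \<comment> \<open>Squares are compared instead of norms, so that the boundary integrals can stay
      in \<open>ennreal\<close>.\<close>
    have "((a + c * b)\<^sup>2) \<le> 2 * a\<^sup>2 + (2 * c\<^sup>2) * b\<^sup>2" for a b :: real
      using zero_le_power2[of "a - c * b"] by (simp add: power2_eq_square algebra_simps)
    from this[of "\<phi> n x - \<tau> x" "\<psi> n x - \<sigma> x" for n x]
    have *: "((\<phi> n x + c * \<psi> n x) - (\<tau> x + c * \<sigma> x))\<^sup>2 \<le> 2 * (\<phi> n x - \<tau> x)\<^sup>2 + (2 * c\<^sup>2) * (\<psi> n x - \<sigma> x)\<^sup>2" for n x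
      by (simp add: algebra_simps)
    have "(\<integral>\<^sup>+x. ennreal (((\<phi> n x + c * \<psi> n x) - (\<tau> x + c * \<sigma> x))\<^sup>2) \<partial>S) \<le> ?B n" for n
    proof -
      have "(\<integral>\<^sup>+x. ennreal (((\<phi> n x + c * \<psi> n x) - (\<tau> x + c * \<sigma> x))\<^sup>2) \<partial>S)
        \<le> (\<integral>\<^sup>+x. ennreal 2 * ennreal ((\<phi> n x - \<tau> x)\<^sup>2) + ennreal (2 * c\<^sup>2) * ennreal ((\<psi> n x - \<sigma> x)\<^sup>2) \<partial>S)"
        using * by (intro nn_integral_mono)
          (simp add: ennreal_mult[symmetric] ennreal_plus[symmetric] del: ennreal_plus ennreal_numeral)
      also have "\<dots> = ?B n"
        by (subst nn_integral_add) (simp_all add: nn_integral_cmult)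
      finally show ?thesis .
    qed
    then show ?thesis
      by (intro tendsto_sandwich[OF _ _ tendsto_const lim] always_eventually allI) auto
  qed
  ultimately show ?thesis
    unfolding has_trace_def S_def[symmetric]
    using W12_comb[OF bo vw] W12_comb[OF bo phi(2) psi(2)] smooth_fun_comb[OF phi(1) psi(1)]
    by (intro conjI exI[of _ "\<lambda>n x. \<phi> n x + c * \<psi> n x"]) auto
qed

lemma V_space_comb:
  assumes bo: "bounded \<Omega>" "open \<Omega>" and v: "v \<in> V_space \<Omega> \<Gamma>D" and w: "w \<in> V_space \<Omega> \<Gamma>D"
  shows "(\<lambda>x. v x + c * w x) \<in> V_space \<Omega> \<Gamma>D"
proof -
  obtain \<tau> \<sigma> where "has_trace \<Omega> v \<tau>" "AE x in surface_measure \<Omega>. x \<in> \<Gamma>D \<longrightarrow> \<tau> x = 0"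
    "has_trace \<Omega> w \<sigma>" "AE x in surface_measure \<Omega>. x \<in> \<Gamma>D \<longrightarrow> \<sigma> x = 0"
    using v w unfolding V_space_def by blast
  then show ?thesis
    unfolding V_space_def by (auto intro!: exI[of _ "\<lambda>x. \<tau> x + c * \<sigma> x"] has_trace_comb bo elim: eventually_elim2)
qed

lemma V_space_zero:
  assumes "bounded \<Omega>" "open \<Omega>"
  shows "(\<lambda>x. 0) \<in> V_space \<Omega> \<Gamma>D"
proof -
  have "L2_norm \<Omega> (\<lambda>x. 0 :: real) = 0" by (simp add: L2_norm_def)
  then have "W12_norm \<Omega> (\<lambda>x. 0) = 0"
    unfolding W12_norm_def using L2_norm_grad_zero[OF assms] by simp
  then have "has_trace \<Omega> (\<lambda>x. 0) (\<lambda>x. 0)"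
    unfolding has_trace_def using W12_zero smooth_class_smooth[OF smooth_class.const[of 0]]
    by (intro conjI exI[of _ "\<lambda>n x. 0"]) auto
  then show ?thesis unfolding V_space_def by auto
qed

lemma V_space_W12: "v \<in> V_space \<Omega> \<Gamma>D \<Longrightarrow> v \<in> W12 \<Omega>"
  by (auto simp: V_space_def has_trace_def)

lemma V_space_L2: "v \<in> V_space \<Omega> \<Gamma>D \<Longrightarrow> v \<in> L2 \<Omega>"
  using V_space_W12 W12_L2 by blast

lemma V_space_diff:
  assumes "bounded \<Omega>" "open \<Omega>" "v \<in> V_space \<Omega> \<Gamma>D" "w \<in> V_space \<Omega> \<Gamma>D"
  shows "(\<lambda>x. v x - w x) \<in> V_space \<Omega> \<Gamma>D"
  using V_space_comb[OF assms, of "-1"] by simp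

lemma V_space_scale:
  assumes "bounded \<Omega>" "open \<Omega>" "v \<in> V_space \<Omega> \<Gamma>D"
  shows "(\<lambda>x. c * v x) \<in> V_space \<Omega> \<Gamma>D"
  using V_space_comb[OF assms(1,2) V_space_zero[OF assms(1,2)] assms(3)] by simp

lemma grad_diff:
  assumes "bounded \<Omega>" "open \<Omega>" "v \<in> W12 \<Omega>" "w \<in> W12 \<Omega>"
  shows "AE x in lebesgue_on \<Omega>. grad \<Omega> (\<lambda>x. v x - w x) x = grad \<Omega> v x - grad \<Omega> w x"
  using grad_comb[OF assms, of "-1"] by simp

lemma V_norm_diff:
  assumes "bounded \<Omega>" "open \<Omega>" "v \<in> W12 \<Omega>" "w \<in> W12 \<Omega>"
  shows "V_norm \<Omega> (\<lambda>x. v x - w x) = L2_norm \<Omega> (\<lambda>x. grad \<Omega> v x - grad \<Omega> w x)"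
  using L2_norm_grad_comb[OF assms, of "-1"] by (simp add: V_norm_def)

lemma V_norm_scale:
  assumes "bounded \<Omega>" "open \<Omega>" "v \<in> W12 \<Omega>"
  shows "V_norm \<Omega> (\<lambda>x. c * v x) = \<bar>c\<bar> * V_norm \<Omega> v"
proof -
  have "AE x in lebesgue_on \<Omega>. grad \<Omega> (\<lambda>x. c * v x) x = c *\<^sub>R grad \<Omega> v x"
    using grad_comb[OF assms(1,2) W12_zero assms(3), of c] grad_zero[OF assms(1,2)]
    by eventually_elim simp
  moreover have "(\<lambda>x. c * v x) \<in> W12 \<Omega>"
    using W12_comb[OF assms(1,2) W12_zero assms(3), of c] by simp
  ultimately have "V_norm \<Omega> (\<lambda>x. c * v x) = L2_norm \<Omega> (\<lambda>x. c *\<^sub>R grad \<Omega> v x)"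
    unfolding V_norm_def by (intro L2_norm_cong_AE W12_L2 L2_scale assms)
  then show ?thesis by (simp add: L2_norm_scale V_norm_def)
qed

section \<open>The dual of V\<close>

lemma V_norm_nonneg: "V_norm \<Omega> v \<ge> 0" by (simp add: V_norm_def L2_norm_nonneg)

lemma V_dual_add:
  "\<zeta> \<in> V_dual \<Omega> \<Gamma>D \<Longrightarrow> v \<in> V_space \<Omega> \<Gamma>D \<Longrightarrow> w \<in> V_space \<Omega> \<Gamma>D \<Longrightarrow> \<zeta> (\<lambda>x. v x + w x) = \<zeta> v + \<zeta> w"
  by (auto simp: V_dual_def)

lemma V_dual_scale: "\<zeta> \<in> V_dual \<Omega> \<Gamma>D \<Longrightarrow> v \<in> V_space \<Omega> \<Gamma>D \<Longrightarrow> \<zeta> (\<lambda>x. c * v x) = c * \<zeta> v"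
  by (auto simp: V_dual_def)

lemma V_dual_diff_arg:
  assumes "bounded \<Omega>" "open \<Omega>" "\<zeta> \<in> V_dual \<Omega> \<Gamma>D" "v \<in> V_space \<Omega> \<Gamma>D" "w \<in> V_space \<Omega> \<Gamma>D"
  shows "\<zeta> (\<lambda>x. v x - w x) = \<zeta> v - \<zeta> w"
  using V_dual_add[OF assms(3,4) V_space_scale[OF assms(1,2,5), of "-1"]] V_dual_scale[OF assms(3,5), of "-1"] by simp

lemma V_dual_boundedE:
  assumes "\<zeta> \<in> V_dual \<Omega> \<Gamma>D"
  obtains C where "\<And>v. v \<in> V_space \<Omega> \<Gamma>D \<Longrightarrow> \<bar>\<zeta> v\<bar> \<le> C * V_norm \<Omega> v"
proof -
  from assms have "\<exists>C. \<forall>v\<in>V_space \<Omega> \<Gamma>D. \<bar>\<zeta> v\<bar> \<le> C * V_norm \<Omega> v" by (simp add: V_dual_def)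
  with that show thesis by blast
qed

text \<open>Makes the supremum in \<open>V_dual_norm\<close> meaningful, since \<open>Sup\<close> on
  the reals says nothing about unbounded sets.\<close>

lemma V_dual_bdd:
  assumes "\<zeta> \<in> V_dual \<Omega> \<Gamma>D"
  shows "bdd_above ((\<lambda>v. \<bar>\<zeta> v\<bar>) ` {v \<in> V_space \<Omega> \<Gamma>D. V_norm \<Omega> v \<le> 1})"
proof -
  obtain C where C: "\<And>v. v \<in> V_space \<Omega> \<Gamma>D \<Longrightarrow> \<bar>\<zeta> v\<bar> \<le> C * V_norm \<Omega> v"
    using V_dual_boundedE[OF assms] by blast
  have "\<bar>\<zeta> v\<bar> \<le> \<bar>C\<bar>" if "v \<in> V_space \<Omega> \<Gamma>D" "V_norm \<Omega> v \<le> 1" for v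
  proof -
    have "\<bar>\<zeta> v\<bar> \<le> C * V_norm \<Omega> v" by (rule C[OF that(1)])
    also have "\<dots> \<le> \<bar>C\<bar> * V_norm \<Omega> v" by (intro mult_right_mono V_norm_nonneg) simp
    also have "\<dots> \<le> \<bar>C\<bar>" using that(2) by (simp add: mult_left_le)
    finally show ?thesis .
  qed
  then show ?thesis by (auto simp: bdd_above_def)
qed

lemma V_dual_norm_nonneg:
  assumes "bounded \<Omega>" "open \<Omega>" "\<zeta> \<in> V_dual \<Omega> \<Gamma>D"
  shows "V_dual_norm \<Omega> \<Gamma>D \<zeta> \<ge> 0"
  unfolding V_dual_norm_def
  by (rule cSUP_upper2[OF V_dual_bdd[OF assms(3)], of "\<lambda>x. 0"])
     (use V_space_zero[OF assms(1,2)] L2_norm_grad_zero[OF assms(1,2)] in \<open>auto simp: V_norm_def\<close>)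

lemma V_dual_bound:
  assumes bo: "bounded \<Omega>" "open \<Omega>" and z: "\<zeta> \<in> V_dual \<Omega> \<Gamma>D" and v: "v \<in> V_space \<Omega> \<Gamma>D"
  shows "\<bar>\<zeta> v\<bar> \<le> V_dual_norm \<Omega> \<Gamma>D \<zeta> * V_norm \<Omega> v"
proof (cases "V_norm \<Omega> v = 0")
  \<comment> \<open>\<open>V_norm\<close> vanishes on every representative of 0, where normalising
    is impossible; boundedness then forces \<open>\<zeta> v = 0\<close>.\<close>
  case True
  obtain C where "\<bar>\<zeta> v\<bar> \<le> C * V_norm \<Omega> v" using V_dual_boundedE[OF z] v by metis
  with True show ?thesis by simp
next
  case False
  let ?c = "inverse (V_norm \<Omega> v)"
  have pos: "V_norm \<Omega> v > 0" using False V_norm_nonneg[of \<Omega> v] by simp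
  have "V_norm \<Omega> (\<lambda>x. ?c * v x) = 1"
    using pos by (simp add: V_norm_scale[OF bo V_space_W12[OF v]])
  then have "\<bar>\<zeta> (\<lambda>x. ?c * v x)\<bar> \<le> V_dual_norm \<Omega> \<Gamma>D \<zeta>"
    unfolding V_dual_norm_def by (intro cSUP_upper V_dual_bdd z) (auto intro: V_space_scale bo v)
  then show ?thesis using pos
    unfolding V_dual_scale[OF z v] by (simp add: abs_mult field_simps)
qed

lemma V_dual_norm_le:
  assumes "bounded \<Omega>" "open \<Omega>"
    and "\<And>v. v \<in> V_space \<Omega> \<Gamma>D \<Longrightarrow> V_norm \<Omega> v \<le> 1 \<Longrightarrow> \<bar>\<zeta> v\<bar> \<le> C"
  shows "V_dual_norm \<Omega> \<Gamma>D \<zeta> \<le> C"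
  unfolding V_dual_norm_def
proof (rule cSUP_least)
  have "(\<lambda>x. 0) \<in> {v \<in> V_space \<Omega> \<Gamma>D. V_norm \<Omega> v \<le> 1}"
    using V_space_zero[OF assms(1,2)] L2_norm_grad_zero[OF assms(1,2)] by (simp add: V_norm_def)
  then show "{v \<in> V_space \<Omega> \<Gamma>D. V_norm \<Omega> v \<le> 1} \<noteq> {}" by blast
qed (use assms(3) in auto)

lemma V_dual_diff:
  assumes "\<zeta> \<in> V_dual \<Omega> \<Gamma>D" "\<xi> \<in> V_dual \<Omega> \<Gamma>D"
  shows "(\<lambda>v. \<zeta> v - \<xi> v) \<in> V_dual \<Omega> \<Gamma>D"
proof -
  obtain C D where C: "\<And>v. v \<in> V_space \<Omega> \<Gamma>D \<Longrightarrow> \<bar>\<zeta> v\<bar> \<le> C * V_norm \<Omega> v"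
     and D: "\<And>v. v \<in> V_space \<Omega> \<Gamma>D \<Longrightarrow> \<bar>\<xi> v\<bar> \<le> D * V_norm \<Omega> v"
    using V_dual_boundedE[OF assms(1)] V_dual_boundedE[OF assms(2)] by metis
  have "\<bar>\<zeta> v - \<xi> v\<bar> \<le> (C + D) * V_norm \<Omega> v" if "v \<in> V_space \<Omega> \<Gamma>D" for v
    using C[OF that] D[OF that] by (simp add: distrib_right)
  then have "\<exists>C. \<forall>v\<in>V_space \<Omega> \<Gamma>D. \<bar>\<zeta> v - \<xi> v\<bar> \<le> C * V_norm \<Omega> v" by blast
  with assms show ?thesis by (simp add: V_dual_def right_diff_distrib)
qed

text \<open>All Bochner spaces in use take values in spaces of functions; pointwise differences suffice for
  the metric arguments.\<close>

locale fun_seminorm =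
  fixes X :: "('d \<Rightarrow> 'e::real_vector) set" and N :: "('d \<Rightarrow> 'e) \<Rightarrow> real"
  assumes diff: "p \<in> X \<Longrightarrow> q \<in> X \<Longrightarrow> (\<lambda>x. p x - q x) \<in> X"
    and zero: "(\<lambda>x. 0) \<in> X" "N (\<lambda>x. 0) = 0"
    and nonneg: "p \<in> X \<Longrightarrow> N p \<ge> 0"
    and tri: "p \<in> X \<Longrightarrow> q \<in> X \<Longrightarrow> N (\<lambda>x. p x - q x) \<le> N p + N q"
begin

text \<open>Symmetry is derived by applying \<open>tri\<close> to \<open>0 - p\<close> and to
  \<open>0 - (- p)\<close>.\<close>

lemma neg: assumes "p \<in> X" shows "(\<lambda>x. - p x) \<in> X" "N (\<lambda>x. - p x) = N p"
proof -
  show m: "(\<lambda>x. - p x) \<in> X" using diff[OF zero(1) assms] by simp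
  show "N (\<lambda>x. - p x) = N p"
    using tri[OF zero(1) assms] tri[OF zero(1) m] by (simp add: zero)
qed

lemma commute: "p \<in> X \<Longrightarrow> q \<in> X \<Longrightarrow> N (\<lambda>x. p x - q x) = N (\<lambda>x. q x - p x)"
  using neg(2)[OF diff[of p q]] by simp

lemma tri_mid:
  assumes "p \<in> X" "q \<in> X" "r \<in> X"
  shows "N (\<lambda>x. p x - r x) \<le> N (\<lambda>x. p x - q x) + N (\<lambda>x. q x - r x)"
  using tri[OF diff[OF assms(1,2)] diff[OF assms(3,2)]] commute[OF assms(2,3)] by simp

lemma le_diff:
  assumes "p \<in> X" "q \<in> X"
  shows "\<bar>N p - N q\<bar> \<le> N (\<lambda>x. p x - q x)"
  using tri_mid[OF assms(1) assms(2) zero(1)] tri_mid[OF assms(2) assms(1) zero(1)] commute[OF assms]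
  by simp

lemma diff_diff:
  assumes "p \<in> X" "q \<in> X" "r \<in> X" "s \<in> X"
  shows "N (\<lambda>x. (p x - q x) - (r x - s x)) \<le> N (\<lambda>x. p x - r x) + N (\<lambda>x. q x - s x)"
  using tri[OF diff[OF assms(1,3)] diff[OF assms(2,4)]] by (simp add: algebra_simps)

end

lemma fun_seminorm_L2: "fun_seminorm (L2 \<Omega>) (L2_norm \<Omega>)"
proof
  fix p q :: "'a \<Rightarrow> 'b" assume "p \<in> L2 \<Omega>" "q \<in> L2 \<Omega>"
  then show "L2_norm \<Omega> (\<lambda>x. p x - q x) \<le> L2_norm \<Omega> p + L2_norm \<Omega> q"
    using L2_norm_comb[of p \<Omega> q "-1"] by simp
qed (auto intro: L2_diff L2_zero L2_norm_nonneg simp: L2_norm_def)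

lemma fun_seminorm_V:
  assumes "bounded \<Omega>" "open \<Omega>"
  shows "fun_seminorm (V_space \<Omega> \<Gamma>D) (V_norm \<Omega>)"
proof
  fix p q assume pq: "p \<in> V_space \<Omega> \<Gamma>D" "q \<in> V_space \<Omega> \<Gamma>D"
  show "V_norm \<Omega> (\<lambda>x. p x - q x) \<le> V_norm \<Omega> p + V_norm \<Omega> q"
    unfolding V_norm_diff[OF assms pq[THEN V_space_W12]]
    unfolding V_norm_def
    by (intro fun_seminorm.tri[OF fun_seminorm_L2] W12_L2 pq[THEN V_space_W12])
qed (use L2_norm_grad_zero[OF assms] in \<open>auto intro: V_space_diff V_space_zero assms V_norm_nonneg simp: V_norm_def L2_norm_nonneg\<close>)

lemma fun_seminorm_V_dual:
  assumes "bounded \<Omega>" "open \<Omega>"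
  shows "fun_seminorm (V_dual \<Omega> \<Gamma>D) (V_dual_norm \<Omega> \<Gamma>D)"
proof
  show 0: "(\<lambda>x. 0) \<in> V_dual \<Omega> \<Gamma>D" by (auto simp: V_dual_def intro: exI[of _ 0])
  show "V_dual_norm \<Omega> \<Gamma>D (\<lambda>x. 0) = 0"
    by (intro antisym V_dual_norm_le V_dual_norm_nonneg assms 0) simp
  fix p q assume pq: "p \<in> V_dual \<Omega> \<Gamma>D" "q \<in> V_dual \<Omega> \<Gamma>D"
  show "V_dual_norm \<Omega> \<Gamma>D (\<lambda>x. p x - q x) \<le> V_dual_norm \<Omega> \<Gamma>D p + V_dual_norm \<Omega> \<Gamma>D q"
  proof (rule V_dual_norm_le[OF assms])
    fix v assume v: "v \<in> V_space \<Omega> \<Gamma>D" "V_norm \<Omega> v \<le> 1"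
    have "\<bar>r v\<bar> \<le> V_dual_norm \<Omega> \<Gamma>D r" if "r \<in> V_dual \<Omega> \<Gamma>D" for r
      using V_dual_bound[OF assms that v(1)] V_dual_norm_nonneg[OF assms that] v(2) V_norm_nonneg[of \<Omega> v]
      by (meson mult_left_le order_trans)
    from this[OF pq(1)] this[OF pq(2)]
    show "\<bar>p v - q v\<bar> \<le> V_dual_norm \<Omega> \<Gamma>D p + V_dual_norm \<Omega> \<Gamma>D q" by linarith
  qed
qed (auto intro: V_dual_diff V_dual_norm_nonneg assms)


section \<open>Bochner spaces\<close>

text \<open>The pointwise \<open>lim\<close> is measurable outright and agrees with \<open>g\<close>
  off a null set; completeness of Lebesgue measure does the rest.\<close>

lemma borel_measurable_lebesgue_on_AE_limit:
  fixes f :: "nat \<Rightarrow> 'a::euclidean_space \<Rightarrow> real"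
  assumes S: "S \<in> sets lebesgue" and f: "\<And>n. f n \<in> borel_measurable (lebesgue_on S)"
    and lim: "AE t in lebesgue_on S. (\<lambda>n. f n t) \<longlonglongrightarrow> g t"
  shows "g \<in> borel_measurable (lebesgue_on S)"
proof -
  define l where "l t = lim (\<lambda>n. f n t)" for t
  have "l \<in> borel_measurable (lebesgue_on S)" unfolding l_def by (rule borel_measurable_lim_metric[OF f])
  then have "(\<lambda>t. indicator S t *\<^sub>R l t) \<in> borel_measurable lebesgue"
    using S by (simp add: borel_measurable_restrict_space_iff)
  moreover have "AE t in lebesgue. t \<in> S \<longrightarrow> (\<lambda>n. f n t) \<longlonglongrightarrow> g t"
    using lim S by (simp add: AE_restrict_space_iff)
  then have "AE t in lebesgue. indicator S t *\<^sub>R l t = indicator S t *\<^sub>R g t"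
    by (rule eventually_mono) (auto simp: l_def limI indicator_def)
  ultimately have "(\<lambda>t. indicator S t *\<^sub>R g t) \<in> borel_measurable lebesgue"
    by (rule borel_measurable_AE)
  then show ?thesis using S by (simp add: borel_measurable_restrict_space_iff)
qed

lemma strongly_measurableE:
  assumes "strongly_measurable T X N u"
  obtains s where "\<And>n. simple_function (lebesgue_on {0<..<T}) (s n)" "\<And>n. s n ` {0<..<T} \<subseteq> X"
    "AE t in lebesgue_on {0<..<T}. (\<lambda>n. N (s n t - u t)) \<longlonglongrightarrow> 0"
  using assms unfolding strongly_measurable_def by blast

text \<open>Source of measurability for norms and pairings of Bochner functions: simple approximants
  give simple functions of \<open>t\<close>, and sequential continuity of \<open>\<Phi>\<close>
  passes to the limit.\<close>

lemma strongly_measurable_compose2: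
  assumes u: "strongly_measurable T X M u" "AE t in lebesgue_on {0<..<T}. u t \<in> X"
    and v: "strongly_measurable T Y N v" "AE t in lebesgue_on {0<..<T}. v t \<in> Y"
    and cont: "\<And>p q s r. p \<in> X \<Longrightarrow> q \<in> Y \<Longrightarrow> (\<And>n. s n \<in> X) \<Longrightarrow> (\<And>n. r n \<in> Y) \<Longrightarrow>
      (\<lambda>n. M (s n - p)) \<longlonglongrightarrow> 0 \<Longrightarrow> (\<lambda>n. N (r n - q)) \<longlonglongrightarrow> 0 \<Longrightarrow> (\<lambda>n. \<Phi> (s n) (r n)) \<longlonglongrightarrow> (\<Phi> p q :: real)"
  shows "(\<lambda>t. \<Phi> (u t) (v t)) \<in> borel_measurable (lebesgue_on {0<..<T})"
proof -
  let ?M = "lebesgue_on {0<..<T}"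
  obtain s where s: "\<And>n. simple_function ?M (s n)" "\<And>n. s n ` {0<..<T} \<subseteq> X"
    "AE t in ?M. (\<lambda>n. M (s n t - u t)) \<longlonglongrightarrow> 0"
    by (rule strongly_measurableE[OF u(1)]) (rule that)
  obtain r where r: "\<And>n. simple_function ?M (r n)" "\<And>n. r n ` {0<..<T} \<subseteq> Y"
    "AE t in ?M. (\<lambda>n. N (r n t - v t)) \<longlonglongrightarrow> 0"
    by (rule strongly_measurableE[OF v(1)]) (rule that)
  show ?thesis
  proof (rule borel_measurable_lebesgue_on_AE_limit)
    show "(\<lambda>t. \<Phi> (s n t) (r n t)) \<in> borel_measurable ?M" for n
      by (rule borel_measurable_simple_function[OF simple_function_compose2[OF s(1) r(1)]])
    have "AE t in ?M. t \<in> {0<..<T}" by (intro AE_I2) (simp add: space_restrict_space)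
    then show "AE t in ?M. (\<lambda>n. \<Phi> (s n t) (r n t)) \<longlonglongrightarrow> \<Phi> (u t) (v t)"
      using s(3) r(3) u(2) v(2)
    proof eventually_elim
      case (elim t)
      have "s n t \<in> X" "r n t \<in> Y" for n using s(2)[of n] r(2)[of n] elim(1) by blast+
      then show ?case by (rule cont[OF elim(4,5) _ _ elim(2,3)])
    qed
  qed simp
qed

lemma bochner_L2_D:
  assumes "u \<in> bochner_L2 T X N"
  shows "AE t in lebesgue_on {0<..<T}. u t \<in> X" "strongly_measurable T X N u"
    "integrable (lebesgue_on {0<..<T}) (\<lambda>t. (N (u t))\<^sup>2)"
  using assms by (auto simp: bochner_L2_def)

context fun_seminorm
begin

lemma strongly_measurable_simple:
  assumes "simple_function (lebesgue_on {0<..<T}) s" "s ` {0<..<T} \<subseteq> X"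
  shows "strongly_measurable T X N s"
  unfolding strongly_measurable_def
  by (rule exI[of _ "\<lambda>_. s"]) (use assms zero in \<open>auto simp: fun_diff_def\<close>)

lemma tendsto_N:
  assumes "p \<in> X" "\<And>n. s n \<in> X" "(\<lambda>n. N (s n - p)) \<longlonglongrightarrow> 0"
  shows "(\<lambda>n. N (s n)) \<longlonglongrightarrow> N p"
proof (rule LIM_zero_cancel, rule Lim_null_comparison[OF _ assms(3)])
  show "\<forall>\<^sub>F n in sequentially. norm (N (s n) - N p) \<le> N (s n - p)"
    using le_diff[OF assms(2,1)] by (intro always_eventually) (simp add: fun_diff_def)
qed

lemma norm_diff_measurable:
  assumes "strongly_measurable T X N u" "AE t in lebesgue_on {0<..<T}. u t \<in> X"
    "strongly_measurable T X N v" "AE t in lebesgue_on {0<..<T}. v t \<in> X"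
  shows "(\<lambda>t. N (\<lambda>x. u t x - v t x)) \<in> borel_measurable (lebesgue_on {0<..<T})"
proof (rule strongly_measurable_compose2[OF assms, where \<Phi> = "\<lambda>p q. N (\<lambda>x. p x - q x)"])
  fix p q s r assume *: "p \<in> X" "q \<in> X" "\<And>n. s n \<in> X" "\<And>n. r n \<in> X"
    "(\<lambda>n. N (s n - p)) \<longlonglongrightarrow> 0" "(\<lambda>n. N (r n - q)) \<longlonglongrightarrow> 0"
  have "(\<lambda>n. N (\<lambda>x. s n x - p x) + N (\<lambda>x. r n x - q x)) \<longlonglongrightarrow> 0 + 0"
    using *(5,6) by (intro tendsto_add) (simp_all add: fun_diff_def)
  then have lim: "(\<lambda>n. N (\<lambda>x. s n x - p x) + N (\<lambda>x. r n x - q x)) \<longlonglongrightarrow> 0" by simp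
  show "(\<lambda>n. N (\<lambda>x. s n x - r n x)) \<longlonglongrightarrow> N (\<lambda>x. p x - q x)"
  proof (rule LIM_zero_cancel, rule Lim_null_comparison[OF _ lim], intro always_eventually allI)
    fix n
    have "\<bar>N (\<lambda>x. s n x - r n x) - N (\<lambda>x. p x - q x)\<bar> \<le> N (\<lambda>x. (s n x - r n x) - (p x - q x))"
      by (intro le_diff diff *)
    also have "\<dots> \<le> N (\<lambda>x. s n x - p x) + N (\<lambda>x. r n x - q x)" by (intro diff_diff *)
    finally show "norm (N (\<lambda>x. s n x - r n x) - N (\<lambda>x. p x - q x)) \<le> N (\<lambda>x. s n x - p x) + N (\<lambda>x. r n x - q x)"
      by simp
  qed
qed

lemma strongly_measurable_const:
  assumes "p \<in> X" shows "strongly_measurable T X N (\<lambda>_. p)"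
  by (rule strongly_measurable_simple) (use assms in auto)

lemma norm_measurable:
  assumes "strongly_measurable T X N u" "AE t in lebesgue_on {0<..<T}. u t \<in> X"
  shows "(\<lambda>t. N (u t)) \<in> borel_measurable (lebesgue_on {0<..<T})"
proof -
  have "(\<lambda>t. N (\<lambda>x. u t x - 0)) \<in> borel_measurable (lebesgue_on {0<..<T})"
    by (rule norm_diff_measurable[OF assms strongly_measurable_const[OF zero(1)]]) (intro AE_I2 zero(1))
  then show ?thesis unfolding diff_zero .
qed

lemma bochner_const:
  assumes "p \<in> X" shows "(\<lambda>_. p) \<in> bochner_L2 T X N"
  unfolding bochner_L2_def
proof (intro CollectI conjI AE_I2 assms strongly_measurable_const)
  show "integrable (lebesgue_on {0<..<T}) (\<lambda>t. (N p)\<^sup>2)"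
    by (intro finite_measure.integrable_const finite_measure_lebesgue_on) simp
qed

text \<open>Applied to gradients, scalings and pointwise Lipschitz maps. The hypothesis compares
  \<open>F p - F q\<close> with \<open>p - q\<close> instead of asking for linearity, because the
  projection is nonlinear and \<open>grad\<close> is linear only almost everywhere.\<close>

lemma bochner_image:
  assumes u: "u \<in> bochner_L2 T X N" and Y: "fun_seminorm Y M"
    and F: "\<And>p. p \<in> X \<Longrightarrow> F p \<in> Y" "\<And>p. p \<in> X \<Longrightarrow> M (F p) \<le> K * N p"
      "\<And>p q. p \<in> X \<Longrightarrow> q \<in> X \<Longrightarrow> M (\<lambda>x. F p x - F q x) \<le> K * N (\<lambda>x. p x - q x)"
  shows "(\<lambda>t. F (u t)) \<in> bochner_L2 T Y M"
proof -
  let ?M = "lebesgue_on {0<..<T}"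
  interpret Y: fun_seminorm Y M by (rule Y)
  note u = bochner_L2_D[OF u]
  obtain s where s: "\<And>n. simple_function ?M (s n)" "\<And>n. s n ` {0<..<T} \<subseteq> X"
    "AE t in ?M. (\<lambda>n. N (s n t - u t)) \<longlonglongrightarrow> 0"
    by (rule strongly_measurableE[OF u(2)]) (rule that)
  have inI: "AE t in ?M. t \<in> {0<..<T}" by (intro AE_I2) (simp add: space_restrict_space)
  have mem: "AE t in ?M. F (u t) \<in> Y" using u(1) by eventually_elim (rule F(1))
  have sm: "strongly_measurable T Y M (\<lambda>t. F (u t))"
    unfolding strongly_measurable_def
  proof (intro exI[of _ "\<lambda>n t. F (s n t)"] conjI allI)
    show "simple_function ?M (\<lambda>t. F (s n t))" for n
      using simple_function_compose[OF s(1)[of n], of F] by (simp add: comp_def)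
    show "(\<lambda>t. F (s n t)) ` {0<..<T} \<subseteq> Y" for n using s(2)[of n] F(1) by auto
    show "AE t in ?M. (\<lambda>n. M (F (s n t) - F (u t))) \<longlonglongrightarrow> 0"
      using s(3) u(1) inI
    proof eventually_elim
      case (elim t)
      have sX: "s n t \<in> X" for n using s(2)[of n] elim(3) by auto
      show ?case
      proof (rule Lim_null_comparison[OF _ tendsto_mult_right_zero[OF elim(1), of K]], intro always_eventually allI)
        fix n
        show "norm (M (F (s n t) - F (u t))) \<le> K * N (s n t - u t)"
          using F(3)[OF sX elim(2), of n] Y.nonneg[OF Y.diff[OF F(1)[OF sX] F(1)[OF elim(2)]], of n]
          unfolding fun_diff_def by simp
      qed
    qed
  qed
  have "integrable ?M (\<lambda>t. (M (F (u t)))\<^sup>2)"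
  proof (rule Bochner_Integration.integrable_bound)
    show "integrable ?M (\<lambda>t. K\<^sup>2 * (N (u t))\<^sup>2)" using u(3) by simp
    show "(\<lambda>t. (M (F (u t)))\<^sup>2) \<in> borel_measurable ?M"
      using Y.norm_measurable[OF sm mem] by simp
    show "AE t in ?M. norm ((M (F (u t)))\<^sup>2) \<le> norm (K\<^sup>2 * (N (u t))\<^sup>2)"
      using u(1)
    proof eventually_elim
      case (elim t)
      have "(M (F (u t)))\<^sup>2 \<le> (K * N (u t))\<^sup>2"
        by (intro power_mono F(2) elim Y.nonneg F(1))
      then show ?case by (simp add: power_mult_distrib)
    qed
  qed
  with mem sm show ?thesis by (simp add: bochner_L2_def)
qed

lemma bochner_diff:
  assumes "u \<in> bochner_L2 T X N" "v \<in> bochner_L2 T X N"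
  shows "(\<lambda>t x. u t x - v t x) \<in> bochner_L2 T X N"
proof -
  let ?M = "lebesgue_on {0<..<T}"
  note u = bochner_L2_D[OF assms(1)] and v = bochner_L2_D[OF assms(2)]
  obtain s where s: "\<And>n. simple_function ?M (s n)" "\<And>n. s n ` {0<..<T} \<subseteq> X"
    "AE t in ?M. (\<lambda>n. N (s n t - u t)) \<longlonglongrightarrow> 0"
    by (rule strongly_measurableE[OF u(2)]) (rule that)
  obtain r where r: "\<And>n. simple_function ?M (r n)" "\<And>n. r n ` {0<..<T} \<subseteq> X"
    "AE t in ?M. (\<lambda>n. N (r n t - v t)) \<longlonglongrightarrow> 0"
    by (rule strongly_measurableE[OF v(2)]) (rule that)
  have inI: "AE t in ?M. t \<in> {0<..<T}" by (intro AE_I2) (simp add: space_restrict_space)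
  have mem: "AE t in ?M. (\<lambda>x. u t x - v t x) \<in> X" using u(1) v(1) by eventually_elim (rule diff)
  have sm: "strongly_measurable T X N (\<lambda>t x. u t x - v t x)"
    unfolding strongly_measurable_def
  proof (intro exI[of _ "\<lambda>n t x. s n t x - r n t x"] conjI allI)
    show "simple_function ?M (\<lambda>t x. s n t x - r n t x)" for n
      by (rule simple_function_compose2[OF s(1) r(1), where h = "\<lambda>p q x. p x - q x"])
    show "(\<lambda>t x. s n t x - r n t x) ` {0<..<T} \<subseteq> X" for n using s(2)[of n] r(2)[of n] diff by auto
    show "AE t in ?M. (\<lambda>n. N ((\<lambda>x. s n t x - r n t x) - (\<lambda>x. u t x - v t x))) \<longlonglongrightarrow> 0"
      using s(3) r(3) u(1) v(1) inI
    proof eventually_elim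
      case (elim t)
      have sX: "s n t \<in> X" "r n t \<in> X" for n using s(2)[of n] r(2)[of n] elim by auto
      have "(\<lambda>n. N (s n t - u t) + N (r n t - v t)) \<longlonglongrightarrow> 0"
        using tendsto_add[OF elim(1,2)] by simp
      then show ?case
      proof (rule Lim_null_comparison[rotated], intro always_eventually allI)
        fix n
        show "norm (N ((\<lambda>x. s n t x - r n t x) - (\<lambda>x. u t x - v t x))) \<le> N (s n t - u t) + N (r n t - v t)"
          using diff_diff[OF sX elim(3,4), of n] nonneg[OF diff[OF diff[OF sX] diff[OF elim(3,4)]], of n]
          unfolding fun_diff_def by simp
      qed
    qed
  qed
  have "integrable ?M (\<lambda>t. (N (\<lambda>x. u t x - v t x))\<^sup>2)"
  proof (rule Bochner_Integration.integrable_bound)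
    show "integrable ?M (\<lambda>t. 2 * (N (u t))\<^sup>2 + 2 * (N (v t))\<^sup>2)" using u(3) v(3) by auto
    show "(\<lambda>t. (N (\<lambda>x. u t x - v t x))\<^sup>2) \<in> borel_measurable ?M"
      using norm_measurable[OF sm mem] by simp
    show "AE t in ?M. norm ((N (\<lambda>x. u t x - v t x))\<^sup>2) \<le> norm (2 * (N (u t))\<^sup>2 + 2 * (N (v t))\<^sup>2)"
      using u(1) v(1)
    proof eventually_elim
      case (elim t)
      have "(N (\<lambda>x. u t x - v t x))\<^sup>2 \<le> (N (u t) + N (v t))\<^sup>2"
        using tri[OF elim] nonneg[OF diff[OF elim]] by (simp add: power_mono)
      also have "\<dots> \<le> 2 * (N (u t))\<^sup>2 + 2 * (N (v t))\<^sup>2"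
        using sum_squares_bound[of "N (u t)" "N (v t)"] by (simp add: power2_sum)
      finally show ?case by simp
    qed
  qed
  with mem sm show ?thesis by (simp add: bochner_L2_def)
qed

lemma bochner_simple_approx:
  assumes "u \<in> bochner_L2 T X N" "e > 0"
  obtains s where "simple_function (lebesgue_on {0<..<T}) s" "s ` {0<..<T} \<subseteq> X"
    "integrable (lebesgue_on {0<..<T}) (\<lambda>t. (N (\<lambda>x. u t x - s t x))\<^sup>2)"
    "(LINT t|lebesgue_on {0<..<T}. (N (\<lambda>x. u t x - s t x))\<^sup>2) < e"
proof -
  let ?M = "lebesgue_on {0<..<T}"
  note u = bochner_L2_D[OF assms(1)]
  obtain s where s: "\<And>n. simple_function ?M (s n)" "\<And>n. s n ` {0<..<T} \<subseteq> X"
    "AE t in ?M. (\<lambda>n. N (s n t - u t)) \<longlonglongrightarrow> 0"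
    by (rule strongly_measurableE[OF u(2)]) (rule that)
  have inI: "AE t in ?M. t \<in> {0<..<T}" by (intro AE_I2) (simp add: space_restrict_space)
  have [measurable]: "(\<lambda>t. N (u t)) \<in> borel_measurable ?M" by (rule norm_measurable[OF u(2,1)])
  have [measurable]: "(\<lambda>t. N (s n t)) \<in> borel_measurable ?M" for n
    using borel_measurable_simple_function[OF simple_function_compose[OF s(1)[of n], of N]] by (simp add: comp_def)
  \<comment> \<open>Dropping values of more than twice the norm of \<open>u t\<close> gives
    domination by \<open>9 * (N (u t))\<^sup>2\<close>. The factor 2 leaves room: where
    \<open>N (u t) > 0\<close>, the values \<open>s n t\<close> are eventually kept; where it is 0,
    only values of norm 0 survive.\<close>
  define r where "r n t = (if N (s n t) \<le> 2 * N (u t) then s n t else (\<lambda>x. 0))" for n t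
  have r: "simple_function ?M (r n)" for n
  proof -
    have "{t \<in> space ?M. N (s n t) \<le> 2 * N (u t)} \<in> sets ?M" by measurable
    then show ?thesis unfolding r_def by (rule simple_function_If[OF s(1) simple_function_const])
  qed
  have rX: "r n ` {0<..<T} \<subseteq> X" for n using s(2)[of n] zero(1) by (auto simp: r_def)
  have meas: "(\<lambda>t. N (\<lambda>x. u t x - r n t x)) \<in> borel_measurable ?M" for n
    by (rule norm_diff_measurable[OF u(2,1) strongly_measurable_simple[OF r rX]])
       (use rX[of n] in \<open>auto intro!: AE_I2 simp: space_restrict_space image_subset_iff\<close>)
  have lim: "AE t in ?M. (\<lambda>n. (N (\<lambda>x. u t x - r n t x))\<^sup>2) \<longlonglongrightarrow> 0\<^sup>2"
    using s(3) u(1) inI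
  proof eventually_elim
    case (elim t)
    have sX: "s n t \<in> X" for n using s(2)[of n] elim(3) by auto
    have rX': "r n t \<in> X" for n using rX[of n] elim(3) by auto
    have "(\<lambda>n. N (\<lambda>x. u t x - r n t x)) \<longlonglongrightarrow> 0"
    proof (cases "N (u t) = 0")
      case True
      have "N (r n t) \<le> 0" for n using True zero by (simp add: r_def)
      then have "N (\<lambda>x. u t x - r n t x) = 0" for n
        using tri[OF elim(2) rX', of n] nonneg[OF diff[OF elim(2) rX']] True by (intro antisym) (auto intro: order_trans)
      then show ?thesis by simp
    next
      case False
      then have "N (u t) < 2 * N (u t)" using nonneg[OF elim(2)] by simp
      moreover have "(\<lambda>n. N (s n t)) \<longlonglongrightarrow> N (u t)" by (rule tendsto_N[OF elim(2) sX elim(1)])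
      ultimately have "\<forall>\<^sub>F n in sequentially. N (s n t) < 2 * N (u t)" by (simp add: order_tendstoD)
      then have "\<forall>\<^sub>F n in sequentially. N (s n t - u t) = N (\<lambda>x. u t x - r n t x)"
        by eventually_elim (use commute[OF elim(2) sX] in \<open>simp add: r_def fun_diff_def\<close>)
      then show ?thesis using elim(1) by (rule Lim_transform_eventually[rotated])
    qed
    then show ?case by (rule tendsto_power)
  qed
  have bnd: "AE t in ?M. norm ((N (\<lambda>x. u t x - r n t x))\<^sup>2) \<le> 9 * (N (u t))\<^sup>2" for n
    using u(1) inI
  proof eventually_elim
    case (elim t)
    have rX': "r n t \<in> X" using rX[of n] elim(2) by auto
    have "N (r n t) \<le> 2 * N (u t)" using zero nonneg[OF elim(1)] by (simp add: r_def)
    with tri[OF elim(1) rX'] have "N (\<lambda>x. u t x - r n t x) \<le> 3 * N (u t)" by simp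
    then have "(N (\<lambda>x. u t x - r n t x))\<^sup>2 \<le> (3 * N (u t))\<^sup>2"
      by (intro power_mono nonneg diff elim rX')
    then show ?case by (simp add: power_mult_distrib)
  qed
  have int: "integrable ?M (\<lambda>t. 9 * (N (u t))\<^sup>2)" using u(3) by simp
  have "(\<lambda>n. LINT t|?M. (N (\<lambda>x. u t x - r n t x))\<^sup>2) \<longlonglongrightarrow> (LINT t|?M. 0\<^sup>2)"
    by (rule integral_dominated_convergence[OF _ _ int lim bnd]) (use meas in auto)
  then have "\<forall>\<^sub>F n in sequentially. (LINT t|?M. (N (\<lambda>x. u t x - r n t x))\<^sup>2) < e"
    using assms(2) by (simp add: order_tendstoD)
  then obtain n where "(LINT t|?M. (N (\<lambda>x. u t x - r n t x))\<^sup>2) < e"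
    by (auto simp: eventually_sequentially)
  moreover have "integrable ?M (\<lambda>t. (N (\<lambda>x. u t x - r n t x))\<^sup>2)"
    by (rule Bochner_Integration.integrable_bound[OF int]) (use meas bnd in \<open>auto elim!: eventually_mono\<close>)
  ultimately show ?thesis using that r rX by blast
qed

end

text \<open>Supplies countably many test elements among the values of \<open>u\<close> itself. The
  simple approximants in the two norms are unrelated functions, so each selected time is close to a
  pair of values, \<open>p\<close> with respect to \<open>M\<close> and \<open>q\<close> with
  respect to \<open>N\<close>.\<close>

lemma bochner_countable_dense:
  fixes u :: "real \<Rightarrow> 'd \<Rightarrow> 'e::real_vector"
  assumes X: "fun_seminorm X M" and Y: "fun_seminorm Y N"
    and u: "u \<in> bochner_L2 T X M" "u \<in> bochner_L2 T Y N"
  obtains C where "countable C" "C \<subseteq> {0<..<T}" "\<And>c. c \<in> C \<Longrightarrow> u c \<in> X"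
    "AE t in lebesgue_on {0<..<T}. \<forall>e>0. \<exists>c\<in>C. M (\<lambda>x. u t x - u c x) < e \<and> N (\<lambda>x. u t x - u c x) < e"
proof -
  let ?M = "lebesgue_on {0<..<T}"
  interpret X: fun_seminorm X M by (rule X)
  interpret Y: fun_seminorm Y N by (rule Y)
  note uX = bochner_L2_D[OF u(1)] and uY = bochner_L2_D[OF u(2)]
  obtain s where s: "\<And>n. simple_function ?M (s n)" "\<And>n. s n ` {0<..<T} \<subseteq> X"
    "AE t in ?M. (\<lambda>n. M (s n t - u t)) \<longlonglongrightarrow> 0"
    by (rule strongly_measurableE[OF uX(2)]) (rule that)
  obtain r where r: "\<And>n. simple_function ?M (r n)" "\<And>n. r n ` {0<..<T} \<subseteq> Y"
    "AE t in ?M. (\<lambda>n. N (r n t - u t)) \<longlonglongrightarrow> 0"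
    by (rule strongly_measurableE[OF uY(2)]) (rule that)
  define S where "S = (\<Union>n. s n ` {0<..<T})"
  define R where "R = (\<Union>n. r n ` {0<..<T})"
  have "finite (s n ` {0<..<T})" "finite (r n ` {0<..<T})" for n
    using s(1)[of n] r(1)[of n] by (simp_all add: simple_function_def space_restrict_space)
  then have cnt: "countable S" "countable R"
    unfolding S_def R_def by (auto intro: countable_finite)
  define P where "P k p q c \<longleftrightarrow> c \<in> {0<..<T} \<and> u c \<in> X \<and> u c \<in> Y \<and> M (\<lambda>x. p x - u c x) < 1 / Suc k \<and> N (\<lambda>x. q x - u c x) < 1 / Suc k"
    for k :: nat and p q c
  define pick where "pick = (\<lambda>(k, p, q). SOME c. P k p q c)"
  define C where "C = pick ` {(k, p, q) \<in> UNIV \<times> S \<times> R. \<exists>c. P k p q c}"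
  have pick: "P k p q (pick (k, p, q))" if "P k p q c" for k p q c
    unfolding pick_def using someI[of "P k p q", OF that] by simp
  have C: "\<exists>k p q. P k p q c" if "c \<in> C" for c
  proof -
    from that obtain k p q c' where "P k p q c'" "c = pick (k, p, q)" by (auto simp: C_def)
    with pick show ?thesis by blast
  qed
  have "countable C"
  proof (rule countable_subset)
    show "C \<subseteq> pick ` (UNIV \<times> S \<times> R)" by (auto simp: C_def)
    show "countable (pick ` (UNIV \<times> S \<times> R))" using cnt by (intro countable_image countable_SIGMA) auto
  qed
  moreover have "C \<subseteq> {0<..<T}" "\<And>c. c \<in> C \<Longrightarrow> u c \<in> X" using C unfolding P_def by blast+
  moreover have "AE t in ?M. t \<in> {0<..<T}" by (intro AE_I2) (simp add: space_restrict_space)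
  then have "AE t in ?M. \<forall>e>0. \<exists>c\<in>C. M (\<lambda>x. u t x - u c x) < e \<and> N (\<lambda>x. u t x - u c x) < e"
    using s(3) r(3) uX(1) uY(1)
  proof eventually_elim
    case (elim t)
    show ?case
    proof (intro allI impI)
      fix e :: real assume "e > 0"
      then obtain k :: nat where k: "1 / Suc k < e / 2" using nat_approx_posE[of "e/2"] by auto
      have "\<forall>\<^sub>F n in sequentially. M (s n t - u t) < 1 / Suc k" "\<forall>\<^sub>F n in sequentially. N (r n t - u t) < 1 / Suc k"
        using elim(2,3) by (auto intro!: order_tendstoD)
      then obtain n m where nm: "M (s n t - u t) < 1 / Suc k" "N (r m t - u t) < 1 / Suc k"
        by (auto simp: eventually_sequentially)
      have mem: "s n t \<in> X" "r m t \<in> Y" "s n t \<in> S" "r m t \<in> R"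
        using s(2)[of n] r(2)[of m] elim(1) unfolding S_def R_def by blast+
      \<comment> \<open>The time \<open>t\<close> itself witnesses that some time is close to this
        pair, so \<open>pick\<close> returns one that is.\<close>
      have Pt: "P k (s n t) (r m t) t" using nm elim by (simp add: P_def fun_diff_def)
      define c where "c = pick (k, s n t, r m t)"
      have c: "c \<in> C" unfolding C_def c_def using Pt mem by (intro imageI) auto
      have Pc: "P k (s n t) (r m t) c" unfolding c_def by (rule pick[OF Pt])
      have "M (\<lambda>x. u t x - u c x) \<le> M (\<lambda>x. u t x - s n t x) + M (\<lambda>x. s n t x - u c x)"
        by (rule X.tri_mid) (use Pc mem elim in \<open>auto simp: P_def\<close>)
      moreover have "N (\<lambda>x. u t x - u c x) \<le> N (\<lambda>x. u t x - r m t x) + N (\<lambda>x. r m t x - u c x)"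
        by (rule Y.tri_mid) (use Pc mem elim in \<open>auto simp: P_def\<close>)
      ultimately have "M (\<lambda>x. u t x - u c x) < e \<and> N (\<lambda>x. u t x - u c x) < e"
        using Pc Pt k X.commute[OF mem(1) elim(4)] Y.commute[OF mem(2) elim(5)] unfolding P_def by linarith
      with c show "\<exists>c\<in>C. M (\<lambda>x. u t x - u c x) < e \<and> N (\<lambda>x. u t x - u c x) < e" by blast
    qed
  qed
  ultimately show ?thesis using that by blast
qed

text \<open>Common frame for the inner product of \<open>L2\<close> and for the duality of
  \<open>V_dual\<close> and \<open>V_space\<close>; additivity is stated through differences, as in
  \<open>fun_seminorm\<close>.\<close>

locale fun_pairing = X: fun_seminorm X M + Y: fun_seminorm Y N
  for X :: "('d \<Rightarrow> 'e::real_vector) set" and M and Y :: "('f \<Rightarrow> 'g::real_vector) set" and N +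
  fixes \<Phi> :: "('d \<Rightarrow> 'e) \<Rightarrow> ('f \<Rightarrow> 'g) \<Rightarrow> real"
  assumes diff_left: "p \<in> X \<Longrightarrow> p' \<in> X \<Longrightarrow> q \<in> Y \<Longrightarrow> \<Phi> (\<lambda>x. p x - p' x) q = \<Phi> p q - \<Phi> p' q"
    and diff_right: "p \<in> X \<Longrightarrow> q \<in> Y \<Longrightarrow> q' \<in> Y \<Longrightarrow> \<Phi> p (\<lambda>x. q x - q' x) = \<Phi> p q - \<Phi> p q'"
    and bound: "p \<in> X \<Longrightarrow> q \<in> Y \<Longrightarrow> \<bar>\<Phi> p q\<bar> \<le> M p * N q"
begin

lemma pairing_measurable:
  assumes "strongly_measurable T X M u" "AE t in lebesgue_on {0<..<T}. u t \<in> X"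
    "strongly_measurable T Y N v" "AE t in lebesgue_on {0<..<T}. v t \<in> Y"
  shows "(\<lambda>t. \<Phi> (u t) (v t)) \<in> borel_measurable (lebesgue_on {0<..<T})"
proof (rule strongly_measurable_compose2[OF assms])
  fix p q s r assume *: "p \<in> X" "q \<in> Y" "\<And>n. s n \<in> X" "\<And>n. r n \<in> Y"
    and lim: "(\<lambda>n. M (s n - p)) \<longlonglongrightarrow> 0" "(\<lambda>n. N (r n - q)) \<longlonglongrightarrow> 0"
  have "(\<lambda>n. M (s n - p) * N (r n) + M p * N (r n - q)) \<longlonglongrightarrow> 0 * N q + M p * 0"
    by (intro tendsto_intros lim Y.tendsto_N *)
  then have lim0: "(\<lambda>n. M (s n - p) * N (r n) + M p * N (r n - q)) \<longlonglongrightarrow> 0" by simp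
  show "(\<lambda>n. \<Phi> (s n) (r n)) \<longlonglongrightarrow> \<Phi> p q"
  proof (rule LIM_zero_cancel, rule Lim_null_comparison[OF _ lim0], intro always_eventually allI)
    fix n
    have "\<Phi> (s n) (r n) - \<Phi> p q = \<Phi> (\<lambda>x. s n x - p x) (r n) + \<Phi> p (\<lambda>x. r n x - q x)"
      using * by (simp add: diff_left diff_right)
    also have "\<bar>\<dots>\<bar> \<le> M (\<lambda>x. s n x - p x) * N (r n) + M p * N (\<lambda>x. r n x - q x)"
      by (rule order_trans[OF abs_triangle_ineq add_mono]) (intro bound X.diff Y.diff *)+
    finally show "norm (\<Phi> (s n) (r n) - \<Phi> p q) \<le> M (s n - p) * N (r n) + M p * N (r n - q)"
      by (simp add: fun_diff_def)
  qed
qed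

lemma pairing_integrable:
  assumes "u \<in> bochner_L2 T X M" "v \<in> bochner_L2 T Y N"
  shows "integrable (lebesgue_on {0<..<T}) (\<lambda>t. \<Phi> (u t) (v t))"
proof (rule Bochner_Integration.integrable_bound)
  note u = bochner_L2_D[OF assms(1)] and v = bochner_L2_D[OF assms(2)]
  show "integrable (lebesgue_on {0<..<T}) (\<lambda>t. (M (u t))\<^sup>2 + (N (v t))\<^sup>2)" using u(3) v(3) by simp
  show "(\<lambda>t. \<Phi> (u t) (v t)) \<in> borel_measurable (lebesgue_on {0<..<T})"
    by (rule pairing_measurable[OF u(2,1) v(2,1)])
  show "AE t in lebesgue_on {0<..<T}. norm (\<Phi> (u t) (v t)) \<le> norm ((M (u t))\<^sup>2 + (N (v t))\<^sup>2)"
    using u(1) v(1)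
  proof eventually_elim
    case (elim t)
    then show ?case
      using bound[OF elim] sum_squares_bound[of "M (u t)" "N (v t)"]
        mult_nonneg_nonneg[OF X.nonneg[OF elim(1)] Y.nonneg[OF elim(2)]] by simp
  qed
qed

end

lemma fun_pairing_L2: "fun_pairing (L2 \<Omega>) (L2_norm \<Omega>) (L2 \<Omega>) (L2_norm \<Omega>) (L2_ip \<Omega>)"
proof -
  interpret fun_seminorm "L2 \<Omega> :: ('a \<Rightarrow> 'b) set" "L2_norm \<Omega>" by (rule fun_seminorm_L2)
  show ?thesis by unfold_locales (simp_all add: L2_ip_diff_left L2_ip_diff_right L2_cauchy_schwarz)
qed

lemma fun_pairing_V:
  assumes "bounded \<Omega>" "open \<Omega>"
  shows "fun_pairing (V_dual \<Omega> \<Gamma>D) (V_dual_norm \<Omega> \<Gamma>D) (V_space \<Omega> \<Gamma>D) (V_norm \<Omega>) (\<lambda>\<zeta> v. \<zeta> v)"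
proof -
  interpret D: fun_seminorm "V_dual \<Omega> \<Gamma>D" "V_dual_norm \<Omega> \<Gamma>D" by (rule fun_seminorm_V_dual[OF assms])
  interpret fun_seminorm "V_space \<Omega> \<Gamma>D" "V_norm \<Omega>" by (rule fun_seminorm_V[OF assms])
  show ?thesis by unfold_locales (simp, rule V_dual_diff_arg[OF assms], auto intro: V_dual_bound[OF assms])
qed


section \<open>Integrals over time intervals\<close>

lemma borel_measurable_lebesgue_onI: "f \<in> borel_measurable borel \<Longrightarrow> f \<in> borel_measurable (lebesgue_on S)"
  by (intro measurable_restrict_space1 measurable_completion) simp

text \<open>Restricting to \<open>{0<..<T}\<close> extends \<open>f\<close> by zero, so windows may stick out of the time interval.\<close>

definition tint :: "real \<Rightarrow> (real \<Rightarrow> real) \<Rightarrow> real \<Rightarrow> real \<Rightarrow> real" where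
  "tint T f a b = (LINT r|lebesgue_on {0<..<T}. indicator {a..<b} r * f r)"

lemma tint_integrable:
  fixes f :: "real \<Rightarrow> real"
  assumes "integrable (lebesgue_on {0<..<T}) f"
  shows "integrable (lebesgue_on {0<..<T}) (\<lambda>r. indicator {a..<b} r * f r)"
proof (rule Bochner_Integration.integrable_bound[OF assms])
  have [measurable]: "indicat_real {a..<b} \<in> borel_measurable (lebesgue_on {0<..<T})"
    by (intro borel_measurable_lebesgue_onI) simp
  show "(\<lambda>r. indicator {a..<b} r * f r) \<in> borel_measurable (lebesgue_on {0<..<T})"
    using assms by measurable
qed (auto simp: indicator_def)

lemma tint_combine:
  assumes "integrable (lebesgue_on {0<..<T}) f" "a \<le> b" "b \<le> c"
  shows "tint T f a c = tint T f a b + tint T f b c"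
proof -
  \<comment> \<open>Half-open windows make this exact at every \<open>r\<close>, the common end
    point included.\<close>
  have "indicator {a..<c} r * f r = indicator {a..<b} r * f r + indicator {b..<c} r * f r" for r
    using assms(2,3) by (auto simp: indicator_def)
  then show ?thesis
    unfolding tint_def using tint_integrable[OF assms(1)] by (simp add: Bochner_Integration.integral_add)
qed

lemma tint_add:
  assumes "integrable (lebesgue_on {0<..<T}) f" "integrable (lebesgue_on {0<..<T}) h"
  shows "tint T (\<lambda>r. f r + h r) a b = tint T f a b + tint T h a b"
  unfolding tint_def using tint_integrable[OF assms(1)] tint_integrable[OF assms(2)] by (simp add: distrib_left)

lemma tint_diff:
  assumes "integrable (lebesgue_on {0<..<T}) f" "integrable (lebesgue_on {0<..<T}) h"
  shows "tint T (\<lambda>r. f r - h r) a b = tint T f a b - tint T h a b"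
  unfolding tint_def using tint_integrable[OF assms(1)] tint_integrable[OF assms(2)] by (simp add: right_diff_distrib)

lemma tint_cmult: "tint T (\<lambda>r. c * f r) a b = c * tint T f a b"
  unfolding tint_def by (simp add: mult.left_commute[of _ c])

lemma tint_mono:
  assumes "integrable (lebesgue_on {0<..<T}) f" "integrable (lebesgue_on {0<..<T}) h"
    and "AE r in lebesgue_on {0<..<T}. a \<le> r \<and> r < b \<longrightarrow> f r \<le> h r"
  shows "tint T f a b \<le> tint T h a b"
  unfolding tint_def
  by (rule integral_mono_AE[OF tint_integrable[OF assms(1)] tint_integrable[OF assms(2)]])
     (use assms(3) in \<open>eventually_elim, auto simp: indicator_def\<close>)

lemma tint_cong_AE:
  assumes "integrable (lebesgue_on {0<..<T}) f" "integrable (lebesgue_on {0<..<T}) h"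
    and "AE r in lebesgue_on {0<..<T}. f r = h r"
  shows "tint T f a b = tint T h a b"
  by (intro antisym tint_mono assms(1,2)) (use assms(3) in \<open>auto elim: eventually_mono\<close>)

lemma tint_nonneg:
  assumes "AE r in lebesgue_on {0<..<T}. 0 \<le> f r"
  shows "0 \<le> tint T f a b"
  unfolding tint_def
  by (rule integral_nonneg_AE) (use assms in \<open>auto elim: eventually_mono\<close>)

lemma tint_abs_le:
  assumes "integrable (lebesgue_on {0<..<T}) f"
  shows "\<bar>tint T f a b\<bar> \<le> tint T (\<lambda>r. \<bar>f r\<bar>) a b"
proof -
  have "\<bar>tint T f a b\<bar> \<le> (LINT r|lebesgue_on {0<..<T}. \<bar>indicator {a..<b} r * f r\<bar>)"
    unfolding tint_def by (rule integral_abs_bound)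
  also have "\<dots> = tint T (\<lambda>r. \<bar>f r\<bar>) a b"
    unfolding tint_def by (simp add: abs_mult)
  finally show ?thesis .
qed

lemma tint_mono_interval:
  assumes "integrable (lebesgue_on {0<..<T}) f" "AE r in lebesgue_on {0<..<T}. 0 \<le> f r" "c \<le> a" "b \<le> d"
  shows "tint T f a b \<le> tint T f c d"
  unfolding tint_def
  by (rule integral_mono_AE[OF tint_integrable[OF assms(1)] tint_integrable[OF assms(1)]])
     (use assms(2-4) in \<open>auto simp: indicator_def elim!: eventually_mono\<close>)

lemma tint_full: "tint T f 0 T = (LINT r|lebesgue_on {0<..<T}. f r)"
  unfolding tint_def by (rule Bochner_Integration.integral_cong) (auto simp: space_restrict_space)

text \<open>Bridge to the gauge integral, from which continuity of primitives, differentiation and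
  the fundamental theorem of calculus are taken.\<close>

lemma tint_HK:
  assumes f: "integrable (lebesgue_on {0<..<T}) f" and ab: "a \<le> b"
  shows "tint T f a b = integral {a..b} (\<lambda>r. indicator {0<..<T} r * f r)"
    and "(\<lambda>r. indicator {0<..<T} r * f r) integrable_on {a..b}"
proof -
  let ?F = "\<lambda>r. indicator {0<..<T} r * f r"
  have F: "integrable lebesgue ?F"
    using f integrable_restrict_space[of "{0<..<T}" lebesgue f] by simp
  show on: "?F integrable_on {a..b}"
    using integrable_on_subcbox[OF integrable_on_lebesgue[OF F], of a b] by simp
  have Fab: "integrable (lebesgue_on {a..b}) ?F"
    using integrable_mult_indicator[OF _ F, of "{a..b}"] by (simp add: integrable_restrict_space)
  have "tint T f a b = (LINT r|lebesgue. indicator {0<..<T} r * (indicator {a..<b} r * f r))"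
    unfolding tint_def by (subst integral_restrict_space) auto
  also have "\<dots> = (LINT r|lebesgue. indicator {a..b} r *\<^sub>R ?F r)"
  proof (rule integral_cong_AE)
    have "(\<lambda>r. indicator {a..<b} r *\<^sub>R ?F r) \<in> borel_measurable lebesgue"
      by (rule borel_measurable_integrable[OF integrable_mult_indicator[OF _ F]]) simp
    then show "(\<lambda>r. indicator {0<..<T} r * (indicator {a..<b} r * f r)) \<in> borel_measurable lebesgue"
      by (simp add: mult.left_commute)
    show "(\<lambda>r. indicator {a..b} r *\<^sub>R ?F r) \<in> borel_measurable lebesgue"
      by (rule borel_measurable_integrable[OF integrable_mult_indicator[OF _ F]]) simp
    have "AE r in lebesgue. r \<notin> {b}"
      by (rule AE_not_in) (simp add: negligible_iff_null_sets[symmetric])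
    then show "AE r in lebesgue. indicator {0<..<T} r * (indicator {a..<b} r * f r) = indicator {a..b} r *\<^sub>R ?F r"
      by (rule eventually_mono) (auto simp: indicator_def)
  qed
  also have "\<dots> = (LINT r|lebesgue_on {a..b}. ?F r)"
    by (subst integral_restrict_space) auto
  also have "\<dots> = integral {a..b} ?F"
    by (rule lebesgue_integral_eq_integral[OF Fab]) simp
  finally show "tint T f a b = integral {a..b} ?F" .
qed

lemma integrable_const_interval: "integrable (lebesgue_on {0<..<T::real}) (\<lambda>_. c::real)"
  by (intro finite_measure.integrable_const finite_measure_lebesgue_on) simp

lemma tint_const:
  assumes "0 \<le> a" "a \<le> b" "b \<le> T"
  shows "tint T (\<lambda>_. c) a b = c * (b - a)"
proof -
  have "integral {a..b} (\<lambda>r. indicator {0<..<T} r * c) = integral {a..b} (\<lambda>r. c)"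
    by (rule integral_spike[of "{0, T}"]) (use assms in \<open>auto simp: indicator_def\<close>)
  then show ?thesis using assms by (simp add: tint_HK(1)[OF integrable_const_interval] mult.commute)
qed

lemma tint_primitive_continuous:
  assumes f: "integrable (lebesgue_on {0<..<T}) f" and T: "0 < T"
  shows "continuous_on {0..T} (\<lambda>x. tint T f 0 x)"
proof -
  have "continuous_on {0..T} (\<lambda>x. integral {0..x} (\<lambda>r. indicator {0<..<T} r * f r))"
    using tint_HK(2)[OF f, of 0 T] T by (intro indefinite_integral_continuous_1) simp
  then show ?thesis
    by (rule continuous_on_cong[THEN iffD1, rotated 2]) (simp_all add: tint_HK(1)[OF f])
qed

text \<open>Absolute continuity of the integral, obtained as uniform continuity of the primitive on
  a compact interval.\<close>

lemma tint_uniformly_small: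
  assumes f: "integrable (lebesgue_on {0<..<T}) f" and "0 < T" "0 < e"
  obtains d where "d > 0" "\<And>a b. 0 \<le> a \<Longrightarrow> a \<le> b \<Longrightarrow> b \<le> T \<Longrightarrow> b - a < d \<Longrightarrow> \<bar>tint T f a b\<bar> < e"
proof -
  have "continuous_on {0..T} (\<lambda>x. tint T f 0 x)" by (rule tint_primitive_continuous[OF f assms(2)])
  then have "uniformly_continuous_on {0..T} (\<lambda>x. tint T f 0 x)"
    by (simp add: compact_uniformly_continuous)
  then obtain d where d: "d > 0" "\<And>x x'. x \<in> {0..T} \<Longrightarrow> x' \<in> {0..T} \<Longrightarrow> dist x' x < d \<Longrightarrow> dist (tint T f 0 x') (tint T f 0 x) < e"
    using assms(3) by (rule uniformly_continuous_onE) (rule that)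
  have "\<bar>tint T f a b\<bar> < e" if "0 \<le> a" "a \<le> b" "b \<le> T" "b - a < d" for a b
    using d(2)[of a b] that tint_combine[OF f, of 0 a b] by (simp add: dist_real_def)
  with d(1) show ?thesis by (rule that)
qed

lemma AE_lebesgue_onI:
  assumes "negligible N" "S \<in> sets lebesgue" "\<And>x. x \<in> S \<Longrightarrow> x \<notin> N \<Longrightarrow> P x"
  shows "AE x in lebesgue_on S. P x"
  using AE_not_in[of N lebesgue] assms
  by (auto simp: AE_restrict_space_iff negligible_iff_null_sets elim!: eventually_mono)

text \<open>The differentiation theorem is one-sided, over cubes with lower corner \<open>x\<close>;
  left windows of \<open>f\<close> are right windows of the reflected function.\<close>

lemma tint_lebesgue_points:
  assumes f: "integrable (lebesgue_on {0<..<T}) f"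
  shows "AE t in lebesgue_on {0<..<T}. ((\<lambda>h. tint T f t (t + h) / h) \<longlongrightarrow> f t) (at_right 0)
     \<and> ((\<lambda>h. tint T f (t - h) t / h) \<longlongrightarrow> f t) (at_right 0)"
proof -
  define F where "F = (\<lambda>r. indicator {0<..<T} r * f r)"
  have int: "F integrable_on {a..b}" for a b
    using tint_HK(2)[OF f, of a b] by (cases "a \<le> b") (auto simp: F_def)
  then have int': "(\<lambda>r. F (- r)) integrable_on {a..b}" for a b
    using Henstock_Kurzweil_Integration.integrable_reflect_real[where f = F and a = "-b" and b = "-a"] by simp
  obtain N where N: "negligible N" "\<And>x e. x \<notin> N \<Longrightarrow> 0 < e \<Longrightarrow> \<exists>d>0. \<forall>h. 0 < h \<and> h < d \<longrightarrow>
       norm (integral (cbox x (x + h *\<^sub>R One)) F /\<^sub>R h ^ DIM(real) - F x) < e"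
    using integrable_ccontinuous_explicit[of F] int by auto
  obtain N' where N': "negligible N'" "\<And>x e. x \<notin> N' \<Longrightarrow> 0 < e \<Longrightarrow> \<exists>d>0. \<forall>h. 0 < h \<and> h < d \<longrightarrow>
       norm (integral (cbox x (x + h *\<^sub>R One)) (\<lambda>r. F (- r)) /\<^sub>R h ^ DIM(real) - F (- x)) < e"
    using integrable_ccontinuous_explicit[of "\<lambda>r. F (- r)"] int' by auto
  have negl: "negligible (N \<union> uminus ` N')"
    using N(1) N'(1) negligible_differentiable_image_negligible[OF _ N'(1), of uminus]
    by (intro negligible_Un) (auto intro!: derivative_intros)
  show ?thesis
  proof (rule AE_lebesgue_onI[OF negl])
    fix x assume x: "x \<in> {0<..<T}" "x \<notin> N \<union> uminus ` N'"
    then have xN: "x \<notin> N" "- x \<notin> N'" by force+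
    have Fx: "F x = f x" using x by (simp add: F_def)
    have "((\<lambda>h. tint T f x (x + h) / h) \<longlongrightarrow> f x) (at_right 0)"
    proof (rule tendstoI)
      fix e :: real assume e: "e > 0"
      obtain d where d0: "d > 0 \<and> (\<forall>h. 0 < h \<and> h < d \<longrightarrow> norm (integral (cbox x (x + h *\<^sub>R One)) F /\<^sub>R h ^ DIM(real) - F x) < e)"
        using N(2)[OF xN(1) e] ..
      then have d: "d > 0" "\<And>h. 0 < h \<Longrightarrow> h < d \<Longrightarrow> norm (integral (cbox x (x + h *\<^sub>R One)) F /\<^sub>R h ^ DIM(real) - F x) < e"
        by simp_all
      have "dist (tint T f x (x + h) / h) (f x) < e" if "0 < h" "h < d" for h
      proof -
        have I: "tint T f x (x + h) = integral {x..x + h} F"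
          using that by (simp add: tint_HK(1)[OF f] F_def)
        show ?thesis
          unfolding I Fx[symmetric] dist_real_def using d(2)[OF that] by (simp add: divide_inverse mult.commute)
      qed
      then show "\<forall>\<^sub>F h in at_right 0. dist (tint T f x (x + h) / h) (f x) < e"
        using d(1) by (auto simp: eventually_at_right_field)
    qed
    moreover have "((\<lambda>h. tint T f (x - h) x / h) \<longlongrightarrow> f x) (at_right 0)"
    proof (rule tendstoI)
      fix e :: real assume e: "e > 0"
      obtain d where d0: "d > 0 \<and> (\<forall>h. 0 < h \<and> h < d \<longrightarrow>
          norm (integral (cbox (- x) (- x + h *\<^sub>R One)) (\<lambda>r. F (- r)) /\<^sub>R h ^ DIM(real) - F (- (- x))) < e)"
        using N'(2)[OF xN(2) e] ..
      then have d: "d > 0" "\<And>h. 0 < h \<Longrightarrow> h < d \<Longrightarrow>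
          norm (integral (cbox (- x) (- x + h *\<^sub>R One)) (\<lambda>r. F (- r)) /\<^sub>R h ^ DIM(real) - F (- (- x))) < e"
        by simp_all
      have "dist (tint T f (x - h) x / h) (f x) < e" if "0 < h" "h < d" for h
      proof -
        have I: "tint T f (x - h) x = integral {- x..- x + h} (\<lambda>r. F (- r))"
          using that Henstock_Kurzweil_Integration.integral_reflect_real[where f = F and a = "x - h" and b = x]
          by (simp add: tint_HK(1)[OF f] F_def)
        show ?thesis
          unfolding I Fx[symmetric] dist_real_def using d(2)[OF that] by (simp add: divide_inverse mult.commute)
      qed
      then show "\<forall>\<^sub>F h in at_right 0. dist (tint T f (x - h) x / h) (f x) < e"
        using d(1) by (auto simp: eventually_at_right_field)
    qed
    ultimately show "((\<lambda>h. tint T f x (x + h) / h) \<longlongrightarrow> f x) (at_right 0)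
     \<and> ((\<lambda>h. tint T f (x - h) x / h) \<longlongrightarrow> f x) (at_right 0)" ..
  qed simp
qed

section \<open>Test functions in time and their antiderivatives\<close>

lemma smooth_fun_DERIV:
  fixes \<theta> :: "real \<Rightarrow> real"
  assumes "smooth_fun \<theta>"
  shows "(\<theta> has_real_derivative deriv \<theta> x) (at x)"
  using smooth_fun_differentiable[OF assms] by (simp add: DERIV_deriv_iff_real_differentiable)

lemma frechet_derivative_real:
  fixes \<theta> :: "real \<Rightarrow> real"
  assumes "(\<theta> has_real_derivative D) (at x)"
  shows "frechet_derivative \<theta> (at x) 1 = D"
proof -
  have "(\<theta> has_derivative (\<lambda>h. D * h)) (at x)" using assms by (simp add: has_field_derivative_def)
  from frechet_derivative_at[OF this, symmetric] show ?thesis by simp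
qed

lemma test_deriv:
  fixes \<theta> :: "real \<Rightarrow> real"
  assumes "\<theta> \<in> test_functions \<Omega>"
  shows "deriv \<theta> \<in> test_functions \<Omega>"
proof -
  have "smooth_fun \<theta>" using assms by (simp add: test_functions_def)
  then have "deriv \<theta> = (\<lambda>x. frechet_derivative \<theta> (at x) 1)"
    by (auto simp: frechet_derivative_real[OF smooth_fun_DERIV])
  with test_functions_deriv[OF assms, of 1] show ?thesis by simp
qed

lemma test_zero_outside: "\<theta> \<in> test_functions \<Omega> \<Longrightarrow> x \<notin> \<Omega> \<Longrightarrow> \<theta> x = 0"
  using closure_subset[of "{x. \<theta> x \<noteq> 0}"] by (auto simp: test_functions_def)

lemma test_integrable:
  "\<theta> \<in> test_functions \<Omega>' \<Longrightarrow> integrable (lebesgue_on {0<..<T::real}) \<theta>"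
  using integrable_mult_test[OF integrable_const_interval[of T 1]] by simp

lemma integral_deriv_test:
  fixes \<theta> :: "real \<Rightarrow> real"
  assumes th: "\<theta> \<in> test_functions {0<..<T}" and r: "0 < r" "r < T"
  shows "(LINT t|lebesgue_on {0<..<T}. indicator {r..<T} t * deriv \<theta> t) = - \<theta> r"
proof -
  have "tint T (deriv \<theta>) r T = integral {r..T} (\<lambda>t. indicator {0<..<T} t * deriv \<theta> t)"
    by (rule tint_HK(1)[OF test_integrable[OF test_deriv[OF th]]]) (use r in simp)
  also have "\<dots> = integral {r..T} (deriv \<theta>)"
    by (rule integral_spike[of "{T}"]) (use r in \<open>auto simp: indicator_def\<close>)
  also have "\<dots> = \<theta> T - \<theta> r"
  proof -
    have "smooth_fun \<theta>" using th by (simp add: test_functions_def)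
    then have "(\<theta> has_vector_derivative deriv \<theta> x) (at x within {r..T})" for x
      unfolding has_real_derivative_iff_has_vector_derivative[symmetric]
      by (rule has_field_derivative_at_within[OF smooth_fun_DERIV])
    then have "(deriv \<theta> has_integral (\<theta> T - \<theta> r)) {r..T}"
      using r by (intro fundamental_theorem_of_calculus) auto
    then show ?thesis by (rule integral_unique)
  qed
  also have "\<theta> T = 0" by (rule test_zero_outside[OF th]) simp
  finally show ?thesis by (simp add: tint_def)
qed

text \<open>Mean zero is what makes the primitive vanish to the right of the support, so that it is
  again a test function.\<close>

lemma test_antiderivative:
  assumes eta: "\<eta> \<in> test_functions {0<..<T::real}" and zero: "(LINT t|lebesgue_on {0<..<T}. \<eta> t) = 0" and T: "0 < T"
  obtains \<theta> where "\<theta> \<in> test_functions {0<..<T}" "deriv \<theta> = \<eta>"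
proof -
  let ?K = "closure {t. \<eta> t \<noteq> 0}"
  have K: "compact ?K" "?K \<subseteq> {0<..<T}" and sm: "smooth_fun \<eta>" using eta by (auto simp: test_functions_def)
  have "\<exists>a b. 0 < a \<and> a \<le> b \<and> b < T \<and> ?K \<subseteq> {a..b}"
  proof (cases "?K = {}")
    case True then show ?thesis using T by (intro exI[of _ "T / 2"]) auto
  next
    case False
    obtain a where a: "a \<in> ?K" "\<And>x. x \<in> ?K \<Longrightarrow> a \<le> x" using compact_attains_inf[OF K(1) False] by blast
    obtain b where b: "b \<in> ?K" "\<And>x. x \<in> ?K \<Longrightarrow> x \<le> b" using compact_attains_sup[OF K(1) False] by blast
    have "a \<in> {0<..<T}" "b \<in> {0<..<T}" using a(1) b(1) K(2) by (meson subsetD)+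
    moreover have "?K \<subseteq> {a..b}" using a(2) b(2) by (meson atLeastAtMost_iff subsetI)
    ultimately show ?thesis using a(2)[OF b(1)] by (intro exI[of _ a] exI[of _ b]) simp
  qed
  then obtain a b where ab: "0 < a" "a \<le> b" "b < T" "?K \<subseteq> {a..b}" by blast
  have eta0: "\<eta> t = 0" if "t \<notin> {a..b}" for t
    using that ab(4) closure_subset[of "{t. \<eta> t \<noteq> 0}"] by auto
  have cont: "continuous_on S \<eta>" for S by (rule smooth_fun_continuous[OF sm])
  \<comment> \<open>Starting at -1, left of the support, keeps every \<open>t \<ge> a\<close> away
    from the lower limit of integration, where the derivative would only be one-sided.\<close>
  define \<theta> where "\<theta> t = integral {-1..t} \<eta>" for t
  have int: "\<eta> integrable_on {c..d}" for c d by (rule integrable_continuous_real[OF cont])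
  have low: "\<theta> t = 0" if "t < a" for t
  proof -
    have "\<theta> t = integral {-1..t} (\<lambda>_. 0)"
      unfolding \<theta>_def by (rule integral_cong) (use that eta0 in auto)
    then show ?thesis by simp
  qed
  have "integral {0..T} \<eta> = tint T \<eta> 0 T"
    unfolding tint_HK(1)[OF test_integrable[OF eta] less_imp_le[OF T]]
    by (rule integral_cong) (use test_zero_outside[OF eta] in \<open>auto simp: indicator_def\<close>)
  then have total: "integral {0..T} \<eta> = 0" using zero by (simp add: tint_full)
  have high: "\<theta> t = 0" if "b < t" for t
  proof -
    \<comment> \<open>Covers \<open>t\<close> on either side of \<open>T\<close>, so that the
      integral up to \<open>t\<close> can be compared with the total mass over
      \<open>{0..T}\<close>.\<close>
    define m where "m = max t T"
    have m: "t \<le> m" "T \<le> m" by (auto simp: m_def)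
    have "integral {-1..t} \<eta> + integral {t..m} \<eta> = integral {-1..m} \<eta>"
      using ab that m by (intro Henstock_Kurzweil_Integration.integral_combine int) auto
    moreover have "integral {-1..0} \<eta> + integral {0..m} \<eta> = integral {-1..m} \<eta>"
      using ab that m by (intro Henstock_Kurzweil_Integration.integral_combine int) auto
    moreover have "integral {0..T} \<eta> + integral {T..m} \<eta> = integral {0..m} \<eta>"
      using ab that m T by (intro Henstock_Kurzweil_Integration.integral_combine int) auto
    moreover have "integral {c..d} \<eta> = 0" if "d < a \<or> b < c" for c d
    proof -
      have "integral {c..d} \<eta> = integral {c..d} (\<lambda>_. 0)"
        by (rule integral_cong) (use eta0 that in auto)
      then show ?thesis by simp
    qed
    then have "integral {t..m} \<eta> = 0" "integral {T..m} \<eta> = 0" "integral {-1..0} \<eta> = 0"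
      using that ab by auto
    ultimately show ?thesis using total by (simp add: \<theta>_def)
  qed
  have der: "(\<theta> has_real_derivative \<eta> t) (at t)" for t
  proof (cases "t < a")
    case True
    have "((\<lambda>_. 0) has_real_derivative 0) (at t)" by simp
    then have "(\<theta> has_real_derivative 0) (at t)"
      by (rule has_field_derivative_transform_within_open[where S = "{..<a}"]) (use True low in auto)
    then show ?thesis using eta0[of t] True by simp
  next
    case False
    have "(\<theta> has_real_derivative \<eta> t) (at t within {-1..t + 1})"
      unfolding \<theta>_def by (rule integral_has_real_derivative[OF cont]) (use False ab in auto)
    moreover have "t \<in> interior {-1..t + 1}" using False ab(1) by (simp add: interior_atLeastAtMost_real)
    ultimately show ?thesis by (metis at_within_interior)
  qed
  have deriv: "deriv \<theta> = \<eta>" using der by (auto intro: DERIV_imp_deriv)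
  have "smooth_fun \<theta>"
  proof (rule smooth_fun_step)
    show "\<theta> differentiable at x" for x using der[of x] by (auto simp: real_differentiable_def)
    show "smooth_fun (\<lambda>x. frechet_derivative \<theta> (at x) i)" if "i \<in> Basis" for i
      using that sm by (simp add: frechet_derivative_real[OF der])
  qed
  moreover have sub: "{t. \<theta> t \<noteq> 0} \<subseteq> {a..b}" using low high by force
  then have "closure {t. \<theta> t \<noteq> 0} \<subseteq> {a..b}" by (rule closure_minimal) simp
  moreover from this have "closure {t. \<theta> t \<noteq> 0} \<subseteq> {0<..<T}" using ab by force
  moreover have "compact (closure {t. \<theta> t \<noteq> 0})"
    using sub by (meson bounded_closed_interval bounded_subset compact_closure)
  ultimately have "\<theta> \<in> test_functions {0<..<T}" by (simp add: test_functions_def)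
  then show ?thesis using deriv by (rule that)
qed

lemma test_functions_comb:
  assumes "\<phi> \<in> test_functions \<Omega>" "\<psi> \<in> test_functions \<Omega>"
  shows "(\<lambda>x. \<phi> x + c * \<psi> x) \<in> test_functions \<Omega>"
proof -
  let ?K = "closure {x. \<phi> x \<noteq> 0} \<union> closure {x. \<psi> x \<noteq> 0}"
  have K: "compact ?K" "?K \<subseteq> \<Omega>" using assms by (auto simp: test_functions_def)
  have "{x. \<phi> x + c * \<psi> x \<noteq> 0} \<subseteq> {x. \<phi> x \<noteq> 0} \<union> {x. \<psi> x \<noteq> 0}" by auto
  also have "\<dots> \<subseteq> ?K" by (intro Un_mono closure_subset)
  finally have "{x. \<phi> x + c * \<psi> x \<noteq> 0} \<subseteq> ?K" .
  then have sub: "closure {x. \<phi> x + c * \<psi> x \<noteq> 0} \<subseteq> ?K" by (rule closure_minimal) (intro closed_Un closed_closure)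
  moreover have "compact (closure {x. \<phi> x + c * \<psi> x \<noteq> 0})"
    using closed_Int_compact[OF closed_closure K(1), of "{x. \<phi> x + c * \<psi> x \<noteq> 0}"] sub by (simp add: inf.absorb1)
  moreover have "smooth_fun (\<lambda>x. \<phi> x + c * \<psi> x)"
    using assms by (intro smooth_fun_comb) (auto simp: test_functions_def)
  ultimately show ?thesis using K(2) by (auto simp: test_functions_def)
qed


section \<open>Weak derivatives and primitives in time\<close>

lemma integrable_finite_interval_const_bound:
  fixes f :: "real \<Rightarrow> real"
  assumes "f \<in> borel_measurable (lebesgue_on {0<..<T})" "AE t in lebesgue_on {0<..<T}. \<bar>f t\<bar> \<le> B"
  shows "integrable (lebesgue_on {0<..<T}) f"
  by (rule finite_measure.integrable_const_bound[OF finite_measure_lebesgue_on]) (use assms in auto)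

lemma AE_in_interval: "AE t in lebesgue_on {0<..<T::real}. 0 < t \<and> t < T"
  by (intro AE_I2) (simp add: space_restrict_space)

lemma tint_primitive_bound:
  assumes "integrable (lebesgue_on {0<..<T}) f"
  shows "\<bar>tint T f a b\<bar> \<le> (LINT r|lebesgue_on {0<..<T}. \<bar>f r\<bar>)"
proof -
  have "\<bar>tint T f a b\<bar> \<le> tint T (\<lambda>r. \<bar>f r\<bar>) a b" by (rule tint_abs_le[OF assms])
  also have "\<dots> \<le> (LINT r|lebesgue_on {0<..<T}. \<bar>f r\<bar>)"
    unfolding tint_def
    by (rule integral_mono[OF tint_integrable]) (use assms in \<open>auto simp: indicator_def\<close>)
  finally show ?thesis .
qed

lemma tint_primitive_integrable:
  assumes f: "integrable (lebesgue_on {0<..<T}) f" and T: "0 < T"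
  shows "integrable (lebesgue_on {0<..<T}) (\<lambda>x. tint T f 0 x)"
proof (rule integrable_finite_interval_const_bound)
  have "continuous_on {0<..<T} (\<lambda>x. tint T f 0 x)"
    by (rule continuous_on_subset[OF tint_primitive_continuous[OF f T]]) auto
  then show "(\<lambda>x. tint T f 0 x) \<in> borel_measurable (lebesgue_on {0<..<T})"
    by (rule continuous_imp_measurable_on_sets_lebesgue) simp
  show "AE t in lebesgue_on {0<..<T}. \<bar>tint T f 0 t\<bar> \<le> (LINT r|lebesgue_on {0<..<T}. \<bar>f r\<bar>)"
    by (intro AE_I2 tint_primitive_bound f)
qed

text \<open>Fubini over the triangle \<open>r < t\<close>: the inner integral of
  \<open>deriv \<theta>\<close> from \<open>r\<close> to \<open>T\<close> is
  \<open>- \<theta> r\<close>.\<close>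

lemma integral_deriv_test_primitive:
  assumes th: "\<theta> \<in> test_functions {0<..<T}" and k: "integrable (lebesgue_on {0<..<T}) k" and T: "0 < T"
  shows "(LINT t|lebesgue_on {0<..<T}. deriv \<theta> t * tint T k 0 t) = - (LINT t|lebesgue_on {0<..<T}. \<theta> t * k t)"
proof -
  define M where "M = lebesgue_on {0<..<T}"
  have fin: "finite_measure M" unfolding M_def by (rule finite_measure_lebesgue_on) simp
  interpret finite_measure M by (rule fin)
  interpret P: pair_sigma_finite M M ..
  have d: "deriv \<theta> \<in> test_functions {0<..<T}" by (rule test_deriv[OF th])
  obtain B where B: "\<And>t. \<bar>deriv \<theta> t\<bar> \<le> B" by (rule test_functions_bounded[OF d]) (rule that)
  have [measurable]: "(\<lambda>t. t) \<in> borel_measurable M" "deriv \<theta> \<in> borel_measurable M" "k \<in> borel_measurable M"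
    using d k smooth_fun_measurable[of "deriv \<theta>"] unfolding M_def
    by (auto intro!: borel_measurable_lebesgue_onI simp: test_functions_def)
  have [measurable]: "(\<lambda>p. fst p) \<in> borel_measurable (M \<Otimes>\<^sub>M M)" "(\<lambda>p. snd p) \<in> borel_measurable (M \<Otimes>\<^sub>M M)"
    using measurable_compose[OF measurable_fst \<open>(\<lambda>t. t) \<in> borel_measurable M\<close>]
      measurable_compose[OF measurable_snd \<open>(\<lambda>t. t) \<in> borel_measurable M\<close>] by auto
  define \<Psi> where "\<Psi> t r = (if 0 \<le> r \<and> r < t then deriv \<theta> t * k r else 0)" for t r
  have "integrable (M \<Otimes>\<^sub>M M) (\<lambda>p. B * \<bar>k (snd p)\<bar>)"
  proof (rule P.Fubini_integrable)
    show "(\<lambda>p. B * \<bar>k (snd p)\<bar>) \<in> borel_measurable (M \<Otimes>\<^sub>M M)" by measurable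
    show "integrable M (\<lambda>x. LINT y|M. norm (B * \<bar>k (snd (x, y))\<bar>))" by (simp add: integrable_const)
    show "AE x in M. integrable M (\<lambda>y. B * \<bar>k (snd (x, y))\<bar>)" using k by (simp add: M_def)
  qed
  then have int: "integrable (M \<Otimes>\<^sub>M M) (case_prod \<Psi>)"
  proof (rule Bochner_Integration.integrable_bound)
    show "case_prod \<Psi> \<in> borel_measurable (M \<Otimes>\<^sub>M M)" unfolding \<Psi>_def case_prod_beta by measurable
    have "\<bar>\<Psi> t r\<bar> \<le> \<bar>B * \<bar>k r\<bar>\<bar>" for t r
      using B[of t] by (auto simp: \<Psi>_def abs_mult intro!: mult_right_mono)
    then show "AE p in M \<Otimes>\<^sub>M M. norm (case_prod \<Psi> p) \<le> norm (B * \<bar>k (snd p)\<bar>)"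
      by (intro AE_I2) (simp add: case_prod_beta)
  qed
  have "(LINT t|M. deriv \<theta> t * tint T k 0 t) = (LINT t|M. LINT r|M. \<Psi> t r)"
  proof (intro Bochner_Integration.integral_cong refl)
    fix t
    have "deriv \<theta> t * tint T k 0 t = (LINT r|M. deriv \<theta> t * (indicator {0..<t} r * k r))"
      unfolding tint_def M_def by simp
    also have "\<dots> = (LINT r|M. \<Psi> t r)"
      by (intro Bochner_Integration.integral_cong) (auto simp: \<Psi>_def indicator_def)
    finally show "deriv \<theta> t * tint T k 0 t = (LINT r|M. \<Psi> t r)" .
  qed
  also have "\<dots> = (LINT r|M. LINT t|M. \<Psi> t r)"
    using P.Fubini_integral[OF int] by simp
  also have "\<dots> = (LINT r|M. - (\<theta> r * k r))"
  proof (intro Bochner_Integration.integral_cong refl)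
    fix r assume "r \<in> space M"
    then have r: "0 < r" "r < T" by (auto simp: M_def space_restrict_space)
    have "(LINT t|M. \<Psi> t r) = (LINT t|M. (indicator {r..<T} t * deriv \<theta> t) * k r)"
    proof (rule integral_cong_AE)
      show "(\<lambda>t. \<Psi> t r) \<in> borel_measurable M" unfolding \<Psi>_def by measurable
      have [measurable]: "indicat_real {r..<T} \<in> borel_measurable M" unfolding M_def
        by (intro borel_measurable_lebesgue_onI) simp
      show "(\<lambda>t. (indicator {r..<T} t * deriv \<theta> t) * k r) \<in> borel_measurable M" by measurable
      \<comment> \<open>The integrands differ only at \<open>t = r\<close>, where
        \<open>\<Psi>\<close> has a strict inequality.\<close>
      show "AE t in M. \<Psi> t r = (indicator {r..<T} t * deriv \<theta> t) * k r"
        unfolding M_def by (rule AE_lebesgue_onI[of "{r}"]) (use r in \<open>auto simp: \<Psi>_def indicator_def\<close>)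
    qed
    also have "\<dots> = (LINT t|M. indicator {r..<T} t * deriv \<theta> t) * k r" by simp
    also have "\<dots> = - (\<theta> r * k r)" unfolding M_def integral_deriv_test[OF th r] by simp
    finally show "(LINT t|M. \<Psi> t r) = - (\<theta> r * k r)" .
  qed
  finally show ?thesis by (simp add: M_def)
qed

text \<open>The difference \<open>q\<close> of \<open>p\<close> and the primitive annihilates
  derivatives of test functions, that is, test functions of mean zero. Correcting an arbitrary test
  function by a multiple of a fixed \<open>\<psi>0\<close> shows that \<open>q\<close> acts as a
  constant.\<close>

lemma du_bois_reymond:
  assumes p: "integrable (lebesgue_on {0<..<T}) p" and k: "integrable (lebesgue_on {0<..<T}) k" and T: "0 < T"
    and weak: "\<And>\<theta>. \<theta> \<in> test_functions {0<..<T} \<Longrightarrow>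
      (LINT t|lebesgue_on {0<..<T}. deriv \<theta> t * p t) = - (LINT t|lebesgue_on {0<..<T}. \<theta> t * k t)"
  shows "\<exists>c. AE t in lebesgue_on {0<..<T}. p t = c + tint T k 0 t"
proof -
  let ?M = "lebesgue_on {0<..<T}"
  define q where "q t = p t - tint T k 0 t" for t
  have q: "integrable ?M q" unfolding q_def using p tint_primitive_integrable[OF k T] by simp
  have q0: "(LINT t|?M. q t * deriv \<theta> t) = 0" if th: "\<theta> \<in> test_functions {0<..<T}" for \<theta>
  proof -
    have "integrable ?M (\<lambda>t. p t * deriv \<theta> t)" "integrable ?M (\<lambda>t. tint T k 0 t * deriv \<theta> t)"
      by (intro integrable_mult_test[OF _ test_deriv[OF th]] p tint_primitive_integrable k T)+
    then have "(LINT t|?M. q t * deriv \<theta> t) = (LINT t|?M. p t * deriv \<theta> t) - (LINT t|?M. tint T k 0 t * deriv \<theta> t)"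
      by (simp add: q_def left_diff_distrib)
    also have "\<dots> = 0"
      using weak[OF th] integral_deriv_test_primitive[OF th k T] by (simp add: mult.commute)
    finally show ?thesis .
  qed
  \<comment> \<open>If all test functions had mean zero, the fundamental lemma for the constant 1
    would give \<open>1 = 0\<close> almost everywhere.\<close>
  have "\<exists>\<psi>0. \<psi>0 \<in> test_functions {0<..<T} \<and> (LINT t|?M. \<psi>0 t) \<noteq> 0"
  proof (rule ccontr)
    assume "\<not> ?thesis"
    then have "AE t in ?M. (1::real) = 0"
      by (intro fundamental_lemma_calculus_of_variations integrable_const_interval) auto
    then have "tint T (\<lambda>_. 1) 0 T = tint T (\<lambda>_. 0) 0 T"
      by (intro tint_cong_AE integrable_const_interval)
    then show False using T by (simp add: tint_const)
  qed
  then obtain \<psi>0 where psi0: "\<psi>0 \<in> test_functions {0<..<T}" "(LINT t|?M. \<psi>0 t) \<noteq> 0" by blast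
  \<comment> \<open>The constant for which \<open>q - c\<close> annihilates \<open>\<psi>0\<close>;
    below, \<open>d\<close> is chosen so that \<open>\<psi> + d * \<psi>0\<close> has mean
    zero.\<close>
  define c where "c = (LINT t|?M. q t * \<psi>0 t) / (LINT t|?M. \<psi>0 t)"
  have "AE t in ?M. q t - c = 0"
  proof (rule fundamental_lemma_calculus_of_variations)
    show "integrable ?M (\<lambda>t. q t - c)" using q integrable_const_interval[of T c] by simp
    fix \<psi> assume psi: "\<psi> \<in> test_functions {0<..<T}"
    define d where "d = - (LINT t|?M. \<psi> t) / (LINT t|?M. \<psi>0 t)"
    have int: "integrable ?M \<psi>" "integrable ?M \<psi>0" "integrable ?M (\<lambda>t. q t * \<psi> t)" "integrable ?M (\<lambda>t. q t * \<psi>0 t)"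
      using test_integrable[OF psi] test_integrable[OF psi0(1)] integrable_mult_test[OF q psi]
        integrable_mult_test[OF q psi0(1)] by simp_all
    obtain \<theta> where th: "\<theta> \<in> test_functions {0<..<T}" "deriv \<theta> = (\<lambda>t. \<psi> t + d * \<psi>0 t)"
    proof (rule test_antiderivative[OF test_functions_comb[OF psi psi0(1), of d] _ T])
      show "(LINT t|?M. \<psi> t + d * \<psi>0 t) = 0" using int psi0(2) by (simp add: d_def)
    qed (rule that)
    have "(LINT t|?M. q t * \<psi> t) + d * (LINT t|?M. q t * \<psi>0 t) = (LINT t|?M. q t * (\<psi> t + d * \<psi>0 t))"
      using int by (simp add: distrib_left mult.left_commute[of _ d])
    also have "\<dots> = 0" using q0[OF th(1)] by (simp add: th(2))
    finally have "(LINT t|?M. q t * \<psi> t) - c * (LINT t|?M. \<psi> t) = 0"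
      using psi0(2) by (simp add: c_def d_def field_simps)
    then show "(LINT t|?M. (q t - c) * \<psi> t) = 0"
      using int by (simp add: left_diff_distrib)
  qed simp
  then have "AE t in ?M. p t = c + tint T k 0 t" by (rule eventually_mono) (simp add: q_def)
  then show ?thesis ..
qed

section \<open>Translations in time\<close>

lemma tint_translate:
  assumes f: "integrable (lebesgue_on {0<..<T}) f" and ab: "0 \<le> a" "b \<le> T" "0 \<le> a + h" "b + h \<le> T"
  shows "integrable (lebesgue_on {0<..<T}) (\<lambda>r. indicator {0<..<T} (r + h) * f (r + h))"
    and "tint T (\<lambda>r. indicator {0<..<T} (r + h) * f (r + h)) a b = tint T f (a + h) (b + h)"
proof -
  let ?I = "{0<..<T}"
  define F where "F r = indicator ?I r * f r" for r
  have F: "integrable lebesgue F" unfolding F_def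
    using f integrable_restrict_space[of ?I lebesgue f] by simp
  have Fh: "integrable lebesgue (\<lambda>r. F (r + h))"
    using lebesgue_integrable_real_affine[OF F, of 1 h] by (simp add: add.commute)
  show *: "integrable (lebesgue_on ?I) (\<lambda>r. indicator ?I (r + h) * f (r + h))"
    unfolding F_def[symmetric]
    using integrable_mult_indicator[OF _ Fh, of ?I] by (simp add: integrable_restrict_space)
  have neg: "negligible {0, -h}" by simp
  have meas: "indicat_real {a..<b} \<in> borel_measurable lebesgue" "indicat_real {a + h..<b + h} \<in> borel_measurable lebesgue"
    by (intro measurable_completion; simp)+
  have Fab: "integrable lebesgue (\<lambda>r. indicator {a..<b} r * F (r + h))"
    using integrable_mult_indicator[OF _ Fh, of "{a..<b}"] by simp
  have "tint T (\<lambda>r. F (r + h)) a b = (LINT r|lebesgue. indicator ?I r * (indicator {a..<b} r * F (r + h)))"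
    unfolding tint_def by (subst integral_restrict_space) auto
  also have "\<dots> = (LINT r|lebesgue. indicator {a..<b} r * F (r + h))"
  proof (rule integral_cong_AE)
    show "(\<lambda>r. indicator ?I r * (indicator {a..<b} r * F (r + h))) \<in> borel_measurable lebesgue"
      using integrable_mult_indicator[OF _ Fab, of ?I] by auto
    show "(\<lambda>r. indicator {a..<b} r * F (r + h)) \<in> borel_measurable lebesgue" using Fab by auto
    have "AE r in lebesgue. r \<notin> {0}" by (rule AE_not_in) (simp add: negligible_iff_null_sets[symmetric])
    then show "AE r in lebesgue. indicator ?I r * (indicator {a..<b} r * F (r + h)) = indicator {a..<b} r * F (r + h)"
      by (rule eventually_mono) (use ab in \<open>auto simp: indicator_def\<close>)
  qed
  also have "\<dots> = (LINT r|lebesgue. (\<lambda>r. indicator {a + h..<b + h} r * F r) (h + 1 * r))"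
    by (intro Bochner_Integration.integral_cong) (auto simp: indicator_def add.commute)
  also have "\<dots> = (LINT r|lebesgue. indicator {a + h..<b + h} r * F r)"
    using lebesgue_integral_real_affine[of 1 "\<lambda>r. indicator {a + h..<b + h} r * F r" h] by simp
  also have "\<dots> = (LINT r|lebesgue. indicator ?I r * (indicator {a + h..<b + h} r * f r))"
    by (intro Bochner_Integration.integral_cong) (auto simp: F_def)
  also have "\<dots> = tint T f (a + h) (b + h)"
    unfolding tint_def by (subst integral_restrict_space) auto
  finally show "tint T (\<lambda>r. indicator ?I (r + h) * f (r + h)) a b = tint T f (a + h) (b + h)"
    by (simp add: F_def)
qed

lemma AE_translate:
  assumes "AE r in lebesgue_on {0<..<T::real}. P r"
  shows "AE r in lebesgue_on {0<..<T}. 0 < r + h \<and> r + h < T \<longrightarrow> P (r + h)"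
proof -
  have "AE r in lebesgue. r \<in> {0<..<T} \<longrightarrow> P r"
    using assms by (simp add: AE_restrict_space_iff)
  then obtain N where N: "N \<in> null_sets lebesgue" "{r. \<not> (r \<in> {0<..<T} \<longrightarrow> P r)} \<subseteq> N"
    by (auto simp: eventually_ae_filter)
  have "negligible ((\<lambda>r. - h + r) ` N)"
    using N(1) by (intro negligible_translation) (simp add: negligible_iff_null_sets)
  then show ?thesis
  proof (rule AE_lebesgue_onI)
    fix r assume "r \<notin> (\<lambda>r. - h + r) ` N"
    then have "r + h \<notin> N" by (metis add.commute add_minus_cancel image_eqI minus_add_cancel)
    then show "0 < r + h \<and> r + h < T \<longrightarrow> P (r + h)" using N(2) by auto
  qed simp
qed


section \<open>The energy balance\<close>

text \<open>Here \<open>a\<close> may lie left of 0: then \<open>{0..<a}\<close> is empty and the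
  part of the window before time 0 carries no mass.\<close>

lemma tint_eq_primitive:
  assumes "integrable (lebesgue_on {0<..<T}) f" "a \<le> b"
  shows "tint T f a b = tint T f 0 b - tint T f 0 a"
proof -
  have "tint T f a b = (LINT r|lebesgue_on {0<..<T}. indicator {0..<b} r * f r - indicator {0..<a} r * f r)"
    unfolding tint_def
    by (rule Bochner_Integration.integral_cong) (use assms(2) in \<open>auto simp: indicator_def space_restrict_space\<close>)
  then show ?thesis
    using tint_integrable[OF assms(1)] by (simp add: tint_def)
qed

text \<open>Clamping to \<open>{0..T}\<close> extends continuity of the primitive to the whole line,
  as windows that leave the time interval require.\<close>

lemma tint_primitive_measurable:
  assumes f: "integrable (lebesgue_on {0<..<T}) f" and T: "0 < T"
  shows "(\<lambda>x. tint T f 0 x) \<in> borel_measurable borel"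
proof -
  have "tint T f 0 x = tint T f 0 (max 0 (min T x))" for x
    unfolding tint_def
    by (rule Bochner_Integration.integral_cong) (auto simp: indicator_def space_restrict_space)
  moreover have "continuous_on UNIV (\<lambda>x. tint T f 0 (max 0 (min T x)))"
    by (rule continuous_on_compose2[OF tint_primitive_continuous[OF f T]]) (use T in \<open>auto intro!: continuous_intros\<close>)
  ultimately have "continuous_on UNIV (\<lambda>x. tint T f 0 x)" by simp
  then show ?thesis by (rule borel_measurable_continuous_onI)
qed

lemma tint_window_integrable:
  assumes f: "integrable (lebesgue_on {0<..<T}) f" and T: "0 < T" and pq: "p \<le> q"
  shows "integrable (lebesgue_on {0<..<T}) (\<lambda>r. tint T f (r + p) (r + q))"
proof (rule integrable_finite_interval_const_bound)
  have "(\<lambda>r. tint T f 0 (r + p)) \<in> borel_measurable borel" for p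
    by (rule measurable_compose[OF _ tint_primitive_measurable[OF f T]]) simp
  then have "(\<lambda>r. tint T f 0 (r + q) - tint T f 0 (r + p)) \<in> borel_measurable borel"
    by (intro borel_measurable_diff)
  then show "(\<lambda>r. tint T f (r + p) (r + q)) \<in> borel_measurable (lebesgue_on {0<..<T})"
    using tint_eq_primitive[OF f, of "r + p" "r + q" for r] pq by (intro borel_measurable_lebesgue_onI) simp
  show "AE r in lebesgue_on {0<..<T}. \<bar>tint T f (r + p) (r + q)\<bar> \<le> (LINT r|lebesgue_on {0<..<T}. \<bar>f r\<bar>)"
    by (intro AE_I2 tint_primitive_bound f)
qed

text \<open>A double integral in disguise: each time is covered by windows whose base points fill a
  set of length at most \<open>q - p\<close>. The proof writes the window integral as a difference
  of values of the primitive \<open>K\<close>, whose translates cancel up to two end windows, one of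
  them with the favourable sign.\<close>

lemma tint_window_le:
  assumes f: "integrable (lebesgue_on {0<..<T}) f" and f0: "AE r in lebesgue_on {0<..<T}. 0 \<le> f r" and T: "0 < T"
    and pq: "p \<le> q" and ab: "0 \<le> a" "a \<le> b" "b \<le> T" "0 \<le> a + p" "b + q \<le> T"
  shows "tint T (\<lambda>r. tint T f (r + p) (r + q)) a b \<le> (q - p) * (LINT r|lebesgue_on {0<..<T}. f r)"
proof -
  let ?M = "lebesgue_on {0<..<T}"
  define K where "K x = tint T f 0 x" for x
  define S where "S = (LINT r|?M. f r)"
  have K: "integrable ?M K" unfolding K_def by (rule tint_primitive_integrable[OF f T])
  have K0: "0 \<le> K x" for x unfolding K_def by (rule tint_nonneg[OF f0])
  have KS: "K x \<le> S" if "x \<le> T" for x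
    unfolding K_def S_def tint_full[symmetric] by (rule tint_mono_interval[OF f f0]) (use that in auto)
  define Kp where "Kp p r = indicator {0<..<T} (r + p) * K (r + p)" for p r
  \<comment> \<open>Lets the zero extension agree with \<open>K\<close> also at the end point 0,
    which the open interval leaves out.\<close>
  have K00: "K 0 = 0" by (simp add: K_def tint_def)
  have Kp_eq: "Kp c r = K (r + c)" if "0 \<le> r + c" "r + c < T" for c r
    using that K00 by (cases "r + c = 0") (auto simp: Kp_def)
  have bp: "b + p \<le> T" "0 \<le> a + q" using pq ab by auto
  have int: "integrable ?M (Kp p)" "integrable ?M (Kp q)"
    unfolding Kp_def by (intro tint_translate(1)[OF K, of a b] ab bp)+
  have win: "integrable ?M (\<lambda>r. tint T f (r + p) (r + q))" by (rule tint_window_integrable[OF f T pq])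
  have "tint T (\<lambda>r. tint T f (r + p) (r + q)) a b = tint T (\<lambda>r. Kp q r - Kp p r) a b"
    unfolding tint_def[of T "\<lambda>r. tint T f (r + p) (r + q)" a b] tint_def[of T "\<lambda>r. Kp q r - Kp p r" a b]
  proof (rule Bochner_Integration.integral_cong[OF refl])
    fix r
    show "indicator {a..<b} r * tint T f (r + p) (r + q) = indicator {a..<b} r * (Kp q r - Kp p r)"
    proof (cases "a \<le> r \<and> r < b")
      case True
      have "Kp q r = K (r + q)" "Kp p r = K (r + p)"
        using True ab pq by (auto intro!: Kp_eq)
      then show ?thesis using tint_eq_primitive[OF f, of "r + p" "r + q"] pq by (simp add: K_def)
    qed (auto simp: indicator_def)
  qed
  also have "\<dots> = tint T K (a + q) (b + q) - tint T K (a + p) (b + p)"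
  proof -
    have "tint T (\<lambda>r. Kp q r - Kp p r) a b = tint T (\<lambda>r. Kp q r) a b - tint T (\<lambda>r. Kp p r) a b"
      by (rule tint_diff[OF int(2,1)])
    moreover have "tint T (\<lambda>r. Kp q r) a b = tint T K (a + q) (b + q)"
      unfolding Kp_def by (rule tint_translate(2)[OF K ab(1,3) bp(2) ab(5)])
    moreover have "tint T (\<lambda>r. Kp p r) a b = tint T K (a + p) (b + p)"
      unfolding Kp_def by (rule tint_translate(2)[OF K ab(1,3,4) bp(1)])
    ultimately show ?thesis by simp
  qed
  also have "\<dots> = tint T K (b + p) (b + q) - tint T K (a + p) (a + q)"
    using tint_eq_primitive[OF K, of "a + q" "b + q"] tint_eq_primitive[OF K, of "a + p" "b + p"]
      tint_eq_primitive[OF K, of "b + p" "b + q"] tint_eq_primitive[OF K, of "a + p" "a + q"] pq ab by simp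
  also have "\<dots> \<le> tint T K (b + p) (b + q)"
    using tint_nonneg[where T = T and f = K and a = "a + p" and b = "a + q"] K0 by simp
  also have "\<dots> \<le> tint T (\<lambda>_. S) (b + p) (b + q)"
    by (rule tint_mono[OF K integrable_const_interval]) (use KS ab in \<open>auto intro!: AE_I2\<close>)
  also have "\<dots> = (q - p) * S"
    using pq ab by (subst tint_const) (auto simp: algebra_simps)
  finally show ?thesis by (simp add: S_def)
qed

section \<open>The weak evolution equation at good times\<close>

locale evolution =
  fixes T :: real and \<Omega> \<Gamma>D :: "'a::euclidean_space set" and v :: "real \<Rightarrow> 'a \<Rightarrow> real"
    and \<xi> :: "real \<Rightarrow> 'a functional"
  assumes bo: "bounded \<Omega>" "open \<Omega>" and T: "0 < T"
    and vV: "v \<in> L2_V T \<Omega> \<Gamma>D" and td: "has_time_derivative T \<Omega> \<Gamma>D v \<xi>"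
begin

abbreviation "MT \<equiv> lebesgue_on {0<..<T}"

definition k :: "real \<Rightarrow> real" where "k r = V_dual_norm \<Omega> \<Gamma>D (\<xi> r)"
definition G :: "real \<Rightarrow> real" where "G r = \<xi> r (v r)"
definition m :: "real \<Rightarrow> real" where "m t = (L2_norm \<Omega> (v t))\<^sup>2"

sublocale V: fun_seminorm "V_space \<Omega> \<Gamma>D" "V_norm \<Omega>" by (rule fun_seminorm_V[OF bo])
sublocale D: fun_seminorm "V_dual \<Omega> \<Gamma>D" "V_dual_norm \<Omega> \<Gamma>D" by (rule fun_seminorm_V_dual[OF bo])
sublocale H: fun_seminorm "L2 \<Omega> :: ('a \<Rightarrow> real) set" "L2_norm \<Omega>" by (rule fun_seminorm_L2)
sublocale DV: fun_pairing "V_dual \<Omega> \<Gamma>D" "V_dual_norm \<Omega> \<Gamma>D" "V_space \<Omega> \<Gamma>D" "V_norm \<Omega>" "\<lambda>\<zeta> v. \<zeta> v"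
  by (rule fun_pairing_V[OF bo])
sublocale HH: fun_pairing "L2 \<Omega> :: ('a \<Rightarrow> real) set" "L2_norm \<Omega>" "L2 \<Omega> :: ('a \<Rightarrow> real) set" "L2_norm \<Omega>" "L2_ip \<Omega>"
  by (rule fun_pairing_L2)

lemma vH: "v \<in> L2_H T \<Omega>" and xi: "\<xi> \<in> L2_V_dual T \<Omega> \<Gamma>D"
  using td by (auto simp: has_time_derivative_def)

lemma AE_mem: "AE t in MT. v t \<in> V_space \<Omega> \<Gamma>D" "AE t in MT. \<xi> t \<in> V_dual \<Omega> \<Gamma>D"
  using bochner_L2_D(1)[OF vV] bochner_L2_D(1)[OF xi] by auto

lemma integrable_k2: "integrable MT (\<lambda>r. (k r)\<^sup>2)"
  unfolding k_def by (rule bochner_L2_D(3)[OF xi])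

lemma k_measurable: "k \<in> borel_measurable MT"
  unfolding k_def[abs_def] by (rule D.norm_measurable[OF bochner_L2_D(2,1)[OF xi]])

lemma integrable_sqrt_bound:
  assumes "integrable MT (\<lambda>r. (f r)\<^sup>2)" "f \<in> borel_measurable MT"
  shows "integrable MT (f :: real \<Rightarrow> real)"
proof (rule Bochner_Integration.integrable_bound)
  show "integrable MT (\<lambda>r. 1 + (f r)\<^sup>2)" using assms(1) integrable_const_interval[of T 1] by simp
  have "\<bar>x\<bar> \<le> 1 + x\<^sup>2" for x :: real
    using zero_le_power2[of "\<bar>x\<bar> - 1"] zero_le_power2[of x] unfolding power2_diff power2_abs power_one by linarith
  then show "AE r in MT. norm (f r) \<le> norm (1 + (f r)\<^sup>2)"
    by (intro AE_I2) (simp add: add_nonneg_nonneg)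
qed (rule assms(2))

lemma integrable_k: "integrable MT k"
  by (rule integrable_sqrt_bound[OF integrable_k2 k_measurable])

lemma AE_k_nonneg: "AE r in MT. 0 \<le> k r"
  using AE_mem(2) by eventually_elim (simp add: k_def V_dual_norm_nonneg[OF bo])

lemma integrable_xi: "w \<in> V_space \<Omega> \<Gamma>D \<Longrightarrow> integrable MT (\<lambda>r. \<xi> r w)"
  by (rule DV.pairing_integrable[OF xi V.bochner_const])

lemma integrable_G: "integrable MT G"
  unfolding G_def[abs_def] by (rule DV.pairing_integrable[OF xi vV])

lemma integrable_m: "integrable MT m"
  unfolding m_def[abs_def] by (rule bochner_L2_D(3)[OF vH])

text \<open>The exceptional null set depends on \<open>w\<close>; removing this dependence is the
  purpose of the good times.\<close>

lemma weak_primitive: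
  assumes w: "w \<in> V_space \<Omega> \<Gamma>D"
  shows "\<exists>c. AE t in MT. L2_ip \<Omega> (v t) w = c + tint T (\<lambda>r. \<xi> r w) 0 t"
proof (rule du_bois_reymond[OF _ integrable_xi[OF w] T])
  show "integrable MT (\<lambda>t. L2_ip \<Omega> (v t) w)"
    by (rule HH.pairing_integrable[OF vH H.bochner_const[OF V_space_L2[OF w]]])
  fix \<theta> assume "\<theta> \<in> test_functions {0<..<T}"
  then show "(LINT t|MT. deriv \<theta> t * L2_ip \<Omega> (v t) w) = - (LINT t|MT. \<theta> t * \<xi> t w)"
    using td w by (simp add: has_time_derivative_def L2_ip_def)
qed

text \<open>The countable dense set makes a single null set serve all test elements \<open>v \<tau>\<close>.\<close>

lemma good_times_exist:
  "\<exists>P. (AE t in MT. P t) \<and> (\<forall>t. P t \<longrightarrow> 0 < t \<and> t < T \<and> v t \<in> V_space \<Omega> \<Gamma>D) \<and>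
    (\<forall>s t \<tau>. P s \<longrightarrow> P t \<longrightarrow> P \<tau> \<longrightarrow> s \<le> t \<longrightarrow>
       L2_ip \<Omega> (\<lambda>x. v t x - v s x) (v \<tau>) = tint T (\<lambda>r. \<xi> r (v \<tau>)) s t)"
proof -
  obtain C where C: "countable C" "C \<subseteq> {0<..<T}" "\<And>c. c \<in> C \<Longrightarrow> v c \<in> V_space \<Omega> \<Gamma>D"
    "AE t in MT. \<forall>e>0. \<exists>c\<in>C. V_norm \<Omega> (\<lambda>x. v t x - v c x) < e \<and> L2_norm \<Omega> (\<lambda>x. v t x - v c x) < e"
    by (rule bochner_countable_dense[OF fun_seminorm_V[OF bo] fun_seminorm_L2 vV vH]) (rule that)
  have "\<forall>c\<in>C. \<exists>K. AE t in MT. L2_ip \<Omega> (v t) (v c) = K + tint T (\<lambda>r. \<xi> r (v c)) 0 t"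
    using weak_primitive C(3) by blast
  then obtain K where K: "\<And>c. c \<in> C \<Longrightarrow> AE t in MT. L2_ip \<Omega> (v t) (v c) = K c + tint T (\<lambda>r. \<xi> r (v c)) 0 t"
    by metis
  define P where "P t \<longleftrightarrow> 0 < t \<and> t < T \<and> v t \<in> V_space \<Omega> \<Gamma>D \<and>
    (\<forall>e>0. \<exists>c\<in>C. V_norm \<Omega> (\<lambda>x. v t x - v c x) < e \<and> L2_norm \<Omega> (\<lambda>x. v t x - v c x) < e) \<and>
    (\<forall>c\<in>C. L2_ip \<Omega> (v t) (v c) = K c + tint T (\<lambda>r. \<xi> r (v c)) 0 t)" for t
  have "AE t in MT. \<forall>c\<in>C. L2_ip \<Omega> (v t) (v c) = K c + tint T (\<lambda>r. \<xi> r (v c)) 0 t"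
    by (simp add: AE_ball_countable[OF C(1)] K)
  with AE_in_interval[of T] AE_mem(1) C(4) have "AE t in MT. P t"
    by eventually_elim (auto simp: P_def)
  moreover have "L2_ip \<Omega> (\<lambda>x. v t x - v s x) (v \<tau>) = tint T (\<lambda>r. \<xi> r (v \<tau>)) s t"
    if Ps: "P s" and Pt: "P t" and P\<tau>: "P \<tau>" and st: "s \<le> t" for s t \<tau>
  proof -
    have mem: "v s \<in> V_space \<Omega> \<Gamma>D" "v t \<in> V_space \<Omega> \<Gamma>D" "v \<tau> \<in> V_space \<Omega> \<Gamma>D"
      using Ps Pt P\<tau> by (auto simp: P_def)
    note memH = mem[THEN V_space_L2]
    define X where "X = L2_ip \<Omega> (\<lambda>x. v t x - v s x) (v \<tau>) - tint T (\<lambda>r. \<xi> r (v \<tau>)) s t"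
    \<comment> \<open>Both sides of the identity are continuous in the test element: the left one in
      the norm of \<open>L2 \<Omega>\<close>, the right one in \<open>V_norm\<close> with the
      integral of \<open>k\<close> as factor. This is why \<open>C\<close> has to be dense in both
      norms at once.\<close>
    define B where "B = L2_norm \<Omega> (\<lambda>x. v t x - v s x) + tint T k s t"
    have B: "B \<ge> 0" unfolding B_def by (intro add_nonneg_nonneg L2_norm_nonneg tint_nonneg AE_k_nonneg)
    have X: "\<bar>X\<bar> \<le> B * e" if e: "e > 0" for e
    proof -
      obtain c where c: "c \<in> C" "V_norm \<Omega> (\<lambda>x. v \<tau> x - v c x) < e" "L2_norm \<Omega> (\<lambda>x. v \<tau> x - v c x) < e"
        using P\<tau> e unfolding P_def by blast
      have vc: "v c \<in> V_space \<Omega> \<Gamma>D" by (rule C(3)[OF c(1)])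
      have dc: "(\<lambda>x. v \<tau> x - v c x) \<in> V_space \<Omega> \<Gamma>D" by (rule V_space_diff[OF bo mem(3) vc])
      have eqc: "L2_ip \<Omega> (\<lambda>x. v t x - v s x) (v c) = tint T (\<lambda>r. \<xi> r (v c)) s t"
        using Ps Pt c(1) tint_eq_primitive[OF integrable_xi[OF vc] st] L2_ip_diff_left[OF memH(2,1) V_space_L2[OF vc]]
        by (simp add: P_def)
      have "X = L2_ip \<Omega> (\<lambda>x. v t x - v s x) (\<lambda>x. v \<tau> x - v c x)
          - (tint T (\<lambda>r. \<xi> r (v \<tau>)) s t - tint T (\<lambda>r. \<xi> r (v c)) s t)"
        using eqc L2_ip_diff_right[OF memH(3) V_space_L2[OF vc] L2_diff[OF memH(2,1)]] by (simp add: X_def)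
      also have "tint T (\<lambda>r. \<xi> r (v \<tau>)) s t - tint T (\<lambda>r. \<xi> r (v c)) s t = tint T (\<lambda>r. \<xi> r (v \<tau>) - \<xi> r (v c)) s t"
        by (rule tint_diff[symmetric]) (intro integrable_xi mem vc)+
      also have "\<dots> = tint T (\<lambda>r. \<xi> r (\<lambda>x. v \<tau> x - v c x)) s t"
      proof (rule tint_cong_AE)
        show "AE r in MT. \<xi> r (v \<tau>) - \<xi> r (v c) = \<xi> r (\<lambda>x. v \<tau> x - v c x)"
          using AE_mem(2) by eventually_elim (rule V_dual_diff_arg[OF bo _ mem(3) vc, symmetric])
        show "integrable MT (\<lambda>r. \<xi> r (v \<tau>) - \<xi> r (v c))"
          by (rule Bochner_Integration.integrable_diff) (intro integrable_xi mem vc)+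
      qed (rule integrable_xi[OF dc])
      finally have "\<bar>X\<bar> \<le> \<bar>L2_ip \<Omega> (\<lambda>x. v t x - v s x) (\<lambda>x. v \<tau> x - v c x)\<bar>
          + \<bar>tint T (\<lambda>r. \<xi> r (\<lambda>x. v \<tau> x - v c x)) s t\<bar>" by linarith
      also have "\<bar>L2_ip \<Omega> (\<lambda>x. v t x - v s x) (\<lambda>x. v \<tau> x - v c x)\<bar> \<le> L2_norm \<Omega> (\<lambda>x. v t x - v s x) * L2_norm \<Omega> (\<lambda>x. v \<tau> x - v c x)"
        by (intro L2_cauchy_schwarz L2_diff memH V_space_L2[OF vc])
      also have "\<dots> \<le> L2_norm \<Omega> (\<lambda>x. v t x - v s x) * e"
        using c(3) by (intro mult_left_mono L2_norm_nonneg) simp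
      also have "\<bar>tint T (\<lambda>r. \<xi> r (\<lambda>x. v \<tau> x - v c x)) s t\<bar> \<le> tint T (\<lambda>r. e * k r) s t"
      proof (rule order_trans[OF tint_abs_le[OF integrable_xi[OF dc]]], rule tint_mono)
        show "integrable MT (\<lambda>r. \<bar>\<xi> r (\<lambda>x. v \<tau> x - v c x)\<bar>)" using integrable_xi[OF dc] by simp
        show "integrable MT (\<lambda>r. e * k r)" using integrable_k by simp
        show "AE r in MT. s \<le> r \<and> r < t \<longrightarrow> \<bar>\<xi> r (\<lambda>x. v \<tau> x - v c x)\<bar> \<le> e * k r"
          using AE_mem(2) AE_k_nonneg
        proof eventually_elim
          case (elim r)
          have "\<bar>\<xi> r (\<lambda>x. v \<tau> x - v c x)\<bar> \<le> k r * V_norm \<Omega> (\<lambda>x. v \<tau> x - v c x)"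
            unfolding k_def by (rule V_dual_bound[OF bo elim(1) dc])
          also have "\<dots> \<le> k r * e" using c(2) elim(2) by (intro mult_left_mono) auto
          finally show ?case by (simp add: mult.commute)
        qed
      qed
      also have "tint T (\<lambda>r. e * k r) s t = e * tint T k s t" by (rule tint_cmult)
      finally show ?thesis by (simp add: B_def algebra_simps)
    qed
    have "X = 0"
    proof (rule ccontr)
      assume "X \<noteq> 0"
      then have "\<bar>X\<bar> / (2 * (B + 1)) > 0" using B by simp
      from X[OF this] B \<open>X \<noteq> 0\<close> show False by (simp add: field_simps) (smt (verit) mult_nonneg_nonneg zero_less_abs_iff mult_pos_pos)
    qed
    then show ?thesis by (simp add: X_def)
  qed
  ultimately show ?thesis by (intro exI[of _ P]) (auto simp: P_def)
qed

end

lemma filterlim_at_right_0I: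
  fixes h :: "nat \<Rightarrow> real"
  assumes "\<And>n. 0 < h n" "h \<longlonglongrightarrow> 0"
  shows "filterlim h (at_right 0) sequentially"
proof -
  have "h n \<noteq> 0" for n using assms(1)[of n] by simp
  with assms show ?thesis by (simp add: filterlim_at)
qed

lemma tint_one_le:
  assumes "a \<le> b" "0 < T"
  shows "tint T (\<lambda>_. 1) a b \<le> b - a"
proof -
  define a' b' where "a' = max 0 (min T a)" and "b' = max 0 (min T b)"
  have "tint T (\<lambda>_. 1) a b = tint T (\<lambda>_. 1) a' b'"
    unfolding tint_def
    by (rule Bochner_Integration.integral_cong)
       (auto simp: a'_def b'_def indicator_def space_restrict_space)
  also have "\<dots> = b' - a'"
    by (subst tint_const) (use assms in \<open>auto simp: a'_def b'_def\<close>)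
  also have "\<dots> \<le> b - a" using assms by (auto simp: a'_def b'_def)
  finally show ?thesis .
qed

section \<open>Constancy of the energy defect F\<close>

locale good_times = evolution +
  fixes P :: "real \<Rightarrow> bool"
  assumes AE_P: "AE t in MT. P t"
    and P_D: "P t \<Longrightarrow> 0 < t" "P t \<Longrightarrow> t < T" "P t \<Longrightarrow> v t \<in> V_space \<Omega> \<Gamma>D"
    and weak: "P s \<Longrightarrow> P t \<Longrightarrow> P \<tau> \<Longrightarrow> s \<le> t \<Longrightarrow>
       L2_ip \<Omega> (\<lambda>x. v t x - v s x) (v \<tau>) = tint T (\<lambda>r. \<xi> r (v \<tau>)) s t"
begin

definition F :: "real \<Rightarrow> real" where "F t = m t - 2 * tint T G 0 t"

text \<open>Bounds the error of freezing the argument of \<open>\<xi> r\<close> at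
  \<open>v t\<close> in place of \<open>v r\<close>.\<close>

definition \<phi> :: "real \<Rightarrow> real \<Rightarrow> real" where "\<phi> t r = k r * V_norm \<Omega> (\<lambda>x. v t x - v r x)"

lemma integrable_F: "integrable MT F"
  unfolding F_def[abs_def] using integrable_m tint_primitive_integrable[OF integrable_G T] by simp

lemma V_diff_measurable:
  assumes "w \<in> V_space \<Omega> \<Gamma>D"
  shows "(\<lambda>r. V_norm \<Omega> (\<lambda>x. w x - v r x)) \<in> borel_measurable MT"
  by (rule V.norm_diff_measurable[OF V.strongly_measurable_const[OF assms] AE_I2 bochner_L2_D(2,1)[OF vV]])
     (rule assms)

lemma integrable_V_diff2:
  assumes "w \<in> V_space \<Omega> \<Gamma>D"
  shows "integrable MT (\<lambda>r. (V_norm \<Omega> (\<lambda>x. w x - v r x))\<^sup>2)"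
  by (rule bochner_L2_D(3)[OF V.bochner_diff[OF V.bochner_const[OF assms] vV]])

lemma integrable_prod_bound:
  assumes "integrable MT (\<lambda>r. (f r)\<^sup>2)" "integrable MT (\<lambda>r. (h r)\<^sup>2)"
    and [measurable]: "f \<in> borel_measurable MT" "h \<in> borel_measurable MT"
  shows "integrable MT (\<lambda>r. f r * h r :: real)"
proof (rule Bochner_Integration.integrable_bound)
  show "integrable MT (\<lambda>r. (f r)\<^sup>2 + (h r)\<^sup>2)" using assms by simp
  have "\<bar>a * b\<bar> \<le> a\<^sup>2 + b\<^sup>2" for a b :: real
    using sum_squares_bound[of "\<bar>a\<bar>" "\<bar>b\<bar>"] mult_nonneg_nonneg[OF abs_ge_zero[of a] abs_ge_zero[of b]]
    unfolding abs_mult power2_abs by linarith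
  then show "AE r in MT. norm (f r * h r) \<le> norm ((f r)\<^sup>2 + (h r)\<^sup>2)"
    by (intro AE_I2) simp
qed measurable

lemma integrable_phi:
  assumes "v t \<in> V_space \<Omega> \<Gamma>D"
  shows "integrable MT (\<phi> t)"
  unfolding \<phi>_def[abs_def]
  by (rule integrable_prod_bound[OF integrable_k2 integrable_V_diff2[OF assms] k_measurable V_diff_measurable[OF assms]])

lemma abs_tint_phi:
  assumes "v s \<in> V_space \<Omega> \<Gamma>D"
  shows "\<bar>tint T (\<lambda>r. \<xi> r (v s)) a b - tint T G a b\<bar> \<le> tint T (\<phi> s) a b"
proof -
  note int = integrable_xi[OF assms] integrable_G
  have int': "integrable MT (\<lambda>r. \<xi> r (v s) - G r)" using int by simp
  have "tint T (\<lambda>r. \<xi> r (v s)) a b - tint T G a b = tint T (\<lambda>r. \<xi> r (v s) - G r) a b"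
    by (rule tint_diff[OF int, symmetric])
  also have "\<bar>\<dots>\<bar> \<le> tint T (\<lambda>r. \<bar>\<xi> r (v s) - G r\<bar>) a b" by (rule tint_abs_le[OF int'])
  also have "\<dots> \<le> tint T (\<phi> s) a b"
  proof (rule tint_mono)
    show "AE r in MT. a \<le> r \<and> r < b \<longrightarrow> \<bar>\<xi> r (v s) - G r\<bar> \<le> \<phi> s r"
      using AE_mem
    proof eventually_elim
      case (elim r)
      have "\<xi> r (v s) - G r = \<xi> r (\<lambda>x. v s x - v r x)"
        unfolding G_def by (rule V_dual_diff_arg[OF bo elim(2) assms elim(1), symmetric])
      then show ?case
        unfolding \<phi>_def k_def using V_dual_bound[OF bo elim(2) V_space_diff[OF bo assms elim(1)]] by simp
    qed
  qed (use int' integrable_phi[OF assms] in auto)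
  finally show ?thesis .
qed

text \<open>The squared increment is expanded twice, with the weak identity tested by
  \<open>v s\<close> and by \<open>v t\<close>. Discarding the square gives the one-sided bounds on
  \<open>F\<close>; the equalities that keep it return later for continuity in time.\<close>

lemma F_diff:
  assumes "P s" "P t" "s \<le> t"
  shows "F s - F t \<le> 2 * tint T (\<phi> s) s t" and "F t - F s \<le> 2 * tint T (\<phi> t) s t"
    and "(L2_norm \<Omega> (\<lambda>x. v t x - v s x))\<^sup>2 = m t - m s - 2 * tint T (\<lambda>r. \<xi> r (v s)) s t"
    and "(L2_norm \<Omega> (\<lambda>x. v t x - v s x))\<^sup>2 = m s - m t + 2 * tint T (\<lambda>r. \<xi> r (v t)) s t"
proof -
  have mem: "v s \<in> V_space \<Omega> \<Gamma>D" "v t \<in> V_space \<Omega> \<Gamma>D" using assms P_D by auto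
  note memH = mem[THEN V_space_L2]
  have G: "2 * tint T G 0 t - 2 * tint T G 0 s = 2 * tint T G s t"
    using tint_eq_primitive[OF integrable_G assms(3)] by simp
  have 1: "L2_ip \<Omega> (v t) (v s) - m s = tint T (\<lambda>r. \<xi> r (v s)) s t"
    using weak[OF assms(1,2,1,3)] L2_ip_diff_left[OF memH(2,1,1)] by (simp add: L2_ip_self m_def)
  have 2: "m t - L2_ip \<Omega> (v t) (v s) = tint T (\<lambda>r. \<xi> r (v t)) s t"
    using weak[OF assms(1,2,2,3)] L2_ip_diff_left[OF memH(2,1,2)] L2_ip_commute[of \<Omega> "v s"] by (simp add: L2_ip_self m_def)
  have 3: "(L2_norm \<Omega> (\<lambda>x. v t x - v s x))\<^sup>2 = m t + m s - 2 * L2_ip \<Omega> (v t) (v s)"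
    using L2_norm_diff_sq[OF memH(2,1)] by (simp add: m_def)
  show sq: "(L2_norm \<Omega> (\<lambda>x. v t x - v s x))\<^sup>2 = m t - m s - 2 * tint T (\<lambda>r. \<xi> r (v s)) s t"
    and sq': "(L2_norm \<Omega> (\<lambda>x. v t x - v s x))\<^sup>2 = m s - m t + 2 * tint T (\<lambda>r. \<xi> r (v t)) s t"
    using 1 2 3 by linarith+
  have pos: "0 \<le> (L2_norm \<Omega> (\<lambda>x. v t x - v s x))\<^sup>2" by simp
  show "F s - F t \<le> 2 * tint T (\<phi> s) s t"
    using sq pos abs_tint_phi[OF mem(1), of s t] G unfolding F_def by linarith
  show "F t - F s \<le> 2 * tint T (\<phi> t) s t"
    using sq' pos abs_tint_phi[OF mem(2), of s t] G unfolding F_def by linarith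
qed

text \<open>Simple functions reduce the mean continuity of \<open>v\<close> in time to Lebesgue differentiation of
  indicator functions. The values \<open>\<sigma> = 0\<close> and \<open>\<sigma> = 1\<close> select the windows to the right and to the left
  of \<open>r\<close>.\<close>

lemma simple_mean_continuity:
  fixes s :: "real \<Rightarrow> 'b" and h :: "nat \<Rightarrow> real"
  assumes s: "simple_function MT s" and sg: "\<sigma> = 0 \<or> \<sigma> = (1::real)"
    and h: "\<And>n. h n > 0" "h \<longlonglongrightarrow> 0"
  defines "W \<equiv> \<lambda>n r. tint T (\<lambda>\<rho>. if s \<rho> = s r then 0 else 1) (r - \<sigma> * h n) (r + (1 - \<sigma>) * h n)"
  shows "integrable MT (W n)" "(\<lambda>n. tint T (W n) a b / h n) \<longlonglongrightarrow> 0"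
proof -
  define C where "C = s ` {0<..<T}"
  have C: "finite C" using s by (simp add: simple_function_def space_restrict_space C_def)
  \<comment> \<open>The integrand in \<open>W\<close> depends on \<open>r\<close> through
    \<open>s r\<close>; splitting over the finitely many values \<open>c\<close> leaves fixed
    functions to differentiate.\<close>
  define jmp where "jmp c \<rho> = (if s \<rho> = c then 0 else (1::real))" for c \<rho>
  have lvl: "{r \<in> space MT. s r = c} \<in> sets MT" for c
  proof -
    have "s -` {c} \<inter> space MT \<in> sets MT" by (rule simple_functionD(2)[OF s])
    then show ?thesis by (simp add: vimage_def Int_def conj_commute)
  qed
  have chi_meas [measurable]: "jmp c \<in> borel_measurable MT" for c
    unfolding jmp_def by (rule measurable_If[OF _ _ lvl]) auto
  have chi: "integrable MT (jmp c)" for c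
    by (rule integrable_finite_interval_const_bound[of _ _ 1]) (auto simp: jmp_def chi_meas)
  have win: "r - \<sigma> * h n \<le> r + (1 - \<sigma>) * h n" for r n using h(1)[of n] sg by (auto simp: algebra_simps)
  have pq: "- (\<sigma> * h n) \<le> (1 - \<sigma>) * h n" for n using h(1)[of n] sg by auto
  have Wc: "integrable MT (\<lambda>r. tint T (jmp c) (r - \<sigma> * h n) (r + (1 - \<sigma>) * h n))" for c n
    using tint_window_integrable[OF chi T pq, of c n] by simp
  have W_sum: "W n r = (\<Sum>c\<in>C. (if s r = c then 1 else 0) * tint T (jmp c) (r - \<sigma> * h n) (r + (1 - \<sigma>) * h n))"
    if "r \<in> space MT" for n r
  proof -
    have "s r \<in> C" using that by (auto simp: C_def space_restrict_space)
    then have "(\<Sum>c\<in>C. (if s r = c then 1 else 0) * tint T (jmp c) (r - \<sigma> * h n) (r + (1 - \<sigma>) * h n))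
      = tint T (jmp (s r)) (r - \<sigma> * h n) (r + (1 - \<sigma>) * h n)"
      using C by (subst sum.remove[of _ "s r"]) (auto intro!: sum.neutral split: if_splits)
    then show ?thesis by (simp add: W_def jmp_def[abs_def])
  qed
  have W_meas: "W n \<in> borel_measurable MT" for n
  proof -
    have "(\<lambda>r. \<Sum>c\<in>C. (if s r = c then 1 else 0) * tint T (jmp c) (r - \<sigma> * h n) (r + (1 - \<sigma>) * h n)) \<in> borel_measurable MT"
      using Wc by (intro borel_measurable_sum borel_measurable_times measurable_If lvl) auto
    then show ?thesis by (rule measurable_cong[THEN iffD2, rotated]) (rule W_sum)
  qed
  have W_nonneg: "0 \<le> W n r" for n r unfolding W_def by (rule tint_nonneg) auto
  show Wint: "integrable MT (W n)" for n
  proof (rule integrable_finite_interval_const_bound[OF W_meas])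
    show "AE r in MT. \<bar>W n r\<bar> \<le> T"
    proof (intro AE_I2)
      fix r
      have "\<bar>W n r\<bar> \<le> (LINT \<rho>|MT. \<bar>if s \<rho> = s r then 0 else 1\<bar>)"
        unfolding W_def using chi[of "s r"] by (intro tint_primitive_bound) (simp add: jmp_def[abs_def])
      also have "\<dots> = tint T (jmp (s r)) 0 T"
        unfolding tint_full jmp_def by (intro Bochner_Integration.integral_cong) auto
      also have "\<dots> \<le> tint T (\<lambda>_. 1) 0 T"
        by (rule tint_mono[OF chi integrable_const_interval]) (auto simp: jmp_def)
      also have "\<dots> = T" using T by (simp add: tint_const)
      finally show "\<bar>W n r\<bar> \<le> T" .
    qed
  qed
  have leb: "AE r in MT. \<forall>c\<in>C. (\<lambda>n. tint T (jmp c) (r - \<sigma> * h n) (r + (1 - \<sigma>) * h n) / h n) \<longlonglongrightarrow> jmp c r"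
  proof (intro AE_finite_allI C)
    fix c
    have hr: "filterlim h (at_right 0) sequentially"
      by (rule filterlim_at_right_0I[OF h])
    show "AE r in MT. (\<lambda>n. tint T (jmp c) (r - \<sigma> * h n) (r + (1 - \<sigma>) * h n) / h n) \<longlonglongrightarrow> jmp c r"
      using tint_lebesgue_points[OF chi[of c]]
    proof eventually_elim
      case (elim r)
      have "(\<lambda>n. tint T (jmp c) r (r + h n) / h n) \<longlonglongrightarrow> jmp c r"
        by (rule filterlim_compose[OF conjunct1[OF elim] hr])
      moreover have "(\<lambda>n. tint T (jmp c) (r - h n) r / h n) \<longlonglongrightarrow> jmp c r"
        by (rule filterlim_compose[OF conjunct2[OF elim] hr])
      ultimately show ?case using sg by auto
    qed
  qed
  have "(\<lambda>n. LINT r|MT. indicator {a..<b} r * (W n r / h n)) \<longlonglongrightarrow> (LINT r|MT. 0)"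
  proof (rule integral_dominated_convergence)
    have [measurable]: "indicat_real {a..<b} \<in> borel_measurable MT"
      by (intro borel_measurable_lebesgue_onI) simp
    note W_meas [measurable]
    show "(\<lambda>r. indicator {a..<b} r * (W n r / h n)) \<in> borel_measurable MT" for n by measurable
    show "integrable MT (\<lambda>_. (1 :: real))" by (rule integrable_const_interval)
    show "AE r in MT. (\<lambda>n. indicator {a..<b} r * (W n r / h n)) \<longlonglongrightarrow> 0"
      using leb AE_in_interval[of T]
    proof eventually_elim
      case (elim r)
      then have "s r \<in> C" by (auto simp: C_def)
      with elim(1) have "(\<lambda>n. tint T (jmp (s r)) (r - \<sigma> * h n) (r + (1 - \<sigma>) * h n) / h n) \<longlonglongrightarrow> jmp (s r) r"
        by (rule bspec)
      then have "(\<lambda>n. W n r / h n) \<longlonglongrightarrow> jmp (s r) r"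
        unfolding W_def jmp_def[abs_def] .
      then have "(\<lambda>n. indicator {a..<b} r * (W n r / h n)) \<longlonglongrightarrow> indicator {a..<b} r * jmp (s r) r"
        by (intro tendsto_intros)
      \<comment> \<open>The limit is 0 because \<open>s\<close> trivially takes the value
        \<open>s r\<close> at \<open>r\<close>.\<close>
      then show ?case by (simp add: jmp_def)
    qed
  next
    have bound1: "W n r / h n \<le> 1" for n r
    proof -
      have "W n r = tint T (jmp (s r)) (r - \<sigma> * h n) (r + (1 - \<sigma>) * h n)" by (simp add: W_def jmp_def[abs_def])
      also have "\<dots> \<le> tint T (\<lambda>_. 1) (r - \<sigma> * h n) (r + (1 - \<sigma>) * h n)"
        by (rule tint_mono[OF chi integrable_const_interval]) (auto simp: jmp_def)
      also have "\<dots> \<le> h n"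
        by (rule order_trans[OF tint_one_le[OF win T]]) (simp add: algebra_simps)
      finally show ?thesis using h(1)[of n] by simp
    qed
    have "\<bar>indicator {a..<b} r * (W n r / h n)\<bar> \<le> 1" for n r
      using bound1[of n r] W_nonneg[of n r] h(1)[of n] by (auto simp: indicator_def)
    then show "AE r in MT. norm (indicator {a..<b} r * (W n r / h n)) \<le> 1" for n by simp
  qed simp
  then show "(\<lambda>n. tint T (W n) a b / h n) \<longlonglongrightarrow> 0"
    by (simp add: tint_def)
qed

text \<open>A weighted Young inequality separates \<open>k\<close> from the increment of
  \<open>v\<close>, and a simple approximation \<open>s\<close> controls that increment. The
  integrable majorant \<open>E\<close> stands in for the window integral as a function of
  \<open>r\<close>, so that only the measurability of \<open>E\<close> is at stake.\<close>

lemma phi_mean: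
  fixes h :: "nat \<Rightarrow> real"
  assumes sg: "\<sigma> = 0 \<or> \<sigma> = (1::real)" and ab: "0 < a" "a \<le> b" "b < T" and e: "e > 0"
    and h: "\<And>n. h n > 0" "h \<longlonglongrightarrow> 0"
  shows "\<forall>\<^sub>F n in sequentially. \<exists>E. integrable MT E \<and> (AE r in MT. 0 \<le> E r) \<and>
    (\<forall>r. P r \<longrightarrow> tint T (\<phi> r) (r - \<sigma> * h n) (r + (1 - \<sigma>) * h n) \<le> E r) \<and> tint T E a b \<le> e * h n"
proof -
  define K where "K = (LINT r|MT. (k r)\<^sup>2)"
  have K0: "0 \<le> K" unfolding K_def by simp
  \<comment> \<open>The weight in \<open>k * x \<le> \<kappa> * k^2 + x^2 / \<kappa>\<close>, small
    enough to make the contribution of \<open>k\<close> at most \<open>e / 4\<close>.\<close>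
  define \<kappa> where "\<kappa> = e / (4 * (K + 1))"
  have kap: "\<kappa> > 0" "\<kappa> * K \<le> e / 4" using e K0 by (auto simp: \<kappa>_def field_simps)
  \<comment> \<open>The approximation error meets the factor \<open>3 / \<kappa>\<close> twice, once
    at \<open>r\<close> and once inside the window; the constant 24 makes the two together at most
    \<open>e / 4\<close>.\<close>
  obtain s where s: "simple_function MT s" "s ` {0<..<T} \<subseteq> V_space \<Omega> \<Gamma>D"
    "integrable MT (\<lambda>t. (V_norm \<Omega> (\<lambda>x. v t x - s t x))\<^sup>2)"
    "(LINT t|MT. (V_norm \<Omega> (\<lambda>x. v t x - s t x))\<^sup>2) < \<kappa> * e / 24"
    by (rule V.bochner_simple_approx[OF vV, of "\<kappa> * e / 24"]) (use kap e in \<open>auto intro: that\<close>)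
  define \<delta> where "\<delta> t = (V_norm \<Omega> (\<lambda>x. v t x - s t x))\<^sup>2" for t
  have delta: "integrable MT \<delta>" "(LINT t|MT. \<delta> t) < \<kappa> * e / 24" "\<And>t. 0 \<le> \<delta> t"
    using s(3,4) by (auto simp: \<delta>_def[abs_def])
  define C where "C = s ` {0<..<T}"
  have C: "finite C" using s(1) by (simp add: simple_function_def space_restrict_space C_def)
  define D where "D = (\<Sum>p\<in>C \<times> C. (V_norm \<Omega> (\<lambda>x. fst p x - snd p x))\<^sup>2)"
  have D0: "0 \<le> D" unfolding D_def by (intro sum_nonneg) simp
  have D: "(V_norm \<Omega> (\<lambda>x. c x - c' x))\<^sup>2 \<le> D" if "c \<in> C" "c' \<in> C" for c c'
    unfolding D_def
    using member_le_sum[of "(c, c')" "C \<times> C" "\<lambda>p. (V_norm \<Omega> (\<lambda>x. fst p x - snd p x))\<^sup>2"] that C by simp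
  define J where "J r \<rho> = (if s \<rho> = s r then 0 else (1::real))" for r \<rho>
  define W where "W n r = tint T (J r) (r - \<sigma> * h n) (r + (1 - \<sigma>) * h n)" for n r
  have W: "integrable MT (W n)" "(\<lambda>n. tint T (W n) a b / h n) \<longlonglongrightarrow> 0" for n
    using simple_mean_continuity(1)[OF s(1) sg h, of n] simple_mean_continuity(2)[OF s(1) sg h, of a b]
    unfolding W_def[abs_def] J_def[abs_def] by auto
  have J: "integrable MT (J r)" for r
  proof (rule integrable_finite_interval_const_bound)
    have "{\<rho> \<in> space MT. s \<rho> = s r} \<in> sets MT"
      using simple_functionD(2)[OF s(1), of "{s r}"] by (simp add: vimage_def Int_def conj_commute)
    then show "J r \<in> borel_measurable MT" unfolding J_def by (intro measurable_If) auto
    show "AE \<rho> in MT. \<bar>J r \<rho>\<bar> \<le> 1" by (simp add: J_def)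
  qed
  \<comment> \<open>From \<open>v r\<close> to \<open>v \<rho>\<close> by way of \<open>s r\<close>
    and \<open>s \<rho>\<close>; the factor 3 comes from squaring a sum of three terms.\<close>
  have pointwise: "AE \<rho> in MT. \<phi> r \<rho> \<le> \<kappa> * (k \<rho>)\<^sup>2 + (3 / \<kappa>) * (\<delta> r * 1 + (\<delta> \<rho> + D * J r \<rho>))" if Pr: "P r" for r
    using AE_mem(1) AE_in_interval[of T]
  proof eventually_elim
    case (elim \<rho>)
    have r: "0 < r" "r < T" "v r \<in> V_space \<Omega> \<Gamma>D" using P_D[OF Pr] by auto
    have sV: "s r \<in> V_space \<Omega> \<Gamma>D" "s \<rho> \<in> V_space \<Omega> \<Gamma>D" "s r \<in> C" "s \<rho> \<in> C"
      using s(2) r elim by (auto simp: C_def)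
    define A B Z x where "A = V_norm \<Omega> (\<lambda>x. v r x - s r x)" and "B = V_norm \<Omega> (\<lambda>x. s r x - s \<rho> x)"
      and "Z = V_norm \<Omega> (\<lambda>x. v \<rho> x - s \<rho> x)" and "x = V_norm \<Omega> (\<lambda>x. v r x - v \<rho> x)"
    have "x \<le> A + V_norm \<Omega> (\<lambda>x. s r x - v \<rho> x)" unfolding x_def A_def by (rule V.tri_mid[OF r(3) sV(1) elim(1)])
    moreover have "V_norm \<Omega> (\<lambda>x. s r x - v \<rho> x) \<le> B + V_norm \<Omega> (\<lambda>x. s \<rho> x - v \<rho> x)"
      unfolding B_def by (rule V.tri_mid[OF sV(1,2) elim(1)])
    moreover have "V_norm \<Omega> (\<lambda>x. s \<rho> x - v \<rho> x) = Z" unfolding Z_def by (rule V.commute[OF sV(2) elim(1)])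
    ultimately have "x \<le> A + B + Z" by linarith
    moreover have "0 \<le> x" unfolding x_def by (rule V_norm_nonneg)
    ultimately have "x\<^sup>2 \<le> (A + B + Z)\<^sup>2" by (simp add: power_mono)
    also have "\<dots> \<le> 3 * (A\<^sup>2 + (Z\<^sup>2 + B\<^sup>2))"
    proof -
      have "0 \<le> (A - B)\<^sup>2 + (B - Z)\<^sup>2 + (A - Z)\<^sup>2" by simp
      then show ?thesis by (simp add: power2_eq_square algebra_simps)
    qed
    also have "B\<^sup>2 \<le> D * J r \<rho>"
    proof (cases "s \<rho> = s r")
      case True
      then have "B = 0" by (simp add: B_def V.zero(2))
      then show ?thesis using True by (simp add: J_def)
    qed (use D[OF sV(3,4)] in \<open>auto simp: B_def J_def\<close>)
    finally have x2: "x\<^sup>2 \<le> 3 * (\<delta> r + (\<delta> \<rho> + D * J r \<rho>))" by (simp add: \<delta>_def A_def Z_def)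
    have "\<kappa> * (k \<rho> * x) \<le> \<kappa> * (\<kappa> * (k \<rho>)\<^sup>2 + x\<^sup>2 / \<kappa>)"
    proof -
      have "0 \<le> (\<kappa> * k \<rho> - x / 2)\<^sup>2 + 3 / 4 * x\<^sup>2" by simp
      also have "\<dots> = (\<kappa> * k \<rho>)\<^sup>2 + x\<^sup>2 - \<kappa> * (k \<rho> * x)" by (simp add: power2_eq_square field_simps)
      finally have "\<kappa> * (k \<rho> * x) \<le> (\<kappa> * k \<rho>)\<^sup>2 + x\<^sup>2" by simp
      also have "\<dots> = \<kappa> * (\<kappa> * (k \<rho>)\<^sup>2 + x\<^sup>2 / \<kappa>)"
        using kap(1) by (simp add: power2_eq_square distrib_left)
      finally show ?thesis .
    qed
    then have "k \<rho> * x \<le> \<kappa> * (k \<rho>)\<^sup>2 + x\<^sup>2 / \<kappa>" using kap(1) by (rule mult_left_le_imp_le)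
    also have "x\<^sup>2 / \<kappa> \<le> (3 / \<kappa>) * (\<delta> r * 1 + (\<delta> \<rho> + D * J r \<rho>))"
      using divide_right_mono[OF x2 less_imp_le[OF kap(1)]] by simp
    finally show ?case by (simp add: \<phi>_def x_def)
  qed
  \<comment> \<open>\<open>\<delta> r\<close> does not depend on the window variable, hence its
    factor \<open>h n\<close>, the length of the window.\<close>
  define E where "E n r = \<kappa> * tint T (\<lambda>\<rho>. (k \<rho>)\<^sup>2) (r - \<sigma> * h n) (r + (1 - \<sigma>) * h n)
    + (3 / \<kappa>) * (h n * \<delta> r + (tint T \<delta> (r - \<sigma> * h n) (r + (1 - \<sigma>) * h n) + D * W n r))" for n r
  have pq: "- (\<sigma> * h n) \<le> (1 - \<sigma>) * h n" for n using h(1)[of n] sg by auto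
  have win: "r - \<sigma> * h n \<le> r + (1 - \<sigma>) * h n" for r n using pq[of n] by simp
  have wk: "integrable MT (\<lambda>r. tint T (\<lambda>\<rho>. (k \<rho>)\<^sup>2) (r - \<sigma> * h n) (r + (1 - \<sigma>) * h n))"
    and wd: "integrable MT (\<lambda>r. tint T \<delta> (r - \<sigma> * h n) (r + (1 - \<sigma>) * h n))" for n
    using tint_window_integrable[OF integrable_k2 T pq, of n] tint_window_integrable[OF delta(1) T pq, of n] by auto
  have Eint: "integrable MT (E n)" for n
    unfolding E_def using wk[of n] wd[of n] W(1)[of n] delta(1) by simp
  have W0: "0 \<le> W n r" for n r unfolding W_def by (rule tint_nonneg) (simp add: J_def)
  have E0: "0 \<le> E n r" for n r
    unfolding E_def using kap(1) D0 W0[of n r] delta(3) less_imp_le[OF h(1)[of n]]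
    by (intro add_nonneg_nonneg mult_nonneg_nonneg tint_nonneg) (auto simp: AE_I2)
  have Ephi: "tint T (\<phi> r) (r - \<sigma> * h n) (r + (1 - \<sigma>) * h n) \<le> E n r" if Pr: "P r" for n r
  proof -
    let ?a = "r - \<sigma> * h n" and ?b = "r + (1 - \<sigma>) * h n"
    note ints = integrable_const_interval[of T 1] delta(1) J[of r] integrable_k2
    have i1: "integrable MT (\<lambda>\<rho>. \<kappa> * (k \<rho>)\<^sup>2)" and i3: "integrable MT (\<lambda>\<rho>. D * J r \<rho>)"
      and i5: "integrable MT (\<lambda>\<rho>. \<delta> r * 1)"
      using ints by (auto intro: integrable_const_interval)
    have i4: "integrable MT (\<lambda>\<rho>. \<delta> \<rho> + D * J r \<rho>)" using i3 ints by simp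
    have i6: "integrable MT (\<lambda>\<rho>. \<delta> r * 1 + (\<delta> \<rho> + D * J r \<rho>))" by (rule Bochner_Integration.integrable_add[OF i5 i4])
    have i2: "integrable MT (\<lambda>\<rho>. (3 / \<kappa>) * (\<delta> r * 1 + (\<delta> \<rho> + D * J r \<rho>)))" using i6 by (rule integrable_mult_right)
    have "tint T (\<phi> r) ?a ?b \<le> tint T (\<lambda>\<rho>. \<kappa> * (k \<rho>)\<^sup>2 + (3 / \<kappa>) * (\<delta> r * 1 + (\<delta> \<rho> + D * J r \<rho>))) ?a ?b"
    proof (rule tint_mono[OF integrable_phi[OF P_D(3)[OF Pr]]])
      show "integrable MT (\<lambda>\<rho>. \<kappa> * (k \<rho>)\<^sup>2 + (3 / \<kappa>) * (\<delta> r * 1 + (\<delta> \<rho> + D * J r \<rho>)))"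
        by (rule Bochner_Integration.integrable_add[OF i1 i2])
      show "AE \<rho> in MT. ?a \<le> \<rho> \<and> \<rho> < ?b \<longrightarrow> \<phi> r \<rho> \<le> \<kappa> * (k \<rho>)\<^sup>2 + (3 / \<kappa>) * (\<delta> r * 1 + (\<delta> \<rho> + D * J r \<rho>))"
        using pointwise[OF Pr] by eventually_elim simp
    qed
    also have "\<dots> = \<kappa> * tint T (\<lambda>\<rho>. (k \<rho>)\<^sup>2) ?a ?b
      + (3 / \<kappa>) * (\<delta> r * tint T (\<lambda>_. 1) ?a ?b + (tint T \<delta> ?a ?b + D * tint T (J r) ?a ?b))"
    proof -
      show ?thesis
        unfolding tint_add[OF i1 i2] tint_cmult tint_add[OF i5 i4] tint_add[OF delta(1) i3] ..
    qed
    also have "\<dots> \<le> E n r"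
    proof -
      have "tint T (\<lambda>_. 1) ?a ?b \<le> h n"
        by (rule order_trans[OF tint_one_le[OF win T]]) (simp add: algebra_simps)
      then have "\<delta> r * tint T (\<lambda>_. 1) ?a ?b \<le> \<delta> r * h n" using delta(3)[of r] by (rule mult_left_mono)
      then have "\<delta> r * tint T (\<lambda>_. 1) ?a ?b \<le> h n * \<delta> r" by (simp only: mult.commute)
      then show ?thesis unfolding E_def W_def using kap(1) D0 by (intro add_mono mult_left_mono) auto
    qed
    finally show ?thesis .
  qed
  have lim: "(\<lambda>n. (3 / \<kappa>) * (D * (tint T (W n) a b / h n))) \<longlonglongrightarrow> (3 / \<kappa>) * (D * 0)"
    by (intro tendsto_intros W(2))
  have ev1: "\<forall>\<^sub>F n in sequentially. (3 / \<kappa>) * (D * (tint T (W n) a b / h n)) < e / 4"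
    by (rule order_tendstoD(2)[OF lim]) (use e in simp)
  \<comment> \<open>Keeps the windows based in \<open>{a..<b}\<close> inside the time
    interval.\<close>
  have ev2: "\<forall>\<^sub>F n in sequentially. h n < min a (T - b)"
    by (rule order_tendstoD(2)[OF h(2)]) (use ab in simp)
  from ev1 ev2 show ?thesis
  proof eventually_elim
    case (elim n)
    have side: "0 \<le> a - \<sigma> * h n" "b + (1 - \<sigma>) * h n \<le> T" using elim(2) sg ab h(1)[of n] by auto
    have len: "(1 - \<sigma>) * h n - - (\<sigma> * h n) = h n" by (simp add: algebra_simps)
    have ab': "0 \<le> a" "b \<le> T" using ab by auto
    let ?I = "tint T (\<lambda>r. tint T (\<lambda>\<rho>. (k \<rho>)\<^sup>2) (r - \<sigma> * h n) (r + (1 - \<sigma>) * h n)) a b"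
    have I: "?I \<le> h n * K"
      using tint_window_le[OF integrable_k2 _ T pq[of n] ab'(1) ab(2) ab'(2)] side len by (simp add: K_def)
    have b1: "\<kappa> * tint T (\<lambda>r. tint T (\<lambda>\<rho>. (k \<rho>)\<^sup>2) (r - \<sigma> * h n) (r + (1 - \<sigma>) * h n)) a b \<le> e / 4 * h n"
    proof -
      have "\<kappa> * ?I \<le> \<kappa> * (h n * K)" using I kap(1) by (intro mult_left_mono) auto
      also have "\<dots> = (\<kappa> * K) * h n" by simp
      also have "\<dots> \<le> e / 4 * h n" using kap(2) h(1)[of n] by (intro mult_right_mono) auto
      finally show ?thesis .
    qed
    have b2: "tint T (\<lambda>r. tint T \<delta> (r - \<sigma> * h n) (r + (1 - \<sigma>) * h n)) a b \<le> h n * (LINT t|MT. \<delta> t)"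
      using tint_window_le[OF delta(1) _ T pq[of n] ab'(1) ab(2) ab'(2)] side len delta(3) by simp
    have b3: "tint T \<delta> a b \<le> (LINT t|MT. \<delta> t)"
      using tint_mono_interval[OF delta(1) _ ab'] delta(3) by (simp add: tint_full)
    have i1: "integrable MT (\<lambda>r. \<kappa> * tint T (\<lambda>\<rho>. (k \<rho>)\<^sup>2) (r - \<sigma> * h n) (r + (1 - \<sigma>) * h n))" using wk[of n] by simp
    have i3: "integrable MT (\<lambda>r. h n * \<delta> r)" using delta(1) by simp
    have i5: "integrable MT (\<lambda>r. D * W n r)" using W(1)[of n] by simp
    have i4: "integrable MT (\<lambda>r. tint T \<delta> (r - \<sigma> * h n) (r + (1 - \<sigma>) * h n) + D * W n r)" using wd[of n] i5 by simp
    have i6: "integrable MT (\<lambda>r. h n * \<delta> r + (tint T \<delta> (r - \<sigma> * h n) (r + (1 - \<sigma>) * h n) + D * W n r))" using i3 i4 by simp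
    have i2: "integrable MT (\<lambda>r. (3 / \<kappa>) * (h n * \<delta> r + (tint T \<delta> (r - \<sigma> * h n) (r + (1 - \<sigma>) * h n) + D * W n r)))"
      using i6 by (rule integrable_mult_right)
    have "tint T (E n) a b = \<kappa> * tint T (\<lambda>r. tint T (\<lambda>\<rho>. (k \<rho>)\<^sup>2) (r - \<sigma> * h n) (r + (1 - \<sigma>) * h n)) a b
      + (3 / \<kappa>) * (h n * tint T \<delta> a b + (tint T (\<lambda>r. tint T \<delta> (r - \<sigma> * h n) (r + (1 - \<sigma>) * h n)) a b + D * tint T (W n) a b))"
      unfolding E_def[abs_def] tint_add[OF i1 i2] tint_cmult tint_add[OF i3 i4] tint_add[OF wd[of n] i5] ..
    also have "\<dots> \<le> e / 4 * h n + (3 / \<kappa>) * (h n * (LINT t|MT. \<delta> t) + (h n * (LINT t|MT. \<delta> t) + D * tint T (W n) a b))"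
      using b1 b2 b3 kap(1) D0 h(1)[of n] by (intro add_mono mult_left_mono) auto
    also have "\<dots> = e / 4 * h n + (6 / \<kappa>) * (LINT t|MT. \<delta> t) * h n + (3 / \<kappa>) * (D * tint T (W n) a b)"
      by (simp add: algebra_simps)
    \<comment> \<open>The contributions of \<open>k\<close>, of the approximation error and of the
      jumps of \<open>s\<close> each take at most a quarter of \<open>e * h n\<close>.\<close>
    also have "\<dots> \<le> e / 4 * h n + e / 4 * h n + e / 4 * h n"
    proof (intro add_mono mult_right_mono order_refl)
      have "(6 / \<kappa>) * (LINT t|MT. \<delta> t) \<le> (6 / \<kappa>) * (\<kappa> * e / 24)"
        using delta(2) kap(1) by (intro mult_left_mono) auto
      then show "(6 / \<kappa>) * (LINT t|MT. \<delta> t) \<le> e / 4" using kap(1) by simp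
      have "(3 / \<kappa>) * (D * tint T (W n) a b) = ((3 / \<kappa>) * (D * (tint T (W n) a b / h n))) * h n"
        using h(1)[of n] by simp
      also have "\<dots> \<le> e / 4 * h n" using elim(1) h(1)[of n] by (intro mult_right_mono) auto
      finally show "(3 / \<kappa>) * (D * tint T (W n) a b) \<le> e / 4 * h n" .
    qed (use h(1)[of n] in auto)
    also have "\<dots> \<le> e * h n" using e h(1)[of n] by (simp add: field_simps)
    finally have "tint T (E n) a b \<le> e * h n" .
    then show ?case using Eint[of n] E0[of n] Ephi[of _ n] by (intro exI[of _ "E n"]) auto
  qed
qed

lemma F_eq:
  assumes Pab: "P a" "P b" and ab: "a < b"
    and La: "((\<lambda>h. tint T F a (a + h) / h) \<longlongrightarrow> F a) (at_right 0)"
    and Lb: "((\<lambda>h. tint T F b (b + h) / h) \<longlongrightarrow> F b) (at_right 0)"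
  shows "F a = F b"
proof -
  define h where "h n = 1 / (real n + 1)" for n :: nat
  have h: "h n > 0" "h \<longlonglongrightarrow> 0" for n
    using LIMSEQ_inverse_real_of_nat by (auto simp: h_def[abs_def] inverse_eq_divide add.commute)
  have hr: "filterlim h (at_right 0) sequentially" by (rule filterlim_at_right_0I[OF h])
  have pos: "0 < a" "b < T" using Pab P_D by auto
  \<comment> \<open>A fixed upper end beyond \<open>b\<close>: the interval
    \<open>{a + h n..<b + h n}\<close> moves with \<open>n\<close>, while \<open>phi_mean\<close> is
    applied on one that does not.\<close>
  define b' where "b' = (b + T) / 2"
  have b': "b < b'" "b' < T" using pos by (auto simp: b'_def)
  define R where "R n = tint T F (a + h n) (b + h n) - tint T F a b" for n
  have "R n = tint T F b (b + h n) - tint T F a (a + h n)" for n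
    unfolding R_def using h(1)[of n] ab
      tint_eq_primitive[OF integrable_F, of "a + h n" "b + h n"] tint_eq_primitive[OF integrable_F, of a b]
      tint_eq_primitive[OF integrable_F, of b "b + h n"] tint_eq_primitive[OF integrable_F, of a "a + h n"] by simp
  then have "(\<lambda>n. R n / h n) = (\<lambda>n. tint T F b (b + h n) / h n - tint T F a (a + h n) / h n)"
    by (simp add: diff_divide_distrib)
  moreover have "(\<lambda>n. tint T F b (b + h n) / h n - tint T F a (a + h n) / h n) \<longlonglongrightarrow> F b - F a"
    by (intro tendsto_diff filterlim_compose[OF La hr] filterlim_compose[OF Lb hr])
  ultimately have lim: "(\<lambda>n. R n / h n) \<longlonglongrightarrow> F b - F a" by simp
  have hsmall: "\<forall>\<^sub>F n in sequentially. h n < min a (b' - b)"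
    by (rule order_tendstoD(2)[OF h(2)]) (use pos b' in simp)
  have bound: "\<forall>\<^sub>F n in sequentially. \<bar>R n / h n\<bar> \<le> 2 * e" if e: "e > 0" for e
  proof -
    have "\<forall>\<^sub>F n in sequentially. \<exists>E. integrable MT E \<and> (AE r in MT. 0 \<le> E r) \<and>
      (\<forall>r. P r \<longrightarrow> tint T (\<phi> r) (r - 0 * h n) (r + (1 - 0) * h n) \<le> E r) \<and> tint T E a b \<le> e * h n"
      by (rule phi_mean) (use e h pos ab b' in auto)
    moreover have "\<forall>\<^sub>F n in sequentially. \<exists>E. integrable MT E \<and> (AE r in MT. 0 \<le> E r) \<and>
      (\<forall>r. P r \<longrightarrow> tint T (\<phi> r) (r - 1 * h n) (r + (1 - 1) * h n) \<le> E r) \<and> tint T E a b' \<le> e * h n"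
      by (rule phi_mean) (use e h pos ab b' in auto)
    ultimately show ?thesis using hsmall
    proof eventually_elim
      case (elim n)
      have hn: "0 < h n" "h n < a" "b + h n < b'" using h(1)[of n] elim(3) by auto
      obtain E where E: "integrable MT E" "\<And>r. P r \<Longrightarrow> tint T (\<phi> r) r (r + h n) \<le> E r" "tint T E a b \<le> e * h n"
        using elim(1) by auto
      obtain E' where E': "integrable MT E'" "AE r in MT. 0 \<le> E' r" "\<And>r. P r \<Longrightarrow> tint T (\<phi> r) (r - h n) r \<le> E' r"
        "tint T E' a b' \<le> e * h n"
        using elim(2) by auto
      define Fp where "Fp c r = indicator {0<..<T} (r + c) * F (r + c)" for c r
      have c1: "0 \<le> a" "b \<le> T" "0 \<le> a + h n" "b + h n \<le> T"
        using pos ab b' hn by auto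
      have c2: "0 \<le> a + h n" "b + h n \<le> T" "0 \<le> (a + h n) + (- h n)" "(b + h n) + (- h n) \<le> T"
        using pos ab b' hn by auto
      have Fp: "integrable MT (Fp (h n))" "tint T (Fp (h n)) a b = tint T F (a + h n) (b + h n)"
        using tint_translate[OF integrable_F c1] unfolding Fp_def[abs_def] by auto
      have Fm: "integrable MT (Fp (- h n))" "tint T (Fp (- h n)) (a + h n) (b + h n) = tint T F a b"
        using tint_translate[OF integrable_F c2] unfolding Fp_def[abs_def] by auto
      \<comment> \<open>Lower bound for \<open>R n\<close>: each window lies to the right of
        \<open>r\<close>, the point at which \<open>\<phi>\<close> is frozen.\<close>
      have "- R n = tint T (\<lambda>r. F r - Fp (h n) r) a b"
        unfolding R_def Fp(2)[symmetric] tint_diff[OF integrable_F Fp(1)] by simp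
      also have "\<dots> \<le> tint T (\<lambda>r. 2 * E r) a b"
      proof (rule tint_mono)
        show "AE r in MT. a \<le> r \<and> r < b \<longrightarrow> F r - Fp (h n) r \<le> 2 * E r"
          using AE_P AE_translate[OF AE_P, of "h n"]
        proof eventually_elim
          case (elim r)
          show ?case
          proof
            assume r: "a \<le> r \<and> r < b"
            have rr: "0 < r + h n" "r + h n < T" using r hn pos b' ab by auto
            with elim(2) have Pr: "P (r + h n)" by simp
            have "F r - F (r + h n) \<le> 2 * tint T (\<phi> r) r (r + h n)"
              by (rule F_diff(1)[OF elim(1) Pr]) (use hn in simp)
            with E(2)[OF elim(1)] rr show "F r - Fp (h n) r \<le> 2 * E r" by (simp add: Fp_def)
          qed
        qed
      qed (use integrable_F Fp(1) E(1) in auto)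
      also have "\<dots> \<le> 2 * e * h n" using E(3) by (simp add: tint_cmult)
      finally have lo: "- R n \<le> 2 * e * h n" .
      \<comment> \<open>For the upper bound the freezing point is the right end of each window.
        Integrating over the shifted interval makes that end the variable \<open>r\<close>.\<close>
      have "R n = tint T (\<lambda>r. F r - Fp (- h n) r) (a + h n) (b + h n)"
        unfolding R_def Fm(2)[symmetric] tint_diff[OF integrable_F Fm(1)] by simp
      also have "\<dots> \<le> tint T (\<lambda>r. 2 * E' r) (a + h n) (b + h n)"
      proof (rule tint_mono)
        show "AE r in MT. a + h n \<le> r \<and> r < b + h n \<longrightarrow> F r - Fp (- h n) r \<le> 2 * E' r"
          using AE_P AE_translate[OF AE_P, of "- h n"]
        proof eventually_elim
          case (elim r)
          show ?case
          proof
            assume r: "a + h n \<le> r \<and> r < b + h n"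
            have rr: "0 < r + - h n" "r + - h n < T" using r hn pos b' ab by auto
            with elim(2) have Pr: "P (r + - h n)" by simp
            have "F r - F (r + - h n) \<le> 2 * tint T (\<phi> r) (r + - h n) r"
              by (rule F_diff(2)[OF Pr elim(1)]) (use hn in simp)
            with E'(3)[OF elim(1)] rr show "F r - Fp (- h n) r \<le> 2 * E' r" by (simp add: Fp_def)
          qed
        qed
      qed (use integrable_F Fm(1) E'(1) in auto)
      also have "\<dots> = 2 * tint T E' (a + h n) (b + h n)" by (rule tint_cmult)
      also have "\<dots> \<le> 2 * tint T E' a b'"
        using tint_mono_interval[OF E'(1,2), of a "a + h n" "b + h n" b'] hn by simp
      also have "\<dots> \<le> 2 * e * h n" using E'(4) by simp
      finally have "\<bar>R n\<bar> \<le> 2 * e * h n" using lo by linarith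
      then show ?case using hn(1) by (simp add: abs_div_pos[symmetric] pos_divide_le_eq)
    qed
  qed
  have le: "\<bar>F b - F a\<bar> \<le> 2 * e" if "e > 0" for e
    by (rule tendsto_upperbound[OF tendsto_rabs[OF lim] bound[OF that]]) simp
  have "\<bar>F b - F a\<bar> \<le> 0"
  proof (rule field_le_epsilon)
    fix e :: real assume "0 < e"
    then show "\<bar>F b - F a\<bar> \<le> 0 + e" using le[of "e / 2"] by simp
  qed
  then show ?thesis by simp
qed

lemma F_const: "\<exists>c. AE t in MT. F t = c"
proof -
  define L where "L t \<longleftrightarrow> P t \<and> ((\<lambda>h. tint T F t (t + h) / h) \<longlongrightarrow> F t) (at_right 0)" for t
  have AE_L: "AE t in MT. L t"
    using AE_P tint_lebesgue_points[OF integrable_F] by eventually_elim (simp add: L_def)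
  have eq: "F s = F t" if "L s" "L t" for s t
    using that F_eq[of s t] F_eq[of t s] by (cases s t rule: linorder_cases) (auto simp: L_def)
  show ?thesis
  proof (cases "\<exists>t0. L t0")
    case True
    then obtain t0 where "L t0" ..
    with AE_L have "AE t in MT. F t = F t0" by (auto intro: eq elim: eventually_mono)
    then show ?thesis ..
  next
    case False
    with AE_L have "AE t in MT. F t = 0" by (auto elim: eventually_mono)
    then show ?thesis ..
  qed
qed

end


section \<open>Continuous representatives and integration by parts\<close>

lemma nonpos_if_le_all_pos:
  fixes x :: real
  assumes "\<And>e. e > 0 \<Longrightarrow> x \<le> e"
  shows "x \<le> 0"
  by (rule ccontr) (use assms[of "x / 2"] in auto)

lemma AE_interval_exists:
  fixes a b T :: real
  assumes "AE r in lebesgue_on {0<..<T}. Q r" "0 \<le> a" "a < b" "b \<le> T"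
  shows "\<exists>r. a \<le> r \<and> r < b \<and> Q r"
proof (rule ccontr)
  assume no: "\<not> ?thesis"
  have "tint T (\<lambda>_. 1) a b \<le> tint T (\<lambda>_. 0) a b"
  proof (rule tint_mono[OF integrable_const_interval integrable_const_interval])
    show "AE r in lebesgue_on {0<..<T}. a \<le> r \<and> r < b \<longrightarrow> (1::real) \<le> 0"
      using assms(1) by eventually_elim (use no in blast)
  qed
  then show False using assms by (simp add: tint_const)
qed

lemma L2_norm_zero_AE:
  assumes "v \<in> L2 \<Omega>" "L2_norm \<Omega> v = 0"
  shows "AE x in lebesgue_on \<Omega>. v x = 0"
proof -
  have "(LINT x|lebesgue_on \<Omega>. (norm (v x))\<^sup>2) = 0" using assms(2) L2_norm_sq[of \<Omega> v] by simp
  then have "AE x in lebesgue_on \<Omega>. (norm (v x))\<^sup>2 = 0"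
    using integral_nonneg_eq_0_iff_AE[OF L2_D(2)[OF assms(1)]] by simp
  then show ?thesis by simp
qed

lemma L2_norm_AE_zero:
  assumes "AE x in lebesgue_on \<Omega>. v x = w x"
  shows "L2_norm \<Omega> (\<lambda>x. v x - w x) = 0"
proof -
  have "AE x in lebesgue_on \<Omega>. (norm (v x - w x))\<^sup>2 = 0" using assms by eventually_elim simp
  then show ?thesis by (simp add: L2_norm_def integral_eq_zero_AE)
qed

lemma continuous_into_H_D:
  assumes "continuous_into_H T \<Omega> c" "t \<in> {0..T}"
  shows "c t \<in> L2 \<Omega>"
    and "e > 0 \<Longrightarrow> \<exists>d>0. \<forall>s\<in>{0..T}. \<bar>s - t\<bar> < d \<longrightarrow> L2_norm \<Omega> (\<lambda>x. c s x - c t x) < e"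
proof -
  show "c t \<in> L2 \<Omega>" using assms by (simp add: continuous_into_H_def)
  assume e: "e > 0"
  have "((\<lambda>s. L2_norm \<Omega> (c s - c t)) \<longlongrightarrow> 0) (at t within {0..T})"
    using assms by (simp add: continuous_into_H_def)
  then have "\<forall>\<^sub>F s in at t within {0..T}. L2_norm \<Omega> (c s - c t) < e" using e by (rule order_tendstoD(2))
  then obtain d where d: "d > 0" "\<And>s. s \<in> {0..T} \<Longrightarrow> s \<noteq> t \<Longrightarrow> dist s t < d \<Longrightarrow> L2_norm \<Omega> (c s - c t) < e"
    unfolding eventually_at by blast
  have "L2_norm \<Omega> (\<lambda>x. c s x - c t x) < e" if "s \<in> {0..T}" "\<bar>s - t\<bar> < d" for s
  proof (cases "s = t")
    case True
    then show ?thesis using e by (simp add: L2_norm_def)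
  next
    case False
    with d(2)[OF that(1)] that(2) show ?thesis by (simp add: dist_real_def fun_diff_def)
  qed
  with d(1) show "\<exists>d>0. \<forall>s\<in>{0..T}. \<bar>s - t\<bar> < d \<longrightarrow> L2_norm \<Omega> (\<lambda>x. c s x - c t x) < e" by blast
qed

lemma near_point_exists:
  fixes T :: real
  assumes "AE r in lebesgue_on {0<..<T}. Q r" "t0 \<in> {0..T}" "d > 0" "0 < T"
  shows "\<exists>r. r \<in> {0..T} \<and> \<bar>r - t0\<bar> < d \<and> Q r"
proof -
  define \<eta> where "\<eta> = min (d / 2) (T / 2)"
  have \<eta>: "\<eta> > 0" "\<eta> \<le> d / 2" "\<eta> \<le> T / 2" using assms by (auto simp: \<eta>_def)
  \<comment> \<open>The short interval is laid from \<open>t0\<close> towards the middle, so that it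
    stays inside \<open>{0..T}\<close>.\<close>
  define a where "a = (if t0 \<le> T / 2 then t0 else t0 - \<eta>)"
  have "\<exists>r. a \<le> r \<and> r < a + \<eta> \<and> Q r"
    by (rule AE_interval_exists[OF assms(1)]) (use \<eta> assms(2) in \<open>auto simp: a_def\<close>)
  then obtain r where r: "a \<le> r" "r < a + \<eta>" "Q r" by blast
  then have "r \<in> {0..T} \<and> \<bar>r - t0\<bar> < d" using \<eta> assms(2,3) by (auto simp: a_def split: if_splits)
  with r(3) show ?thesis by blast
qed

text \<open>\<open>continuous_rep\<close> is a choice, so its values are determined only up to null
  sets. Times of agreement accumulate at every \<open>t\<close>, the end points included, and
  continuity transfers the agreement there.\<close>

lemma continuous_rep_unique:
  assumes c: "continuous_into_H T \<Omega> c" and c': "continuous_into_H T \<Omega> c'" and T: "0 < T"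
    and eq: "AE t in lebesgue_on {0<..<T}. AE x in lebesgue_on \<Omega>. c t x = c' t x" and t: "t \<in> {0..T}"
  shows "L2_norm \<Omega> (\<lambda>x. c t x - c' t x) = 0"
proof -
  have "L2_norm \<Omega> (\<lambda>x. c t x - c' t x) \<le> e" if e: "e > 0" for e
  proof -
    obtain d where d: "d > 0" "\<And>s. s \<in> {0..T} \<Longrightarrow> \<bar>s - t\<bar> < d \<Longrightarrow> L2_norm \<Omega> (\<lambda>x. c s x - c t x) < e / 2"
      using continuous_into_H_D(2)[OF c t, of "e / 2"] e by auto
    obtain d' where d': "d' > 0" "\<And>s. s \<in> {0..T} \<Longrightarrow> \<bar>s - t\<bar> < d' \<Longrightarrow> L2_norm \<Omega> (\<lambda>x. c' s x - c' t x) < e / 2"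
      using continuous_into_H_D(2)[OF c' t, of "e / 2"] e by auto
    obtain s where s: "s \<in> {0..T}" "\<bar>s - t\<bar> < min d d'" "AE x in lebesgue_on \<Omega>. c s x = c' s x"
      using near_point_exists[OF eq t _ T, of "min d d'"] d(1) d'(1) by auto
    note mem = continuous_into_H_D(1)[OF c t] continuous_into_H_D(1)[OF c' t]
      continuous_into_H_D(1)[OF c s(1)] continuous_into_H_D(1)[OF c' s(1)]
    have "L2_norm \<Omega> (\<lambda>x. c t x - c' t x) \<le> L2_norm \<Omega> (\<lambda>x. c t x - c s x) + L2_norm \<Omega> (\<lambda>x. c s x - c' t x)"
      by (rule L2_norm_triangle_mid[OF mem(1,2,3)])
    also have "L2_norm \<Omega> (\<lambda>x. c s x - c' t x) \<le> L2_norm \<Omega> (\<lambda>x. c s x - c' s x) + L2_norm \<Omega> (\<lambda>x. c' s x - c' t x)"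
      by (rule L2_norm_triangle_mid[OF mem(3,2,4)])
    finally show ?thesis
      using L2_norm_AE_zero[OF s(3)] d(2)[OF s(1)] d'(2)[OF s(1)] s(2) L2_norm_minus_commute[of \<Omega> "c t" "c s"]
      by linarith
  qed
  then have "L2_norm \<Omega> (\<lambda>x. c t x - c' t x) \<le> 0" by (rule nonpos_if_le_all_pos)
  then show ?thesis using L2_norm_nonneg[of \<Omega> "\<lambda>x. c t x - c' t x"] by linarith
qed

section \<open>Continuity in H and the energy balance\<close>

locale energy_times = good_times +
  assumes energy: "P s \<Longrightarrow> P t \<Longrightarrow> s \<le> t \<Longrightarrow> m t - m s = 2 * tint T G s t"
begin

text \<open>The part of the Young estimate of \<open>2 * \<phi> \<sigma> r\<close> that depends on
  \<open>r\<close>; the remaining part is the constant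
  \<open>(V_norm \<Omega> (v \<sigma>))\<^sup>2\<close>.\<close>

definition q :: "real \<Rightarrow> real" where "q r = 2 * (k r)\<^sup>2 + (V_norm \<Omega> (v r))\<^sup>2"

lemma integrable_q: "integrable MT q"
  unfolding q_def[abs_def] using integrable_k2 bochner_L2_D(3)[OF vV] by simp

text \<open>The energy identity replaces the difference of the values of \<open>m\<close> in the
  expanded square by an integral of \<open>G\<close>, leaving only the error of freezing the
  argument at \<open>v \<sigma>\<close>. The two expansions in \<open>F_diff\<close> allow the same
  anchor for later and for earlier times \<open>t\<close>.\<close>

lemma diff_le:
  assumes "P \<sigma>" "P t"
  shows "(L2_norm \<Omega> (\<lambda>x. v t x - v \<sigma> x))\<^sup>2 \<le> tint T q (min \<sigma> t) (max \<sigma> t) + (V_norm \<Omega> (v \<sigma>))\<^sup>2 * \<bar>t - \<sigma>\<bar>"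
proof -
  have mem: "v \<sigma> \<in> V_space \<Omega> \<Gamma>D" by (rule P_D(3)[OF assms(1)])
  have "(L2_norm \<Omega> (\<lambda>x. v t x - v \<sigma> x))\<^sup>2 \<le> 2 * tint T (\<phi> \<sigma>) (min \<sigma> t) (max \<sigma> t)"
  proof (cases "\<sigma> \<le> t")
    case True
    show ?thesis
      using F_diff(3)[OF assms True] energy[OF assms True] abs_tint_phi[OF mem, of \<sigma> t] True by simp
  next
    case False
    then have le: "t \<le> \<sigma>" by simp
    show ?thesis
      using F_diff(4)[OF assms(2,1) le] energy[OF assms(2,1) le] abs_tint_phi[OF mem, of t \<sigma>] False
        L2_norm_minus_commute[of \<Omega> "v t" "v \<sigma>"] by simp
  qed
  also have "\<dots> = tint T (\<lambda>r. 2 * \<phi> \<sigma> r) (min \<sigma> t) (max \<sigma> t)" by (rule tint_cmult[symmetric])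
  also have "\<dots> \<le> tint T (\<lambda>r. q r + (V_norm \<Omega> (v \<sigma>))\<^sup>2) (min \<sigma> t) (max \<sigma> t)"
  proof (rule tint_mono)
    show "AE r in MT. min \<sigma> t \<le> r \<and> r < max \<sigma> t \<longrightarrow> 2 * \<phi> \<sigma> r \<le> q r + (V_norm \<Omega> (v \<sigma>))\<^sup>2"
      using AE_mem(1) AE_k_nonneg
    proof eventually_elim
      case (elim r)
      have "\<phi> \<sigma> r \<le> k r * (V_norm \<Omega> (v \<sigma>) + V_norm \<Omega> (v r))"
        unfolding \<phi>_def by (intro mult_left_mono V.tri mem elim)
      also have "2 * (k r * (V_norm \<Omega> (v \<sigma>) + V_norm \<Omega> (v r))) \<le> q r + (V_norm \<Omega> (v \<sigma>))\<^sup>2"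
        using sum_squares_bound[of "k r" "V_norm \<Omega> (v \<sigma>)"] sum_squares_bound[of "k r" "V_norm \<Omega> (v r)"]
        by (simp add: q_def distrib_left)
      finally show ?case by simp
    qed
  qed (use integrable_phi[OF mem] integrable_q integrable_const_interval in auto)
  also have "\<dots> = tint T q (min \<sigma> t) (max \<sigma> t) + (V_norm \<Omega> (v \<sigma>))\<^sup>2 * (max \<sigma> t - min \<sigma> t)"
    using P_D(1,2)[OF assms(1)] P_D(1,2)[OF assms(2)]
    by (subst tint_add[OF integrable_q integrable_const_interval], subst tint_const) auto
  also have "max \<sigma> t - min \<sigma> t = \<bar>t - \<sigma>\<bar>" by (simp add: max_def min_def)
  finally show ?thesis .
qed

text \<open>The anchor \<open>\<sigma>\<close> is chosen with \<open>V\<close>-norm at most its average near \<open>t0\<close>, so that the blow-up of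
  that norm is compensated by the length of the interval.\<close>

lemma cauchy_at:
  assumes t0: "t0 \<in> {0..T}" and e: "e > 0"
  obtains d \<sigma> where "d > 0" "P \<sigma>" "\<And>t. P t \<Longrightarrow> \<bar>t - t0\<bar> < d \<Longrightarrow> L2_norm \<Omega> (\<lambda>x. v t x - v \<sigma> x) < e"
proof -
  have e4: "e\<^sup>2 / 4 > 0" using e by simp
  obtain d0 where d0: "d0 > 0" "\<And>a b. 0 \<le> a \<Longrightarrow> a \<le> b \<Longrightarrow> b \<le> T \<Longrightarrow> b - a < d0 \<Longrightarrow> \<bar>tint T q a b\<bar> < e\<^sup>2 / 4"
    by (rule tint_uniformly_small[OF integrable_q T e4]) (rule that)
  define d where "d = min (d0 / 4) (T / 2)"
  have d: "d > 0" "d \<le> d0 / 4" "d \<le> T / 2" using d0(1) T by (auto simp: d_def)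
  define a where "a = (if t0 \<le> T / 2 then t0 else t0 - d)"
  have a: "0 \<le> a" "a + d \<le> T" "a \<le> t0" "t0 \<le> a + d" using t0 d T by (auto simp: a_def)
  have "\<exists>\<sigma>. a \<le> \<sigma> \<and> \<sigma> < a + d \<and> P \<sigma> \<and> d * (V_norm \<Omega> (v \<sigma>))\<^sup>2 \<le> e\<^sup>2 / 4"
  proof (rule ccontr)
    assume no: "\<not> ?thesis"
    \<comment> \<open>Otherwise \<open>q\<close> would be at least \<open>e\<^sup>2 / 4 / d\<close>
      almost everywhere on an interval of length \<open>d\<close>, against the choice of
      \<open>d0\<close>.\<close>
    have "tint T (\<lambda>_. e\<^sup>2 / 4 / d) a (a + d) \<le> tint T q a (a + d)"
    proof (rule tint_mono[OF integrable_const_interval integrable_q])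
      show "AE r in MT. a \<le> r \<and> r < a + d \<longrightarrow> e\<^sup>2 / 4 / d \<le> q r"
        using AE_P
      proof eventually_elim
        case (elim r)
        show ?case
        proof
          assume "a \<le> r \<and> r < a + d"
          with no elim have "e\<^sup>2 / 4 \<le> (V_norm \<Omega> (v r))\<^sup>2 * d" by (auto simp: mult.commute not_le intro: less_imp_le)
          then have "e\<^sup>2 / 4 / d \<le> (V_norm \<Omega> (v r))\<^sup>2" using d(1) by (simp only: pos_divide_le_eq)
          then show "e\<^sup>2 / 4 / d \<le> q r" unfolding q_def using zero_le_power2[of "k r"] by linarith
        qed
      qed
    qed
    moreover have "tint T (\<lambda>_. e\<^sup>2 / 4 / d) a (a + d) = e\<^sup>2 / 4"
      using a d by (subst tint_const) auto
    ultimately show False using d0(2)[of a "a + d"] a d d0(1) by simp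
  qed
  then obtain \<sigma> where \<sigma>: "a \<le> \<sigma>" "\<sigma> < a + d" "P \<sigma>" "d * (V_norm \<Omega> (v \<sigma>))\<^sup>2 \<le> e\<^sup>2 / 4" by blast
  have "L2_norm \<Omega> (\<lambda>x. v t x - v \<sigma> x) < e" if t: "P t" "\<bar>t - t0\<bar> < d" for t
  proof -
    \<comment> \<open>Since \<open>d\<close> is at most a quarter of \<open>d0\<close>, this length
      is admissible for \<open>d0\<close>. The two terms of \<open>diff_le\<close> are then below
      \<open>e\<^sup>2 / 4\<close> and at most \<open>e\<^sup>2 / 2\<close>.\<close>
    have len: "\<bar>t - \<sigma>\<bar> \<le> 2 * d" using t(2) \<sigma> a by linarith
    have "\<bar>tint T q (min \<sigma> t) (max \<sigma> t)\<bar> < e\<^sup>2 / 4"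
      by (rule d0(2)) (use P_D(1,2)[OF \<sigma>(3)] P_D(1,2)[OF t(1)] len d d0(1) in \<open>auto simp: max_def min_def\<close>)
    moreover have "(V_norm \<Omega> (v \<sigma>))\<^sup>2 * \<bar>t - \<sigma>\<bar> \<le> (V_norm \<Omega> (v \<sigma>))\<^sup>2 * (2 * d)"
      by (intro mult_left_mono len) simp
    ultimately have "(L2_norm \<Omega> (\<lambda>x. v t x - v \<sigma> x))\<^sup>2 < e\<^sup>2"
      using diff_le[OF \<sigma>(3) t(1)] \<sigma>(4) e4 by (simp add: mult.commute mult.left_commute)
    then show ?thesis using e by (auto intro: power2_less_imp_less)
  qed
  with d(1) \<sigma>(3) show ?thesis by (rule that)
qed

text \<open>One sequence of good times gives the candidate by completeness; \<open>cauchy_at\<close>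
  compares that sequence with all good times near \<open>t0\<close>.\<close>

lemma limit_at:
  assumes t0: "t0 \<in> {0..T}"
  shows "\<exists>w. w \<in> L2 \<Omega> \<and> (\<forall>e>0. \<exists>d>0. \<forall>t. P t \<longrightarrow> \<bar>t - t0\<bar> < d \<longrightarrow> L2_norm \<Omega> (\<lambda>x. v t x - w x) < e)"
proof -
  have "\<forall>n. \<exists>r. \<bar>r - t0\<bar> < 1 / (real n + 1) \<and> P r"
    using near_point_exists[OF AE_P t0 _ T, of "1 / (real n + 1)" for n] by (metis divide_pos_pos of_nat_0_le_iff add_nonneg_pos zero_less_one)
  then obtain \<tau> where \<tau>: "\<And>n. \<bar>\<tau> n - t0\<bar> < 1 / (real n + 1)" "\<And>n. P (\<tau> n)" by metis
  have ev: "\<exists>n0. \<forall>n\<ge>n0. \<bar>\<tau> n - t0\<bar> < d" if d: "d > 0" for d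
  proof -
    obtain n0 where n0: "1 / (real n0 + 1) < d" using nat_approx_posE[OF d] by (auto simp: add.commute)
    have "\<bar>\<tau> n - t0\<bar> < d" if "n \<ge> n0" for n
    proof -
      have "1 / (real n + 1) \<le> 1 / (real n0 + 1)" using that by (intro divide_left_mono) auto
      with \<tau>(1)[of n] n0 show ?thesis by linarith
    qed
    then show ?thesis by blast
  qed
  have vL: "P t \<Longrightarrow> v t \<in> L2 \<Omega>" for t using P_D(3) V_space_L2 by blast
  obtain w where w: "w \<in> L2 \<Omega>" "(\<lambda>n. L2_norm \<Omega> (\<lambda>x. v (\<tau> n) x - w x)) \<longlonglongrightarrow> 0"
  proof (rule L2_complete[of "\<lambda>n. v (\<tau> n)" \<Omega>])
    fix e :: real assume e: "e > 0"
    then have e2: "e / 2 > 0" by simp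
    obtain d \<sigma> where d: "d > 0" "P \<sigma>" "\<And>t. P t \<Longrightarrow> \<bar>t - t0\<bar> < d \<Longrightarrow> L2_norm \<Omega> (\<lambda>x. v t x - v \<sigma> x) < e / 2"
      by (rule cauchy_at[OF t0 e2]) (rule that)
    obtain n0 where n0: "\<And>n. n \<ge> n0 \<Longrightarrow> \<bar>\<tau> n - t0\<bar> < d" using ev[OF d(1)] by blast
    have "L2_norm \<Omega> (\<lambda>x. v (\<tau> i) x - v (\<tau> j) x) < e" if "i \<ge> n0" "j \<ge> n0" for i j
    proof -
      have "L2_norm \<Omega> (\<lambda>x. v (\<tau> i) x - v (\<tau> j) x) \<le> L2_norm \<Omega> (\<lambda>x. v (\<tau> i) x - v \<sigma> x) + L2_norm \<Omega> (\<lambda>x. v \<sigma> x - v (\<tau> j) x)"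
        by (intro L2_norm_triangle_mid vL \<tau> d)
      then show ?thesis
        using d(3)[OF \<tau>(2) n0[OF that(1)]] d(3)[OF \<tau>(2) n0[OF that(2)]] L2_norm_minus_commute[of \<Omega> "v \<sigma>" "v (\<tau> j)"] by linarith
    qed
    then show "\<exists>N. \<forall>i\<ge>N. \<forall>j\<ge>N. L2_norm \<Omega> (\<lambda>x. v (\<tau> i) x - v (\<tau> j) x) < e" by blast
  qed (use vL \<tau> in \<open>auto intro: that\<close>)
  have "\<exists>d>0. \<forall>t. P t \<longrightarrow> \<bar>t - t0\<bar> < d \<longrightarrow> L2_norm \<Omega> (\<lambda>x. v t x - w x) < e" if e: "e > 0" for e
  proof -
    have e3: "e / 3 > 0" using e by simp
    obtain d \<sigma> where d: "d > 0" "P \<sigma>" "\<And>t. P t \<Longrightarrow> \<bar>t - t0\<bar> < d \<Longrightarrow> L2_norm \<Omega> (\<lambda>x. v t x - v \<sigma> x) < e / 3"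
      by (rule cauchy_at[OF t0 e3]) (rule that)
    obtain n0 where n0: "\<And>n. n \<ge> n0 \<Longrightarrow> \<bar>\<tau> n - t0\<bar> < d" using ev[OF d(1)] by blast
    have "\<forall>\<^sub>F n in sequentially. L2_norm \<Omega> (\<lambda>x. v (\<tau> n) x - w x) < e / 3"
      by (rule order_tendstoD(2)[OF w(2) e3])
    then obtain n1 where n1: "\<And>n. n \<ge> n1 \<Longrightarrow> L2_norm \<Omega> (\<lambda>x. v (\<tau> n) x - w x) < e / 3"
      unfolding eventually_sequentially by blast
    define n where "n = max n0 n1"
    have "L2_norm \<Omega> (\<lambda>x. v t x - w x) < e" if t: "P t" "\<bar>t - t0\<bar> < d" for t
    proof -
      have "L2_norm \<Omega> (\<lambda>x. v t x - w x) \<le> L2_norm \<Omega> (\<lambda>x. v t x - v \<sigma> x) + L2_norm \<Omega> (\<lambda>x. v \<sigma> x - w x)"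
        by (intro L2_norm_triangle_mid vL t d w)
      also have "L2_norm \<Omega> (\<lambda>x. v \<sigma> x - w x) \<le> L2_norm \<Omega> (\<lambda>x. v \<sigma> x - v (\<tau> n) x) + L2_norm \<Omega> (\<lambda>x. v (\<tau> n) x - w x)"
        by (intro L2_norm_triangle_mid vL \<tau> d w)
      finally show ?thesis
        using d(3)[OF t] d(3)[OF \<tau>(2) n0[of n]] n1[of n] L2_norm_minus_commute[of \<Omega> "v \<sigma>" "v (\<tau> n)"]
        by (simp add: n_def)
    qed
    with d(1) show ?thesis by blast
  qed
  with w(1) show ?thesis by blast
qed

text \<open>The limits along good times define \<open>c\<close> on all of \<open>{0..T}\<close>, end
  points included. At good times they return \<open>v t\<close> up to a null set, and the energy
  identity extends to 0 and \<open>T\<close> by continuity of both sides.\<close>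

lemma continuous_representative:
  "\<exists>c. continuous_into_H T \<Omega> c \<and> (AE t in MT. AE x in lebesgue_on \<Omega>. c t x = v t x) \<and>
     (L2_norm \<Omega> (c T))\<^sup>2 - (L2_norm \<Omega> (c 0))\<^sup>2 = 2 * (LINT t|MT. \<xi> t (v t))"
proof -
  have "\<forall>t\<in>{0..T}. \<exists>w. w \<in> L2 \<Omega> \<and> (\<forall>e>0. \<exists>d>0. \<forall>s. P s \<longrightarrow> \<bar>s - t\<bar> < d \<longrightarrow> L2_norm \<Omega> (\<lambda>x. v s x - w x) < e)"
    by (intro ballI limit_at)
  from bchoice[OF this] obtain c where c0: "\<forall>t\<in>{0..T}. c t \<in> L2 \<Omega> \<and>
    (\<forall>e>0. \<exists>d>0. \<forall>s. P s \<longrightarrow> \<bar>s - t\<bar> < d \<longrightarrow> L2_norm \<Omega> (\<lambda>x. v s x - c t x) < e)" ..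
  have cL: "c t \<in> L2 \<Omega>" if "t \<in> {0..T}" for t using c0 that by simp
  have c: "\<exists>d>0. \<forall>s. P s \<longrightarrow> \<bar>s - t\<bar> < d \<longrightarrow> L2_norm \<Omega> (\<lambda>x. v s x - c t x) < e" if "t \<in> {0..T}" "e > 0" for t e
    using c0 that by simp
  have vL: "P t \<Longrightarrow> v t \<in> L2 \<Omega>" for t using P_D(3) V_space_L2 by blast
  have cont: "continuous_into_H T \<Omega> c"
    unfolding continuous_into_H_def
  proof (intro ballI conjI cL tendstoI)
    fix t e :: real assume t: "t \<in> {0..T}" and e: "e > 0"
    then have e2: "e / 2 > 0" by simp
    obtain d where d: "d > 0" "\<And>s. P s \<Longrightarrow> \<bar>s - t\<bar> < d \<Longrightarrow> L2_norm \<Omega> (\<lambda>x. v s x - c t x) < e / 2"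
      using c[OF t e2] by blast
    have "L2_norm \<Omega> (\<lambda>x. c s x - c t x) < e" if s: "s \<in> {0..T}" "\<bar>s - t\<bar> < d" for s
    proof -
      obtain d' where d': "d' > 0" "\<And>r. P r \<Longrightarrow> \<bar>r - s\<bar> < d' \<Longrightarrow> L2_norm \<Omega> (\<lambda>x. v r x - c s x) < e / 2"
        using c[OF s(1) e2] by blast
      obtain r where r: "\<bar>r - s\<bar> < min d' (d - \<bar>s - t\<bar>)" "P r"
        using near_point_exists[OF AE_P s(1) _ T, of "min d' (d - \<bar>s - t\<bar>)"] d'(1) s(2) by auto
      have "L2_norm \<Omega> (\<lambda>x. c s x - c t x) \<le> L2_norm \<Omega> (\<lambda>x. c s x - v r x) + L2_norm \<Omega> (\<lambda>x. v r x - c t x)"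
        by (intro L2_norm_triangle_mid cL vL r s t)
      then show ?thesis
        using d'(2)[OF r(2)] d(2)[OF r(2)] r(1) L2_norm_minus_commute[of \<Omega> "c s" "v r"] by linarith
    qed
    then show "\<forall>\<^sub>F s in at t within {0..T}. dist (L2_norm \<Omega> (c s - c t)) 0 < e"
      unfolding eventually_at using d(1)
      by (intro exI[of _ d]) (auto simp: dist_real_def fun_diff_def L2_norm_nonneg)
  qed auto
  have "AE x in lebesgue_on \<Omega>. c t x = v t x" if Pt: "P t" for t
  proof -
    have t: "t \<in> {0..T}" using P_D(1,2)[OF Pt] by simp
    have "L2_norm \<Omega> (\<lambda>x. v t x - c t x) \<le> e" if e: "e > 0" for e
      using c[OF t e] Pt by (fastforce intro: less_imp_le)
    then have "L2_norm \<Omega> (\<lambda>x. v t x - c t x) \<le> 0" by (rule nonpos_if_le_all_pos)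
    then have "L2_norm \<Omega> (\<lambda>x. v t x - c t x) = 0"
      using L2_norm_nonneg[of \<Omega> "\<lambda>x. v t x - c t x"] by simp
    from L2_norm_zero_AE[OF L2_diff[OF vL[OF Pt] cL[OF t]] this]
    show ?thesis by eventually_elim simp
  qed
  then have ae: "AE t in MT. AE x in lebesgue_on \<Omega>. c t x = v t x"
    using AE_P by (auto elim: eventually_mono)
  \<comment> \<open>The bound \<open>h n \<le> T / 2\<close> keeps the times picked near 0 to the
    left of those picked near \<open>T\<close>.\<close>
  define h where "h n = T / (real n + 2)" for n :: nat
  have h: "0 < h n" "h n \<le> T / 2" for n using T by (auto simp: h_def field_simps)
  have hlim: "h \<longlonglongrightarrow> 0"
  proof -
    have "(\<lambda>n. T * inverse (real (Suc (Suc n)))) \<longlonglongrightarrow> T * 0"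
      by (intro tendsto_intros LIMSEQ_Suc[OF LIMSEQ_inverse_real_of_nat])
    then show ?thesis by (simp add: h_def[abs_def] divide_inverse add.commute)
  qed
  have "\<forall>n. \<exists>r. 0 \<le> r \<and> r < h n \<and> P r" "\<forall>n. \<exists>r. T - h n \<le> r \<and> r < T \<and> P r"
    using AE_interval_exists[OF AE_P, of 0 "h n" for n] AE_interval_exists[OF AE_P, of "T - h n" T for n] h T
    by (auto simp: field_simps) (smt (verit) field_sum_of_halves)+
  then obtain s t where s: "\<And>n. 0 \<le> s n" "\<And>n. s n < h n" "\<And>n. P (s n)"
    and t: "\<And>n. T - h n \<le> t n" "\<And>n. t n < T" "\<And>n. P (t n)" by metis
  have st: "s n \<le> t n" for n using s(2)[of n] t(1)[of n] h(2)[of n] by simp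
  have slim: "s \<longlonglongrightarrow> 0"
    by (rule tendsto_sandwich[OF _ _ tendsto_const hlim]) (use s in \<open>auto intro!: always_eventually less_imp_le\<close>)
  have Th: "(\<lambda>n. T - h n) \<longlonglongrightarrow> T" using tendsto_diff[OF tendsto_const[of T] hlim] by simp
  have tlim: "t \<longlonglongrightarrow> T"
    by (rule tendsto_sandwich[OF always_eventually always_eventually Th tendsto_const])
       (use t in \<open>auto intro: less_imp_le\<close>)
  have mlim: "(\<lambda>n. m (p n)) \<longlonglongrightarrow> (L2_norm \<Omega> (c r))\<^sup>2" if p: "\<And>n. P (p n)" "p \<longlonglongrightarrow> r" and r: "r \<in> {0..T}" for p r
    unfolding m_def
  proof (intro tendsto_power H.tendsto_N[OF cL[OF r]])
    show "v (p n) \<in> L2 \<Omega>" for n by (rule vL[OF p(1)])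
    show "(\<lambda>n. L2_norm \<Omega> (v (p n) - c r)) \<longlonglongrightarrow> 0"
    proof (rule LIMSEQ_I)
      fix e :: real assume "e > 0"
      then obtain d where d: "d > 0" "\<And>s. P s \<Longrightarrow> \<bar>s - r\<bar> < d \<Longrightarrow> L2_norm \<Omega> (\<lambda>x. v s x - c r x) < e"
        using c[OF r] by blast
      obtain n0 where "\<And>n. n \<ge> n0 \<Longrightarrow> norm (p n - r) < d" using LIMSEQ_D[OF p(2) d(1)] by blast
      then show "\<exists>n0. \<forall>n\<ge>n0. norm (L2_norm \<Omega> (v (p n) - c r) - 0) < e"
        using d(2)[OF p(1)] by (intro exI[of _ n0]) (simp add: fun_diff_def L2_norm_nonneg)
    qed
  qed
  have K: "(\<lambda>n. tint T G 0 (p n)) \<longlonglongrightarrow> tint T G 0 r" if p: "\<And>n. P (p n)" "p \<longlonglongrightarrow> r" and r: "r \<in> {0..T}" for p r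
    by (rule continuous_on_tendsto_compose[OF tint_primitive_continuous[OF integrable_G T] p(2) r])
       (use P_D(1,2)[OF p(1)] in \<open>auto intro!: always_eventually less_imp_le\<close>)
  have r0: "0 \<in> {0..T}" "T \<in> {0..T}" using T by auto
  have "(\<lambda>n. m (t n) - m (s n)) \<longlonglongrightarrow> (L2_norm \<Omega> (c T))\<^sup>2 - (L2_norm \<Omega> (c 0))\<^sup>2"
    by (intro tendsto_diff mlim s(3) t(3) slim tlim r0)
  moreover have "m (t n) - m (s n) = 2 * (tint T G 0 (t n) - tint T G 0 (s n))" for n
    using energy[OF s(3) t(3) st, of n] tint_eq_primitive[OF integrable_G st, of n] by simp
  moreover have "(\<lambda>n. 2 * (tint T G 0 (t n) - tint T G 0 (s n))) \<longlonglongrightarrow> 2 * (tint T G 0 T - tint T G 0 0)"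
    by (intro tendsto_mult tendsto_const tendsto_diff K s(3) t(3) slim tlim r0)
  ultimately have "(L2_norm \<Omega> (c T))\<^sup>2 - (L2_norm \<Omega> (c 0))\<^sup>2 = 2 * (tint T G 0 T - tint T G 0 0)"
    by (auto dest: LIMSEQ_unique)
  also have "\<dots> = 2 * (LINT t|MT. \<xi> t (v t))" unfolding tint_full by (simp add: tint_def G_def[abs_def])
  finally show ?thesis using cont ae by blast
qed

end

section \<open>Integration by parts in time\<close>

context evolution
begin

lemma energy_times_exist: "\<exists>P. energy_times T \<Omega> \<Gamma>D v \<xi> P"
proof -
  obtain P where P: "AE t in MT. P t" "\<And>t. P t \<Longrightarrow> 0 < t \<and> t < T \<and> v t \<in> V_space \<Omega> \<Gamma>D"
    "\<And>s t \<tau>. P s \<Longrightarrow> P t \<Longrightarrow> P \<tau> \<Longrightarrow> s \<le> t \<Longrightarrow>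
       L2_ip \<Omega> (\<lambda>x. v t x - v s x) (v \<tau>) = tint T (\<lambda>r. \<xi> r (v \<tau>)) s t"
    using good_times_exist by blast
  interpret g: good_times T \<Omega> \<Gamma>D v \<xi> P by unfold_locales (use P in auto)
  obtain c where c: "AE t in MT. g.F t = c" using g.F_const by blast
  \<comment> \<open>Restricting to times where \<open>F\<close> takes its constant value turns the
    almost everywhere statement into an identity for every pair of good times.\<close>
  define P' where "P' t \<longleftrightarrow> P t \<and> g.F t = c" for t
  have "energy_times T \<Omega> \<Gamma>D v \<xi> P'"
  proof unfold_locales
    show "AE t in MT. P' t" using P(1) c by eventually_elim (simp add: P'_def)
    fix s t assume st: "P' s" "P' t" "s \<le> t"
    have "g.F s = g.F t" using st by (simp add: P'_def)
    then show "m t - m s = 2 * tint T G s t"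
      using tint_eq_primitive[OF integrable_G st(3)] by (simp add: g.F_def)
  qed (use P in \<open>auto simp: P'_def\<close>)
  then show ?thesis by (rule exI[of _ P'])
qed

theorem integration_by_parts:
  "\<exists>c. continuous_into_H T \<Omega> c \<and> (AE t in MT. AE x in lebesgue_on \<Omega>. c t x = v t x) \<and>
     (L2_norm \<Omega> (c T))\<^sup>2 - (L2_norm \<Omega> (c 0))\<^sup>2 = 2 * (LINT t|MT. \<xi> t (v t))"
proof -
  obtain P where "energy_times T \<Omega> \<Gamma>D v \<xi> P" using energy_times_exist by blast
  then interpret e: energy_times T \<Omega> \<Gamma>D v \<xi> P .
  show ?thesis by (rule e.continuous_representative)
qed

end


section \<open>The error identity\<close>

lemma proj_ball_nonexpansive:
  assumes "0 \<le> g"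
  shows "norm (proj_ball g a - proj_ball g b) \<le> norm (a - b :: 'a::euclidean_space)"
  unfolding proj_ball_def dist_norm[symmetric]
  by (rule closest_point_lipschitz) (use assms in auto)

lemma proj_ball_zero: "0 \<le> g \<Longrightarrow> proj_ball g (0 :: 'a::euclidean_space) = 0"
  unfolding proj_ball_def by (rule closest_point_self) simp

text \<open>The vector \<open>p\<close> is a subgradient of the convex function
  \<open>g * norm\<close> at \<open>a\<close>. Testing gives
  \<open>p \<bullet> a = g * norm a\<close> and \<open>norm p \<le> g\<close>, so
  \<open>z - p = \<nu> *\<^sub>R a\<close> is normal to the ball at \<open>p\<close>, which
  identifies \<open>p\<close> as the projection of \<open>z\<close>.\<close>

lemma subdiff_bingham_phi:
  fixes z a :: "'a::euclidean_space"
  assumes z: "z \<in> subdiff (bingham_phi \<nu> g) a" and \<nu>: "0 < \<nu>" and g: "0 < g"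
  shows "z - proj_ball g z = \<nu> *\<^sub>R a" and "proj_ball g z \<bullet> a = g * norm a"
proof -
  define p where "p = z - \<nu> *\<^sub>R a"
  text \<open>Letting the step size tend to \<open>0\<close> removes the quadratic part of the energy density.\<close>
  have p: "p \<bullet> d \<le> g * (norm (a + d) - norm a)" for d
  proof -
    \<comment> \<open>Convexity makes the increment of the norm at most linear in \<open>s\<close>;
      division by \<open>s\<close> leaves the quadratic part with one factor
      \<open>s\<close>.\<close>
    have step: "p \<bullet> d \<le> g * (norm (a + d) - norm a) + \<nu> / 2 * s * (norm d)\<^sup>2" if s: "0 < s" "s < 1" for s
    proof -
      have "bingham_phi \<nu> g a + z \<bullet> (s *\<^sub>R d) \<le> bingham_phi \<nu> g (a + s *\<^sub>R d)"
        using z unfolding subdiff_def by (auto dest!: spec[of _ "a + s *\<^sub>R d"])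
      moreover have "(norm (a + s *\<^sub>R d))\<^sup>2 = (norm a)\<^sup>2 + 2 * s * (a \<bullet> d) + s\<^sup>2 * (norm d)\<^sup>2"
        unfolding power2_norm_eq_inner
        by (simp add: inner_add_left inner_add_right inner_commute power2_eq_square)
      moreover have "norm (a + s *\<^sub>R d) \<le> (1 - s) * norm a + s * norm (a + d)"
      proof -
        have "a + s *\<^sub>R d = (1 - s) *\<^sub>R a + s *\<^sub>R (a + d)" by (simp add: algebra_simps)
        also have "norm \<dots> \<le> (1 - s) * norm a + s * norm (a + d)"
          by (rule order_trans[OF norm_triangle_ineq]) (use s in simp)
        finally show ?thesis .
      qed
      then have "g * norm (a + s *\<^sub>R d) \<le> g * ((1 - s) * norm a + s * norm (a + d))"
        using g by (simp add: mult_left_mono)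
      ultimately have "s * (z \<bullet> d) \<le> \<nu> / 2 * (2 * s * (a \<bullet> d) + s\<^sup>2 * (norm d)\<^sup>2) + g * (s * (norm (a + d) - norm a))"
        by (simp add: bingham_phi_def algebra_simps)
      also have "\<dots> = s * (\<nu> * (a \<bullet> d) + \<nu> / 2 * s * (norm d)\<^sup>2 + g * (norm (a + d) - norm a))"
        by (simp add: power2_eq_square algebra_simps)
      finally have "z \<bullet> d \<le> \<nu> * (a \<bullet> d) + \<nu> / 2 * s * (norm d)\<^sup>2 + g * (norm (a + d) - norm a)"
        using s(1) by (simp only: mult_le_cancel_left_pos)
      then show ?thesis by (simp add: p_def inner_diff_left)
    qed
    have "((\<lambda>s. g * (norm (a + d) - norm a) + \<nu> / 2 * s * (norm d)\<^sup>2) \<longlongrightarrow> g * (norm (a + d) - norm a) + \<nu> / 2 * 0 * (norm d)\<^sup>2) (at_right 0)"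
      by (intro tendsto_intros)
    then have "p \<bullet> d \<le> g * (norm (a + d) - norm a) + \<nu> / 2 * 0 * (norm d)\<^sup>2"
    proof (rule tendsto_lowerbound)
      show "\<forall>\<^sub>F s in at_right 0. p \<bullet> d \<le> g * (norm (a + d) - norm a) + \<nu> / 2 * s * (norm d)\<^sup>2"
        unfolding eventually_at_right_field using step by (intro exI[of _ 1]) auto
    qed simp
    then show ?thesis by simp
  qed
  have pa: "p \<bullet> a = g * norm a"
  proof (rule antisym)
    have "norm (a + a) = 2 * norm a" using norm_scaleR[of 2 a] by (simp add: scaleR_2)
    then show "p \<bullet> a \<le> g * norm a" using p[of a] by simp
    show "g * norm a \<le> p \<bullet> a" using p[of "- a"] by simp
  qed
  have pb: "p \<bullet> b \<le> g * norm b" for b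
  proof -
    have "p \<bullet> (b - a) \<le> g * (norm b - norm a)" using p[of "b - a"] by simp
    then show ?thesis using pa by (simp add: inner_diff_right right_diff_distrib)
  qed
  have "norm p * norm p \<le> g * norm p" using pb[of p] by (simp only: power2_norm_eq_inner[symmetric] power2_eq_square)
  then have np: "norm p \<le> g" using g by (cases "norm p = 0") (auto simp: mult_le_cancel_right)
  have "p = closest_point (cball 0 g) z"
  proof (rule closest_point_unique)
    show "p \<in> cball 0 g" using np by simp
    show "\<forall>b\<in>cball 0 g. dist z p \<le> dist z b"
    proof
      fix b :: 'a assume "b \<in> cball 0 g"
      then have "norm b \<le> g" by simp
      \<comment> \<open>The angle criterion for the nearest point: \<open>z - p\<close> makes no
        acute angle with any \<open>b - p\<close>.\<close>
      have "(z - p) \<bullet> (b - p) = \<nu> * (a \<bullet> b - g * norm a)"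
        using pa by (simp add: p_def inner_diff_right inner_commute algebra_simps)
      also have "a \<bullet> b - g * norm a \<le> 0"
        using norm_cauchy_schwarz[of a b] mult_left_mono[OF \<open>norm b \<le> g\<close>, of "norm a"] by (simp add: mult.commute)
      then have "\<nu> * (a \<bullet> b - g * norm a) \<le> 0" using \<nu> by (simp add: mult_le_0_iff)
      finally have le: "(z - p) \<bullet> (b - p) \<le> 0" .
      have "(norm (z - b))\<^sup>2 = (norm (z - p))\<^sup>2 - 2 * ((z - p) \<bullet> (b - p)) + (norm (b - p))\<^sup>2"
        by (simp add: power2_norm_eq_inner inner_diff_left inner_diff_right inner_commute)
      with le have "(norm (z - p))\<^sup>2 \<le> (norm (z - b))\<^sup>2" using zero_le_power2[of "norm (b - p)"] by linarith
      then show "dist z p \<le> dist z b" by (simp add: dist_norm)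
    qed
  qed (use np in auto)
  then have proj: "proj_ball g z = p" by (simp add: proj_ball_def)
  show "z - proj_ball g z = \<nu> *\<^sub>R a" unfolding proj by (simp add: p_def)
  show "proj_ball g z \<bullet> a = g * norm a" unfolding proj by (rule pa)
qed

text \<open>Everything except \<open>(y - z) \<bullet> (l - u)\<close> cancels pointwise.\<close>

lemma bingham_pointwise_identity:
  fixes y z l u :: "'a::euclidean_space"
  assumes z: "z - proj_ball g z = \<nu> *\<^sub>R u" "proj_ball g z \<bullet> u = g * norm u" and \<nu>: "0 < \<nu>"
  shows "1 / (2 * \<nu>) * (norm ((y - z) - (proj_ball g y - proj_ball g z)))\<^sup>2 + g * norm u - proj_ball g y \<bullet> u
     + \<nu> / 2 * (norm (l - u))\<^sup>2 - proj_ball g z \<bullet> l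
   = 1 / (2 * \<nu>) * (norm (y - proj_ball g y - \<nu> *\<^sub>R l))\<^sup>2 - proj_ball g y \<bullet> l + (y - z) \<bullet> (l - u)"
proof -
  define p where "p = y - proj_ball g y"
  define P where "P = proj_ball g y"
  define Z where "Z = proj_ball g z"
  have y: "y = p + P" by (simp add: p_def P_def)
  have zz: "z = Z + \<nu> *\<^sub>R u" using z(1) by (simp add: Z_def algebra_simps)
  have e1: "(y - z) - (P - Z) = p - \<nu> *\<^sub>R u" by (simp add: y zz)
  have e2: "y - P - \<nu> *\<^sub>R l = p - \<nu> *\<^sub>R l" by (simp add: y)
  have "1 / (2 * \<nu>) * (norm (p - \<nu> *\<^sub>R u))\<^sup>2 = 1 / (2 * \<nu>) * (p \<bullet> p) - p \<bullet> u + \<nu> / 2 * (u \<bullet> u)" for u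
    using \<nu> by (simp add: power2_norm_eq_inner inner_diff_left inner_diff_right inner_commute field_simps)
  note ex = this[of u] this[of l]
  show ?thesis
    unfolding P_def[symmetric] Z_def[symmetric] e1 e2 ex
    unfolding z(2)[folded Z_def, symmetric] y zz power2_norm_eq_inner
    by (simp add: inner_diff_left inner_diff_right inner_add_left inner_add_right inner_commute algebra_simps)
qed

section \<open>Differences of solutions and integrability over the cylinder\<close>

lemma continuous_into_H_diff:
  assumes c: "continuous_into_H T \<Omega> c" and c': "continuous_into_H T \<Omega> c'"
  shows "continuous_into_H T \<Omega> (\<lambda>t x. c t x - c' t x)"
  unfolding continuous_into_H_def
proof (intro ballI conjI)
  fix t assume t: "t \<in> {0..T}"
  note mem = continuous_into_H_D(1)[OF c] continuous_into_H_D(1)[OF c']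
  show "(\<lambda>x. c t x - c' t x) \<in> L2 \<Omega>" by (intro L2_diff mem t)
  have "((\<lambda>s. L2_norm \<Omega> (c s - c t) + L2_norm \<Omega> (c' s - c' t)) \<longlongrightarrow> 0 + 0) (at t within {0..T})"
    using c c' t by (intro tendsto_add) (auto simp: continuous_into_H_def)
  then have lim: "((\<lambda>s. L2_norm \<Omega> (c s - c t) + L2_norm \<Omega> (c' s - c' t)) \<longlongrightarrow> 0) (at t within {0..T})" by simp
  show "((\<lambda>s. L2_norm \<Omega> ((\<lambda>x. c s x - c' s x) - (\<lambda>x. c t x - c' t x))) \<longlongrightarrow> 0) (at t within {0..T})"
  proof (rule Lim_null_comparison[OF _ lim])
    have "\<forall>\<^sub>F s in at t within {0..T}. s \<in> {0..T}" by (simp add: eventually_at_filter)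
    then show "\<forall>\<^sub>F s in at t within {0..T}. norm (L2_norm \<Omega> ((\<lambda>x. c s x - c' s x) - (\<lambda>x. c t x - c' t x)))
        \<le> L2_norm \<Omega> (c s - c t) + L2_norm \<Omega> (c' s - c' t)"
    proof eventually_elim
      case (elim s)
      show ?case
        using fun_seminorm.diff_diff[OF fun_seminorm_L2 mem(1)[OF elim] mem(2)[OF elim] mem(1)[OF t] mem(2)[OF t]]
        by (simp add: fun_diff_def L2_norm_nonneg)
    qed
  qed
qed

lemma W_space_time_deriv:
  assumes "v \<in> W_space T \<Omega> \<Gamma>D"
  shows "has_time_derivative T \<Omega> \<Gamma>D v (time_deriv T \<Omega> \<Gamma>D v)"
proof -
  have "\<exists>\<xi>. has_time_derivative T \<Omega> \<Gamma>D v \<xi>" using assms by (simp add: W_space_def)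
  then show ?thesis unfolding time_deriv_def by (rule someI_ex)
qed

lemma continuous_rep_props:
  assumes "continuous_into_H T \<Omega> c \<and> (AE t in lebesgue_on {0<..<T}. AE x in lebesgue_on \<Omega>. c t x = v t x)"
  shows "continuous_into_H T \<Omega> (continuous_rep T \<Omega> v)"
    "AE t in lebesgue_on {0<..<T}. AE x in lebesgue_on \<Omega>. continuous_rep T \<Omega> v t x = v t x"
  using someI_ex[of "\<lambda>c. continuous_into_H T \<Omega> c \<and> (AE t in lebesgue_on {0<..<T}. AE x in lebesgue_on \<Omega>. c t x = v t x)"]
    assms unfolding continuous_rep_def by blast+

text \<open>Lets the difference of the two chosen derivatives serve as derivative of
  \<open>lam - u\<close>, without comparing it to the choice that \<open>time_deriv\<close> makes
  for that function.\<close>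

lemma has_time_derivative_diff:
  assumes bo: "bounded \<Omega>" "open \<Omega>"
    and v: "has_time_derivative T \<Omega> \<Gamma>D v \<xi>" and w: "has_time_derivative T \<Omega> \<Gamma>D w \<eta>"
  shows "has_time_derivative T \<Omega> \<Gamma>D (\<lambda>t x. v t x - w t x) (\<lambda>t p. \<xi> t p - \<eta> t p)"
  unfolding has_time_derivative_def
proof (intro conjI ballI)
  let ?M = "lebesgue_on {0<..<T}"
  interpret H: fun_seminorm "L2 \<Omega> :: ('a \<Rightarrow> real) set" "L2_norm \<Omega>" by (rule fun_seminorm_L2)
  interpret HH: fun_pairing "L2 \<Omega> :: ('a \<Rightarrow> real) set" "L2_norm \<Omega>" "L2 \<Omega> :: ('a \<Rightarrow> real) set" "L2_norm \<Omega>" "L2_ip \<Omega>"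
    by (rule fun_pairing_L2)
  interpret V: fun_seminorm "V_space \<Omega> \<Gamma>D" "V_norm \<Omega>" by (rule fun_seminorm_V[OF bo])
  interpret D: fun_seminorm "V_dual \<Omega> \<Gamma>D" "V_dual_norm \<Omega> \<Gamma>D" by (rule fun_seminorm_V_dual[OF bo])
  interpret DV: fun_pairing "V_dual \<Omega> \<Gamma>D" "V_dual_norm \<Omega> \<Gamma>D" "V_space \<Omega> \<Gamma>D" "V_norm \<Omega>" "\<lambda>\<zeta> v. \<zeta> v"
    by (rule fun_pairing_V[OF bo])
  have vH: "v \<in> L2_H T \<Omega>" "w \<in> L2_H T \<Omega>" and xi: "\<xi> \<in> L2_V_dual T \<Omega> \<Gamma>D" "\<eta> \<in> L2_V_dual T \<Omega> \<Gamma>D"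
    using v w by (auto simp: has_time_derivative_def)
  show "(\<lambda>t x. v t x - w t x) \<in> L2_H T \<Omega>" by (rule H.bochner_diff[OF vH])
  show "(\<lambda>t p. \<xi> t p - \<eta> t p) \<in> L2_V_dual T \<Omega> \<Gamma>D" by (rule D.bochner_diff[OF xi])
  fix \<theta> p assume th: "\<theta> \<in> test_functions {0<..<T}" and p: "p \<in> V_space \<Omega> \<Gamma>D"
  have pL: "p \<in> L2 \<Omega>" by (rule V_space_L2[OF p])
  have i1: "integrable ?M (\<lambda>t. L2_ip \<Omega> (v t) p)" "integrable ?M (\<lambda>t. L2_ip \<Omega> (w t) p)"
    by (intro HH.pairing_integrable vH H.bochner_const[OF pL])+
  have i2: "integrable ?M (\<lambda>t. \<xi> t p)" "integrable ?M (\<lambda>t. \<eta> t p)"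
    by (intro DV.pairing_integrable xi V.bochner_const[OF p])+
  have j1: "integrable ?M (\<lambda>t. deriv \<theta> t * L2_ip \<Omega> (v t) p)" "integrable ?M (\<lambda>t. deriv \<theta> t * L2_ip \<Omega> (w t) p)"
    using integrable_mult_test[OF i1(1) test_deriv[OF th]] integrable_mult_test[OF i1(2) test_deriv[OF th]]
    by (simp_all add: mult.commute)
  have j2: "integrable ?M (\<lambda>t. \<theta> t * \<xi> t p)" "integrable ?M (\<lambda>t. \<theta> t * \<eta> t p)"
    using integrable_mult_test[OF i2(1) th] integrable_mult_test[OF i2(2) th] by (simp_all add: mult.commute)
  have id: "(LINT x|lebesgue_on \<Omega>. q x * p x) = L2_ip \<Omega> q p" for q by (simp add: L2_ip_def)
  have i3: "integrable ?M (\<lambda>t. L2_ip \<Omega> (\<lambda>x. v t x - w t x) p)"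
    by (rule HH.pairing_integrable[OF H.bochner_diff[OF vH] H.bochner_const[OF pL]])
  have "(LINT t|?M. deriv \<theta> t * L2_ip \<Omega> (\<lambda>x. v t x - w t x) p)
      = (LINT t|?M. deriv \<theta> t * L2_ip \<Omega> (v t) p - deriv \<theta> t * L2_ip \<Omega> (w t) p)"
  proof (rule integral_cong_AE)
    show "AE t in ?M. deriv \<theta> t * L2_ip \<Omega> (\<lambda>x. v t x - w t x) p = deriv \<theta> t * L2_ip \<Omega> (v t) p - deriv \<theta> t * L2_ip \<Omega> (w t) p"
      using bochner_L2_D(1)[OF vH(1)] bochner_L2_D(1)[OF vH(2)]
      by eventually_elim (simp add: L2_ip_diff_left pL right_diff_distrib)
    show "(\<lambda>t. deriv \<theta> t * L2_ip \<Omega> (\<lambda>x. v t x - w t x) p) \<in> borel_measurable ?M"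
      using integrable_mult_test[OF i3 test_deriv[OF th]] by (simp add: mult.commute borel_measurable_integrable)
  qed (use j1 in auto)
  also have "\<dots> = (LINT t|?M. deriv \<theta> t * L2_ip \<Omega> (v t) p) - (LINT t|?M. deriv \<theta> t * L2_ip \<Omega> (w t) p)"
    by (rule Bochner_Integration.integral_diff[OF j1])
  also have "\<dots> = - (LINT t|?M. \<theta> t * \<xi> t p) + (LINT t|?M. \<theta> t * \<eta> t p)"
  proof -
    have "(LINT t|?M. deriv \<theta> t * (LINT x|lebesgue_on \<Omega>. v t x * p x)) = - (LINT t|?M. \<theta> t * \<xi> t p)"
      "(LINT t|?M. deriv \<theta> t * (LINT x|lebesgue_on \<Omega>. w t x * p x)) = - (LINT t|?M. \<theta> t * \<eta> t p)"
      using v w th p by (simp_all add: has_time_derivative_def)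
    then show ?thesis unfolding id by simp
  qed
  also have "\<dots> = - (LINT t|?M. \<theta> t * (\<xi> t p - \<eta> t p))"
    using j2 by (simp add: right_diff_distrib)
  finally show "(LINT t|?M. deriv \<theta> t * (LINT x|lebesgue_on \<Omega>. (v t x - w t x) * p x)) = - (LINT t|?M. \<theta> t * (\<xi> t p - \<eta> t p))"
    by (simp add: id)
qed


lemma L2_Y_integrable_sq:
  assumes "w \<in> bochner_L2 T (L2 \<Omega>) (L2_norm \<Omega>)"
  shows "integrable (lebesgue_on {0<..<T}) (\<lambda>t. LINT x|lebesgue_on \<Omega>. (norm (w t x))\<^sup>2)"
  using bochner_L2_D(3)[OF assms] by (simp add: L2_norm_sq)

lemma L2_Y_integrable_inner:
  assumes "w \<in> bochner_L2 T (L2 \<Omega>) (L2_norm \<Omega>)" "p \<in> bochner_L2 T (L2 \<Omega>) (L2_norm \<Omega>)"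
  shows "integrable (lebesgue_on {0<..<T}) (\<lambda>t. LINT x|lebesgue_on \<Omega>. w t x \<bullet> p t x)"
  using fun_pairing.pairing_integrable[OF fun_pairing_L2 assms] by (simp add: L2_ip_def)

lemma L2_Y_lipschitz:
  fixes F :: "'b::euclidean_space \<Rightarrow> 'c::euclidean_space" and w :: "real \<Rightarrow> 'a::euclidean_space \<Rightarrow> 'b"
  assumes F: "\<And>a b. norm (F a - F b) \<le> norm (a - b)" and F0: "F 0 = 0"
    and w: "w \<in> bochner_L2 T (L2 \<Omega>) (L2_norm \<Omega>)"
  shows "(\<lambda>t x. F (w t x)) \<in> bochner_L2 T (L2 \<Omega>) (L2_norm \<Omega>)"
proof (rule fun_seminorm.bochner_image[OF fun_seminorm_L2 w fun_seminorm_L2, where F = "\<lambda>p x. F (p x)" and K = 1])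
  fix p q :: "'a \<Rightarrow> 'b" assume pq: "p \<in> L2 \<Omega>" "q \<in> L2 \<Omega>"
  show "(\<lambda>x. F (p x)) \<in> L2 \<Omega>" by (rule L2_lipschitz[of F, OF F F0 pq(1)])
  show "L2_norm \<Omega> (\<lambda>x. F (p x) - F (q x)) \<le> 1 * L2_norm \<Omega> (\<lambda>x. p x - q x)"
    using L2_norm_lipschitz[of F, OF F F0 pq] by simp
  show "L2_norm \<Omega> (\<lambda>x. F (p x)) \<le> 1 * L2_norm \<Omega> p"
    using L2_norm_lipschitz[of F, OF F F0 pq(1) L2_zero] by (simp add: F0)
qed

lemma L2_Y_scale:
  fixes w :: "real \<Rightarrow> 'a::euclidean_space \<Rightarrow> 'b::euclidean_space"
  assumes "w \<in> bochner_L2 T (L2 \<Omega>) (L2_norm \<Omega>)"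
  shows "(\<lambda>t x. c *\<^sub>R w t x) \<in> bochner_L2 T (L2 \<Omega>) (L2_norm \<Omega>)"
proof (rule fun_seminorm.bochner_image[OF fun_seminorm_L2 assms fun_seminorm_L2, where F = "\<lambda>p x. c *\<^sub>R p x" and K = "\<bar>c\<bar>"])
  fix p q :: "'a \<Rightarrow> 'b" assume "p \<in> L2 \<Omega>" "q \<in> L2 \<Omega>"
  show "L2_norm \<Omega> (\<lambda>x. c *\<^sub>R p x - c *\<^sub>R q x) \<le> \<bar>c\<bar> * L2_norm \<Omega> (\<lambda>x. p x - q x)"
    unfolding scaleR_diff_right[symmetric] L2_norm_scale ..
qed (auto intro: L2_scale simp: L2_norm_scale)

lemma L2_Y_grad:
  assumes bo: "bounded \<Omega>" "open \<Omega>" and v: "v \<in> L2_V T \<Omega> \<Gamma>D"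
  shows "(\<lambda>t. grad \<Omega> (v t)) \<in> L2_Y T \<Omega>"
proof (rule fun_seminorm.bochner_image[OF fun_seminorm_V[OF bo] v fun_seminorm_L2, where K = 1])
  fix p q assume pq: "p \<in> V_space \<Omega> \<Gamma>D" "q \<in> V_space \<Omega> \<Gamma>D"
  show "grad \<Omega> p \<in> L2 \<Omega>" by (rule W12_L2(2)[OF V_space_W12[OF pq(1)]])
  show "L2_norm \<Omega> (grad \<Omega> p) \<le> 1 * V_norm \<Omega> p" by (simp add: V_norm_def)
  show "L2_norm \<Omega> (\<lambda>x. grad \<Omega> p x - grad \<Omega> q x) \<le> 1 * V_norm \<Omega> (\<lambda>x. p x - q x)"
    by (simp add: V_norm_diff[OF bo pq[THEN V_space_W12]])
qed

lemma norm_Q_sq: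
  "(norm_Q T \<Omega> w)\<^sup>2 = (LINT t|lebesgue_on {0<..<T}. LINT x|lebesgue_on \<Omega>. (norm (w t x))\<^sup>2)"
  unfolding norm_Q_def by (intro real_sqrt_pow2 Bochner_Integration.integral_nonneg) auto

theorem lemma5p8:
  fixes \<Omega> \<Gamma>D \<Gamma>N :: "'a::euclidean_space set"
    and T \<nu> g :: real
    and f :: "real \<Rightarrow> 'a functional"
    and u0 :: "'a \<Rightarrow> real"
    and u lam :: "real \<Rightarrow> 'a \<Rightarrow> real"
    and z y :: "real \<Rightarrow> 'a \<Rightarrow> 'a"
  assumes "bounded \<Omega>" and "lipschitz_domain \<Omega>"
    and "boundary_split \<Omega> \<Gamma>D \<Gamma>N" and "\<Gamma>D \<noteq> {}"
    and "0 < T" and "0 < \<nu>" and "0 < g"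
    and "f \<in> L2_V_dual T \<Omega> \<Gamma>D" and "u0 \<in> L2 \<Omega>"
    and "bingham_solution T \<Omega> \<Gamma>D \<nu> g f u0 u"
    and "dual_flux T \<Omega> \<Gamma>D \<nu> g f u z"
    and "y \<in> L2_Y T \<Omega>" and "lam \<in> W_space T \<Omega> \<Gamma>D"
    and "AE t in lebesgue_on {0<..<T}.
           eq_V_dual \<Omega> \<Gamma>D (weak_div \<Omega> (y t)) (\<lambda>w. time_deriv T \<Omega> \<Gamma>D lam t w - f t w)"
  shows "1 / (2 * \<nu>) *
           (norm_Q T \<Omega> (\<lambda>t x. (y t x - z t x) - (proj_ball g (y t x) - proj_ball g (z t x))))\<^sup>2
       + (g * norm1_Q T \<Omega> (\<lambda>t. grad \<Omega> (u t))
          - inner_Q T \<Omega> (\<lambda>t x. proj_ball g (y t x)) (\<lambda>t. grad \<Omega> (u t)))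
       + \<nu> / 2 * (norm_Q T \<Omega> (\<lambda>t. grad \<Omega> (\<lambda>x. lam t x - u t x)))\<^sup>2
       + (g * norm1_Q T \<Omega> (\<lambda>t. grad \<Omega> (lam t))
          - inner_Q T \<Omega> (\<lambda>t x. proj_ball g (z t x)) (\<lambda>t. grad \<Omega> (lam t)))
       + 1 / 2 * (L2_norm \<Omega> (continuous_rep T \<Omega> (\<lambda>t x. lam t x - u t x) T))\<^sup>2
     = 1 / (2 * \<nu>) *
           (norm_Q T \<Omega> (\<lambda>t x. y t x - proj_ball g (y t x) - \<nu> *\<^sub>R grad \<Omega> (lam t) x))\<^sup>2
       + (g * norm1_Q T \<Omega> (\<lambda>t. grad \<Omega> (lam t))
          - inner_Q T \<Omega> (\<lambda>t x. proj_ball g (y t x)) (\<lambda>t. grad \<Omega> (lam t)))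
       + 1 / 2 * (L2_norm \<Omega> (\<lambda>x. continuous_rep T \<Omega> lam 0 x - u0 x))\<^sup>2"
proof -
  define M where "M = lebesgue_on {0<..<T}"
  define N where "N = lebesgue_on \<Omega>"
  have bo: "bounded \<Omega>" "open \<Omega>" using assms(1,2) by (auto simp: lipschitz_domain_def)
  have g0: "0 \<le> g" using assms(7) by simp
  have uW: "u \<in> W_space T \<Omega> \<Gamma>D" using assms(10) by (simp add: bingham_solution_def)
  note lW = assms(13)
  have uV: "u \<in> L2_V T \<Omega> \<Gamma>D" and lV: "lam \<in> L2_V T \<Omega> \<Gamma>D" using uW lW by (auto simp: W_space_def)
  define \<xi>u \<xi>l where "\<xi>u = time_deriv T \<Omega> \<Gamma>D u" and "\<xi>l = time_deriv T \<Omega> \<Gamma>D lam"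
  have tdu: "has_time_derivative T \<Omega> \<Gamma>D u \<xi>u" and tdl: "has_time_derivative T \<Omega> \<Gamma>D lam \<xi>l"
    using W_space_time_deriv[OF uW] W_space_time_deriv[OF lW] by (simp_all add: \<xi>u_def \<xi>l_def)
  define e where "e t x = lam t x - u t x" for t x
  define \<xi> where "\<xi> t p = \<xi>l t p - \<xi>u t p" for t p
  have eV: "e \<in> L2_V T \<Omega> \<Gamma>D"
    unfolding e_def[abs_def] by (rule fun_seminorm.bochner_diff[OF fun_seminorm_V[OF bo] lV uV])
  have tde: "has_time_derivative T \<Omega> \<Gamma>D e \<xi>"
    unfolding e_def[abs_def] \<xi>_def[abs_def] by (rule has_time_derivative_diff[OF bo tdl tdu])
  have ev: "evolution T \<Omega> \<Gamma>D u \<xi>u" "evolution T \<Omega> \<Gamma>D lam \<xi>l" "evolution T \<Omega> \<Gamma>D e \<xi>"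
    by (unfold_locales; fact bo assms(5) uV tdu lV tdl eV tde)+
  \<comment> \<open>For \<open>u\<close> and \<open>lam\<close> only the existence of a continuous
    representative is taken; the energy identity is applied to the difference
    \<open>e\<close>.\<close>
  obtain cu where cu: "continuous_into_H T \<Omega> cu \<and> (AE t in M. AE x in N. cu t x = u t x)"
    using evolution.integration_by_parts[OF ev(1)] unfolding M_def N_def by blast
  obtain cl where cl: "continuous_into_H T \<Omega> cl \<and> (AE t in M. AE x in N. cl t x = lam t x)"
    using evolution.integration_by_parts[OF ev(2)] unfolding M_def N_def by blast
  obtain ce where ce: "continuous_into_H T \<Omega> ce \<and> (AE t in M. AE x in N. ce t x = e t x)"
    "(L2_norm \<Omega> (ce T))\<^sup>2 - (L2_norm \<Omega> (ce 0))\<^sup>2 = 2 * (LINT t|M. \<xi> t (e t))"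
    using evolution.integration_by_parts[OF ev(3)] unfolding M_def N_def by blast
  note ru = continuous_rep_props[OF cu[unfolded M_def N_def]]
  note rl = continuous_rep_props[OF cl[unfolded M_def N_def]]
  note re = continuous_rep_props[OF ce(1)[unfolded M_def N_def]]
  have T0: "0 \<in> {0..T}" "T \<in> {0..T}" using assms(5) by auto
  have endT: "L2_norm \<Omega> (continuous_rep T \<Omega> e T) = L2_norm \<Omega> (ce T)"
  proof -
    have "AE t in lebesgue_on {0<..<T}. AE x in lebesgue_on \<Omega>. continuous_rep T \<Omega> e t x = ce t x"
      using re(2) ce(1)[unfolded M_def N_def, THEN conjunct2]
    proof eventually_elim
      case (elim t)
      then show ?case by eventually_elim simp
    qed
    from continuous_rep_unique[OF re(1) conjunct1[OF ce(1)] assms(5) this T0(2)]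
    show ?thesis
      using L2_norm_le_diff[OF continuous_into_H_D(1)[OF re(1) T0(2)] continuous_into_H_D(1)[OF conjunct1[OF ce(1)] T0(2)]]
      by simp
  qed
  \<comment> \<open>At time 0 the difference of the chosen representatives of \<open>lam\<close> and
    \<open>u\<close> is compared with \<open>ce\<close>; the initial condition of \<open>u\<close>
    brings in \<open>u0\<close>.\<close>
  have end0: "L2_norm \<Omega> (\<lambda>x. continuous_rep T \<Omega> lam 0 x - u0 x) = L2_norm \<Omega> (ce 0)"
  proof -
    let ?d = "\<lambda>t x. continuous_rep T \<Omega> lam t x - continuous_rep T \<Omega> u t x"
    note dc = continuous_into_H_diff[OF rl(1) ru(1)]
    have "AE t in lebesgue_on {0<..<T}. AE x in lebesgue_on \<Omega>. ?d t x = ce t x"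
      using rl(2) ru(2) ce(1)[unfolded M_def N_def, THEN conjunct2]
    proof eventually_elim
      case (elim t)
      then show ?case by eventually_elim (simp add: e_def)
    qed
    from continuous_rep_unique[OF dc conjunct1[OF ce(1)] assms(5) this T0(1)]
    have "L2_norm \<Omega> (?d 0) = L2_norm \<Omega> (ce 0)"
      using L2_norm_le_diff[OF continuous_into_H_D(1)[OF dc T0(1)] continuous_into_H_D(1)[OF conjunct1[OF ce(1)] T0(1)]]
      by simp
    moreover have "L2_norm \<Omega> (\<lambda>x. continuous_rep T \<Omega> lam 0 x - u0 x) = L2_norm \<Omega> (?d 0)"
    proof (rule L2_norm_cong_AE)
      have "AE x in lebesgue_on \<Omega>. continuous_rep T \<Omega> u 0 x = u0 x"
        using assms(10) by (simp add: bingham_solution_def)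
      then show "AE x in lebesgue_on \<Omega>. continuous_rep T \<Omega> lam 0 x - u0 x = ?d 0 x"
        by eventually_elim simp
      show "(\<lambda>x. continuous_rep T \<Omega> lam 0 x - u0 x) \<in> L2 \<Omega>"
        by (intro L2_diff continuous_into_H_D(1)[OF rl(1) T0(1)] assms(9))
      show "?d 0 \<in> L2 \<Omega>" by (rule continuous_into_H_D(1)[OF dc T0(1)])
    qed
    ultimately show ?thesis by simp
  qed
  define U where "U t = grad \<Omega> (u t)" for t
  define L where "L t = grad \<Omega> (lam t)" for t
  define PY where "PY t x = proj_ball g (y t x)" for t x
  define PZ where "PZ t x = proj_ball g (z t x)" for t x
  note yY = assms(12)
  have zY: "z \<in> L2_Y T \<Omega>" using assms(11) by (simp add: dual_flux_def)
  have UY: "U \<in> L2_Y T \<Omega>" and LY: "L \<in> L2_Y T \<Omega>"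
    unfolding U_def[abs_def] L_def[abs_def] by (rule L2_Y_grad[OF bo uV], rule L2_Y_grad[OF bo lV])
  have PYY: "PY \<in> L2_Y T \<Omega>" and PZY: "PZ \<in> L2_Y T \<Omega>"
    unfolding PY_def[abs_def] PZ_def[abs_def]
    by (rule L2_Y_lipschitz[OF proj_ball_nonexpansive[OF g0] proj_ball_zero[OF g0] yY],
        rule L2_Y_lipschitz[OF proj_ball_nonexpansive[OF g0] proj_ball_zero[OF g0] zY])
  note diffY = fun_seminorm.bochner_diff[OF fun_seminorm_L2]
  \<comment> \<open>Integrability comes from pairing \<open>norm (w t x)\<close> with the constant
    1, which is square-integrable on a bounded domain.\<close>
  have normY: "integrable M (\<lambda>t. LINT x|N. norm (w t x))" if w: "w \<in> L2_Y T \<Omega>" for w :: "real \<Rightarrow> 'a \<Rightarrow> 'a"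
  proof -
    have nw: "(\<lambda>t x. norm (w t x)) \<in> L2_H T \<Omega>"
      by (rule L2_Y_lipschitz[of norm, OF _ _ w]) (auto intro: norm_triangle_ineq3)
    show ?thesis
      using L2_Y_integrable_inner[OF nw fun_seminorm.bochner_const[OF fun_seminorm_L2 L2_const[OF bo, of 1]]]
      by (simp add: M_def N_def)
  qed
  define A1 where "A1 t = (LINT x|N. (norm ((y t x - z t x) - (PY t x - PZ t x)))\<^sup>2)" for t
  define A2 where "A2 t = (LINT x|N. norm (U t x))" for t
  define A3 where "A3 t = (LINT x|N. PY t x \<bullet> U t x)" for t
  define A4 where "A4 t = (LINT x|N. (norm (grad \<Omega> (\<lambda>x. lam t x - u t x) x))\<^sup>2)" for t
  define A5 where "A5 t = (LINT x|N. norm (L t x))" for t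
  define A6 where "A6 t = (LINT x|N. PZ t x \<bullet> L t x)" for t
  define B1 where "B1 t = (LINT x|N. (norm (y t x - PY t x - \<nu> *\<^sub>R L t x))\<^sup>2)" for t
  define B3 where "B3 t = (LINT x|N. PY t x \<bullet> L t x)" for t
  have iA1: "integrable M A1"
    unfolding A1_def[abs_def] M_def N_def
    by (rule L2_Y_integrable_sq[OF diffY[OF diffY[OF yY zY] diffY[OF PYY PZY]]])
  have iB1: "integrable M B1"
    unfolding B1_def[abs_def] M_def N_def
    by (rule L2_Y_integrable_sq[OF diffY[OF diffY[OF yY PYY] L2_Y_scale[OF LY]]])
  have iA2: "integrable M A2" and iA5: "integrable M A5"
    unfolding A2_def[abs_def] A5_def[abs_def] by (rule normY[OF UY], rule normY[OF LY])
  have iA3: "integrable M A3" and iA6: "integrable M A6" and iB3: "integrable M B3"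
    unfolding A3_def[abs_def] A6_def[abs_def] B3_def[abs_def] M_def N_def
    by (rule L2_Y_integrable_inner[OF PYY UY], rule L2_Y_integrable_inner[OF PZY LY], rule L2_Y_integrable_inner[OF PYY LY])
  have iA4: "integrable M A4"
    using L2_Y_integrable_sq[OF L2_Y_grad[OF bo eV]] by (simp add: A4_def[abs_def] M_def N_def e_def[abs_def])
  have ixi: "integrable M (\<lambda>t. \<xi> t (e t))"
    using fun_pairing.pairing_integrable[OF fun_pairing_V[OF bo] _ eV, of \<xi>] tde
    by (simp add: has_time_derivative_def M_def)
  \<comment> \<open>The term with \<open>norm (L t x)\<close> occurs on both sides of the claim and
    is left out here.\<close>
  have main: "AE t in M. 1 / (2 * \<nu>) * A1 t + g * A2 t - A3 t + \<nu> / 2 * A4 t - A6 t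
      = 1 / (2 * \<nu>) * B1 t - B3 t - \<xi> t (e t)"
  proof -
    have flux: "AE t in M. AE x in N. z t x \<in> subdiff (bingham_phi \<nu> g) (grad \<Omega> (u t) x)"
      using assms(11) unfolding dual_flux_def M_def N_def by (elim conjE)
    have equ: "AE t in M. eq_V_dual \<Omega> \<Gamma>D (\<lambda>w. \<xi>u t w + L_adj \<Omega> (z t) w) (f t)"
      using assms(11) unfolding dual_flux_def M_def \<xi>u_def by (elim conjE)
    have eql: "AE t in M. eq_V_dual \<Omega> \<Gamma>D (weak_div \<Omega> (y t)) (\<lambda>w. \<xi>l t w - f t w)"
      using assms(14) unfolding M_def \<xi>l_def .
    have memV: "AE t in M. u t \<in> V_space \<Omega> \<Gamma>D" "AE t in M. lam t \<in> V_space \<Omega> \<Gamma>D"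
      and memY: "AE t in M. y t \<in> L2 \<Omega>" "AE t in M. z t \<in> L2 \<Omega>" "AE t in M. PY t \<in> L2 \<Omega>" "AE t in M. PZ t \<in> L2 \<Omega>"
      unfolding M_def by (fact bochner_L2_D(1)[OF uV] bochner_L2_D(1)[OF lV] bochner_L2_D(1)[OF yY]
        bochner_L2_D(1)[OF zY] bochner_L2_D(1)[OF PYY] bochner_L2_D(1)[OF PZY])+
    from flux equ eql memV memY show ?thesis
    proof eventually_elim
      case (elim t)
      have W: "u t \<in> W12 \<Omega>" "lam t \<in> W12 \<Omega>" using elim(4,5) V_space_W12 by auto
      have UL: "U t \<in> L2 \<Omega>" "L t \<in> L2 \<Omega>" unfolding U_def L_def by (rule W12_L2(2)[OF W(1)], rule W12_L2(2)[OF W(2)])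
      have et: "e t \<in> V_space \<Omega> \<Gamma>D" unfolding e_def[abs_def] by (rule V_space_diff[OF bo elim(5,4)])
      have ge: "AE x in N. grad \<Omega> (e t) x = L t x - U t x"
        unfolding N_def e_def[abs_def] L_def U_def by (rule grad_diff[OF bo W(2,1)])
      have geL: "grad \<Omega> (e t) \<in> L2 \<Omega>" by (rule W12_L2(2)[OF V_space_W12[OF et]])
      note yL = elim(6) and zL = elim(7) and PYL = elim(8) and PZL = elim(9)
      note inn = L2_integrable_inner[where \<Omega> = \<Omega>, folded N_def]
      have sq: "integrable N (\<lambda>x. (norm (w x))\<^sup>2)" if "w \<in> L2 \<Omega>" for w :: "'a \<Rightarrow> 'a"
        unfolding N_def by (rule L2_D(2)[OF that])
      have nrm: "integrable N (\<lambda>x. norm (w x))" if "w \<in> L2 \<Omega>" for w :: "'a \<Rightarrow> 'a"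
      proof -
        have "(\<lambda>x. norm (w x)) \<in> L2 \<Omega>"
          by (rule L2_lipschitz[of norm, OF _ _ that]) (auto intro: norm_triangle_ineq3)
        from L2_integrable[OF bo this] show ?thesis by (simp add: N_def)
      qed
      have yz: "(\<lambda>x. y t x - z t x) \<in> L2 \<Omega>" by (rule L2_diff[OF yL zL])
      have lu: "(\<lambda>x. L t x - U t x) \<in> L2 \<Omega>" by (rule L2_diff[OF UL(2,1)])
      have a1: "integrable N (\<lambda>x. (norm ((y t x - z t x) - (PY t x - PZ t x)))\<^sup>2)"
        by (rule sq[OF L2_diff[OF yz L2_diff[OF PYL PZL]]])
      have a2: "integrable N (\<lambda>x. norm (U t x))" by (rule nrm[OF UL(1)])
      have a3: "integrable N (\<lambda>x. PY t x \<bullet> U t x)" by (rule inn[OF PYL UL(1)])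
      have a4: "integrable N (\<lambda>x. (norm (L t x - U t x))\<^sup>2)" by (rule sq[OF lu])
      have a6: "integrable N (\<lambda>x. PZ t x \<bullet> L t x)" by (rule inn[OF PZL UL(2)])
      have b1: "integrable N (\<lambda>x. (norm (y t x - PY t x - \<nu> *\<^sub>R L t x))\<^sup>2)"
        by (rule sq[OF L2_diff[OF L2_diff[OF yL PYL] L2_scale[OF UL(2)]]])
      have b3: "integrable N (\<lambda>x. PY t x \<bullet> L t x)" by (rule inn[OF PYL UL(2)])
      have c1: "integrable N (\<lambda>x. (y t x - z t x) \<bullet> (L t x - U t x))" by (rule inn[OF yz lu])
      \<comment> \<open>The gradient of the difference splits only almost everywhere, which the norm
        does not see.\<close>
      have A4: "A4 t = (LINT x|N. (norm (L t x - U t x))\<^sup>2)"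
      proof -
        have "(L2_norm \<Omega> (grad \<Omega> (e t)))\<^sup>2 = (L2_norm \<Omega> (\<lambda>x. L t x - U t x))\<^sup>2"
          using L2_norm_cong_AE[OF ge[unfolded N_def] geL lu] by simp
        then show ?thesis by (simp add: L2_norm_sq A4_def N_def e_def[abs_def])
      qed
      let ?lhs = "\<lambda>x. 1 / (2 * \<nu>) * (norm ((y t x - z t x) - (PY t x - PZ t x)))\<^sup>2 + g * norm (U t x) - PY t x \<bullet> U t x
         + \<nu> / 2 * (norm (L t x - U t x))\<^sup>2 - PZ t x \<bullet> L t x"
      let ?rhs = "\<lambda>x. 1 / (2 * \<nu>) * (norm (y t x - PY t x - \<nu> *\<^sub>R L t x))\<^sup>2 - PY t x \<bullet> L t x + (y t x - z t x) \<bullet> (L t x - U t x)"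
      have "(LINT x|N. ?lhs x) = (LINT x|N. ?rhs x)"
      proof (rule integral_cong_AE)
        show "AE x in N. ?lhs x = ?rhs x"
          using elim(1)
        proof eventually_elim
          case (elim x)
          note s = subdiff_bingham_phi[OF elim assms(6,7)]
          show ?case
            using bingham_pointwise_identity[OF s assms(6), of "y t x" "L t x"]
            by (simp only: PY_def PZ_def U_def)
        qed
        show "?lhs \<in> borel_measurable N"
          using a1 a2 a3 a4 a6 by (intro borel_measurable_integrable Bochner_Integration.integrable_add
            Bochner_Integration.integrable_diff integrable_mult_right)
        show "?rhs \<in> borel_measurable N"
          using b1 b3 c1 by (intro borel_measurable_integrable Bochner_Integration.integrable_add
            Bochner_Integration.integrable_diff integrable_mult_right)
      qed
      moreover have "(LINT x|N. ?lhs x) = 1 / (2 * \<nu>) * A1 t + g * A2 t - A3 t + \<nu> / 2 * A4 t - A6 t"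
        unfolding A1_def A2_def A3_def A4 A6_def
        using a1 a2 a3 a4 a6 by (simp add: Bochner_Integration.integral_add Bochner_Integration.integral_diff)
      moreover have "(LINT x|N. ?rhs x) = 1 / (2 * \<nu>) * B1 t - B3 t + (LINT x|N. (y t x - z t x) \<bullet> (L t x - U t x))"
        unfolding B1_def B3_def
        using b1 b3 c1 by (simp add: Bochner_Integration.integral_add Bochner_Integration.integral_diff)
      \<comment> \<open>Both constraints are tested with \<open>e t\<close>; the load
        \<open>f t\<close> drops out when they are combined.\<close>
      moreover have "(LINT x|N. (y t x - z t x) \<bullet> (L t x - U t x)) = - \<xi> t (e t)"
      proof -
        have "(LINT x|N. (y t x - z t x) \<bullet> (L t x - U t x)) = L2_ip \<Omega> (\<lambda>x. y t x - z t x) (grad \<Omega> (e t))"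
          using L2_ip_cong_AE[OF ge[unfolded N_def] geL lu yz] by (simp add: L2_ip_def N_def)
        also have "\<dots> = L_adj \<Omega> (y t) (e t) - L_adj \<Omega> (z t) (e t)"
          unfolding L2_ip_diff_left[OF yL zL geL] by (simp add: L2_ip_def L_adj_def)
        also have "\<dots> = - \<xi> t (e t)"
          using bspec[OF elim(2)[unfolded eq_V_dual_def] et] bspec[OF elim(3)[unfolded eq_V_dual_def] et]
          unfolding weak_div_def \<xi>_def by linarith
        finally show ?thesis .
      qed
      ultimately show ?case by linarith
    qed
  qed
  have "(LINT t|M. 1 / (2 * \<nu>) * A1 t + g * A2 t - A3 t + \<nu> / 2 * A4 t - A6 t)
      = (LINT t|M. 1 / (2 * \<nu>) * B1 t - B3 t - \<xi> t (e t))"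
  proof (rule integral_cong_AE[OF _ _ main])
    show "(\<lambda>t. 1 / (2 * \<nu>) * A1 t + g * A2 t - A3 t + \<nu> / 2 * A4 t - A6 t) \<in> borel_measurable M"
      using iA1 iA2 iA3 iA4 iA6 by (intro borel_measurable_integrable Bochner_Integration.integrable_add
        Bochner_Integration.integrable_diff integrable_mult_right)
    show "(\<lambda>t. 1 / (2 * \<nu>) * B1 t - B3 t - \<xi> t (e t)) \<in> borel_measurable M"
      using iB1 iB3 ixi by (intro borel_measurable_integrable Bochner_Integration.integrable_diff integrable_mult_right)
  qed
  moreover have "(LINT t|M. 1 / (2 * \<nu>) * A1 t + g * A2 t - A3 t + \<nu> / 2 * A4 t - A6 t)
    = 1 / (2 * \<nu>) * (LINT t|M. A1 t) + g * (LINT t|M. A2 t) - (LINT t|M. A3 t) + \<nu> / 2 * (LINT t|M. A4 t) - (LINT t|M. A6 t)"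
    using iA1 iA2 iA3 iA4 iA6 by simp
  moreover have "(LINT t|M. 1 / (2 * \<nu>) * B1 t - B3 t - \<xi> t (e t))
    = 1 / (2 * \<nu>) * (LINT t|M. B1 t) - (LINT t|M. B3 t) - (LINT t|M. \<xi> t (e t))"
    using iB1 iB3 ixi by simp
  ultimately have total: "1 / (2 * \<nu>) * (LINT t|M. A1 t) + g * (LINT t|M. A2 t) - (LINT t|M. A3 t) + \<nu> / 2 * (LINT t|M. A4 t) - (LINT t|M. A6 t)
    = 1 / (2 * \<nu>) * (LINT t|M. B1 t) - (LINT t|M. B3 t) - (LINT t|M. \<xi> t (e t))" by simp
  have t1: "(norm_Q T \<Omega> (\<lambda>t x. (y t x - z t x) - (proj_ball g (y t x) - proj_ball g (z t x))))\<^sup>2 = (LINT t|M. A1 t)"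
    unfolding norm_Q_sq by (simp add: A1_def PY_def PZ_def M_def N_def)
  have t2: "norm1_Q T \<Omega> (\<lambda>t. grad \<Omega> (u t)) = (LINT t|M. A2 t)"
    by (simp add: norm1_Q_def A2_def U_def M_def N_def)
  have t3: "inner_Q T \<Omega> (\<lambda>t x. proj_ball g (y t x)) (\<lambda>t. grad \<Omega> (u t)) = (LINT t|M. A3 t)"
    by (simp add: inner_Q_def A3_def PY_def U_def M_def N_def)
  have t4: "(norm_Q T \<Omega> (\<lambda>t. grad \<Omega> (\<lambda>x. lam t x - u t x)))\<^sup>2 = (LINT t|M. A4 t)"
    unfolding norm_Q_sq by (simp add: A4_def M_def N_def)
  have t6: "inner_Q T \<Omega> (\<lambda>t x. proj_ball g (z t x)) (\<lambda>t. grad \<Omega> (lam t)) = (LINT t|M. A6 t)"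
    by (simp add: inner_Q_def A6_def PZ_def L_def M_def N_def)
  have s1: "(norm_Q T \<Omega> (\<lambda>t x. y t x - proj_ball g (y t x) - \<nu> *\<^sub>R grad \<Omega> (lam t) x))\<^sup>2 = (LINT t|M. B1 t)"
    unfolding norm_Q_sq by (simp add: B1_def PY_def L_def M_def N_def)
  have s3: "inner_Q T \<Omega> (\<lambda>t x. proj_ball g (y t x)) (\<lambda>t. grad \<Omega> (lam t)) = (LINT t|M. B3 t)"
    by (simp add: inner_Q_def B3_def PY_def L_def M_def N_def)
  \<comment> \<open>Integration by parts trades the integral of \<open>\<xi> t (e t)\<close> for the
    difference of the end values.\<close>
  have ends: "1 / 2 * (L2_norm \<Omega> (continuous_rep T \<Omega> (\<lambda>t x. lam t x - u t x) T))\<^sup>2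
    = 1 / 2 * (L2_norm \<Omega> (\<lambda>x. continuous_rep T \<Omega> lam 0 x - u0 x))\<^sup>2 + (LINT t|M. \<xi> t (e t))"
    using endT end0 ce(2) by (simp add: e_def[abs_def])
  show ?thesis
    unfolding t1 t2 t3 t4 t6 s1 s3 ends using total by linarith
qed

end
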